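(* There is a categorical duality (that is, a contravariant equivalence of categories) between the following two categories. (1) The category $\mathscr A$ whose objects are the $\{;,\mathsf A,\mathsf R,\sqcup\}$-algebras representable by partial functions and whose morphisms are the homomorphisms of $\{;,\mathsf A,\mathsf R,\sqcup\}$-algebras. (2) The category $\mathscr C$ whose objects are the Stone étale categories all of whose arrows are epimorphisms and whose morphisms are the star-coherent multivalued functors of topological categories.
   Context: **Algebras.** A partial function on a set $X$ is a subset $f\subseteq X\times X$ such that $(x,y)\in f$ and $(x,z)\in f$ imply $y=z$. An algebra of partial functions of the signature $\{;,\mathsf A,\mathsf R,\sqcup\}$ is a nonempty set of partial functions on a common (possibly empty) set $X$, closed under the following operations and equipped with them: composition $f;g=\{(x,z)\mid \exists y: (x,y)\in f,\ (y,z)\in g\}$ (first function on the left); antidomain $\mathsf A(f)=\{(x,x)\in X^2\mid \text{there is no } y \text{ with }(x,y)\in f\}$; range $\mathsf R(f)=\{(y,y)\in X^2\mid \exists x: (x,y)\in f\}$; preferential union $f\sqcup g$, with $(f\sqcup g)(x)=f(x)$ if $f(x)$ is defined, $=g(x)$ if $f(x)$ is undefined but $g(x)$ is defined, and undefined otherwise. An abstract algebra of this signature ($;$ and $\sqcup$ binary, $\mathsf A$ and $\mathsf R$ unary) is representable (by partial functions) if it is isomorphic to an algebra of partial functions. **Topological categories.** Composition in small categories is written $f\cdot g$ with the first arrow on the left; categories may be empty. A topological category is a small category whose set of objects $O$ and set of arrows $M$ are topological spaces such that the source map $\mathbf d\colon M\to O$, the target map $\mathbf r\colon M\to O$, the composition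 map $M\times_O M\to M$ (with $M\times_O M\subseteq M\times M$ carrying the subspace topology), and the identity-assigning map $x\mapsto 1_x$ are continuous. A local homeomorphism $\pi\colon X\to Y$ is a continuous map such that each $x\in X$ has an open neighbourhood $U$ with $\pi(U)$ open and $\pi|_U\colon U\to\pi(U)$ a homeomorphism. An étale category is a topological category for which $\mathbf d$ is a local homeomorphism and $\mathbf r$ is an open map. It is Stone if its space of objects is a Stone space (compact and totally separated). An arrow $f$ is an epimorphism if $f\cdot g=f\cdot h$ implies $g=h$. **Multivalued functors.** A multivalued functor $F\colon\mathcal C\to\mathcal D$ between categories consists of a function from objects of $\mathcal C$ to objects of $\mathcal D$ and a relation from arrows of $\mathcal C$ to arrows of $\mathcal D$ (both written $F$; $F(f)$ is the set of arrows related to $f$, possibly empty) such that: (1) if $f\colon x\to y$ and $g\in F(f)$ then $g\colon F(x)\to F(y)$; (2) $1_{F(x)}\in F(1_x)$ for each object $x$; (3) if $f_1\cdot f_2$ is defined, $g_1\in F(f_1)$ and $g_2\in F(f_2)$, then $g_1\cdot g_2\in F(f_1\cdot f_2)$. Between topological categories, one also requires that the object component is continuous and that the arrow component is a continuous relation: for every open set $U$ of arrows of $\mathcal D$, $F^{-1}(U)=\{f\mid F(f)\cap U\neq\emptyset\}$ is open. Write $\operatorname{Hom}(x,-)$ (resp. $\operatorname{Hom}(-,x)$) for the set of all arrows with source (resp. target) $x$. $F$ is star injective if for all arrows $f_1,f_2$ of $\mathcal C$ with the same source, $F(f_1)\cap F(f_2)\neq\emptyset$ implies $f_1=f_2$.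 $F$ is star surjective if for every object $x$ of $\mathcal C$ and every $g\in\operatorname{Hom}(F(x),-)$ there is $f\in\operatorname{Hom}(x,-)$ with $g\in F(f)$. $F$ (between topological categories) is co-pseudo star surjective if whenever $x$ is an object of $\mathcal C$, $U$ is an open set of arrows of $\mathcal D$ and $U\cap\operatorname{Hom}(-,F(x))\neq\emptyset$, there exist $g\in U$ and $f\in\operatorname{Hom}(-,x)$ with $g\in F(f)$. $F$ is star coherent if it is star injective, star surjective and co-pseudo star surjective. Multivalued functors are composed by composing the object functions and composing the arrow relations. *)

theory Defs
  imports "HOL-Analysis.Analysis"
begin

section \<open>Algebras of partial functions\<close>

record 'a alg =
  carr :: "'a set"
  seq  :: "'a \<Rightarrow> 'a \<Rightarrow> 'a"
  adom :: "'a \<Rightarrow> 'a"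
  rng  :: "'a \<Rightarrow> 'a"
  pref :: "'a \<Rightarrow> 'a \<Rightarrow> 'a"

definition algebra_sig :: "'a alg \<Rightarrow> bool" where
  "algebra_sig A \<longleftrightarrow> carr A \<noteq> {} \<and>
     (\<forall>a\<in>carr A. adom A a \<in> carr A \<and> rng A a \<in> carr A) \<and>
     (\<forall>a\<in>carr A. \<forall>b\<in>carr A. seq A a b \<in> carr A \<and> pref A a b \<in> carr A)"

text \<open>Homomorphisms are extensional on the carrier, so that two homomorphisms are equal as
  functions exactly when they agree on the carrier of their source.\<close>

definition alg_hom :: "'a alg \<Rightarrow> 'b alg \<Rightarrow> ('a \<Rightarrow> 'b) set" where
  "alg_hom A B = {h \<in> carr A \<rightarrow>\<^sub>E carr B.
     (\<forall>a\<in>carr A. h (adom A a) = adom B (h a) \<and> h (rng A a) = rng B (h a)) \<and>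
     (\<forall>a\<in>carr A. \<forall>b\<in>carr A.
        h (seq A a b) = seq B (h a) (h b) \<and> h (pref A a b) = pref B (h a) (h b))}"

definition alg_id :: "'a alg \<Rightarrow> 'a \<Rightarrow> 'a" where
  "alg_id A = (\<lambda>a\<in>carr A. a)"

text \<open>Composition of morphisms is in diagrammatic order: first \<open>h\<close>, then \<open>k\<close>.\<close>

definition alg_comp :: "'a alg \<Rightarrow> ('a \<Rightarrow> 'b) \<Rightarrow> ('b \<Rightarrow> 'c) \<Rightarrow> 'a \<Rightarrow> 'c" where
  "alg_comp A h k = compose (carr A) k h"

definition alg_iso :: "'a alg \<Rightarrow> 'b alg \<Rightarrow> ('a \<Rightarrow> 'b) \<Rightarrow> bool" where
  "alg_iso A B h \<longleftrightarrow> h \<in> alg_hom A B \<and>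
     (\<exists>k\<in>alg_hom B A. alg_comp A h k = alg_id A \<and> alg_comp B k h = alg_id B)"

definition pf_adom :: "'x set \<Rightarrow> ('x \<times> 'x) set \<Rightarrow> ('x \<times> 'x) set" where
  "pf_adom X f = {(x, x) |x. x \<in> X \<and> (\<nexists>y. (x, y) \<in> f)}"

definition pf_rng :: "('x \<times> 'x) set \<Rightarrow> ('x \<times> 'x) set" where
  "pf_rng f = {(y, y) |y. \<exists>x. (x, y) \<in> f}"

definition pf_pref :: "('x \<times> 'x) set \<Rightarrow> ('x \<times> 'x) set \<Rightarrow> ('x \<times> 'x) set" where
  "pf_pref f g = {(x, y). (x, y) \<in> f \<or> ((\<nexists>z. (x, z) \<in> f) \<and> (x, y) \<in> g)}"

definition pf_alg :: "'x set \<Rightarrow> ('x \<times> 'x) set set \<Rightarrow> ('x \<times> 'x) set alg" where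
  "pf_alg X \<F> = \<lparr>carr = \<F>, seq = (\<lambda>f g. f O g), adom = pf_adom X, rng = pf_rng, pref = pf_pref\<rparr>"

definition algebra_of_partial_functions :: "'x set \<Rightarrow> ('x \<times> 'x) set set \<Rightarrow> bool" where
  "algebra_of_partial_functions X \<F> \<longleftrightarrow>
     (\<forall>f\<in>\<F>. f \<subseteq> X \<times> X \<and> single_valued f) \<and> algebra_sig (pf_alg X \<F>)"

definition representable_over :: "'x itself \<Rightarrow> 'a alg \<Rightarrow> bool" where
  "representable_over _ A \<longleftrightarrow> algebra_sig A \<and>
     (\<exists>(X :: 'x set) \<F> h. algebra_of_partial_functions X \<F> \<and> alg_iso A (pf_alg X \<F>) h)"

text \<open>HOL cannot quantify over the type of base points. The base type chosen here is large enough
  to lose nothing: lemma \<open>representable_overD\<close> below shows that an algebra representable over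
  any type at all is representable over this one.\<close>

definition representable :: "'a alg \<Rightarrow> bool" where
  "representable A \<longleftrightarrow> representable_over TYPE(('a \<times> bool) list) A"

section \<open>Stone etale categories\<close>

text \<open>The sets of objects and arrows are the \<open>topspace\<close>s of the two topologies;
  \<open>cmp C f g\<close> is the composite \<open>f\<cdot>g\<close> (first arrow on the left),
  meaningful only when \<open>tgt C f = src C g\<close>.\<close>

record ('o, 'm) tcat =
  objs :: "'o topology"
  arrs :: "'m topology"
  src  :: "'m \<Rightarrow> 'o"
  tgt  :: "'m \<Rightarrow> 'o"
  cmp  :: "'m \<Rightarrow> 'm \<Rightarrow> 'm"
  idn  :: "'o \<Rightarrow> 'm"

abbreviation Ob :: "('o, 'm) tcat \<Rightarrow> 'o set" where "Ob C \<equiv> topspace (objs C)"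
abbreviation Ar :: "('o, 'm) tcat \<Rightarrow> 'm set" where "Ar C \<equiv> topspace (arrs C)"

definition composable :: "('o, 'm) tcat \<Rightarrow> ('m \<times> 'm) set" where
  "composable C = {(f, g). f \<in> Ar C \<and> g \<in> Ar C \<and> tgt C f = src C g}"

definition small_category :: "('o, 'm) tcat \<Rightarrow> bool" where
  "small_category C \<longleftrightarrow>
     (\<forall>f\<in>Ar C. src C f \<in> Ob C \<and> tgt C f \<in> Ob C) \<and>
     (\<forall>x\<in>Ob C. idn C x \<in> Ar C \<and> src C (idn C x) = x \<and> tgt C (idn C x) = x) \<and>
     (\<forall>(f, g)\<in>composable C. cmp C f g \<in> Ar C \<and>
        src C (cmp C f g) = src C f \<and> tgt C (cmp C f g) = tgt C g) \<and>
     (\<forall>f\<in>Ar C. cmp C (idn C (src C f)) f = f \<and> cmp C f (idn C (tgt C f)) = f) \<and>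
     (\<forall>f g h. (f, g) \<in> composable C \<and> (g, h) \<in> composable C \<longrightarrow>
        cmp C (cmp C f g) h = cmp C f (cmp C g h))"

definition topological_category :: "('o, 'm) tcat \<Rightarrow> bool" where
  "topological_category C \<longleftrightarrow> small_category C \<and>
     continuous_map (arrs C) (objs C) (src C) \<and>
     continuous_map (arrs C) (objs C) (tgt C) \<and>
     continuous_map (subtopology (prod_topology (arrs C) (arrs C)) (composable C)) (arrs C)
       (\<lambda>(f, g). cmp C f g) \<and>
     continuous_map (objs C) (arrs C) (idn C)"

definition local_homeomorphism :: "'a topology \<Rightarrow> 'b topology \<Rightarrow> ('a \<Rightarrow> 'b) \<Rightarrow> bool" where
  "local_homeomorphism X Y p \<longleftrightarrow> continuous_map X Y p \<and>
     (\<forall>x\<in>topspace X. \<exists>U. openin X U \<and> x \<in> U \<and> openin Y (p ` U) \<and>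
        homeomorphic_map (subtopology X U) (subtopology Y (p ` U)) p)"

definition etale_category :: "('o, 'm) tcat \<Rightarrow> bool" where
  "etale_category C \<longleftrightarrow> topological_category C \<and>
     local_homeomorphism (arrs C) (objs C) (src C) \<and> open_map (arrs C) (objs C) (tgt C)"

definition totally_separated_space :: "'a topology \<Rightarrow> bool" where
  "totally_separated_space X \<longleftrightarrow>
     (\<forall>x\<in>topspace X. \<forall>y\<in>topspace X. x \<noteq> y \<longrightarrow>
        (\<exists>U. openin X U \<and> closedin X U \<and> x \<in> U \<and> y \<notin> U))"

definition Stone_space :: "'a topology \<Rightarrow> bool" where
  "Stone_space X \<longleftrightarrow> compact_space X \<and> totally_separated_space X"

definition epi_arrow :: "('o, 'm) tcat \<Rightarrow> 'm \<Rightarrow> bool" where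
  "epi_arrow C f \<longleftrightarrow>
     (\<forall>g h. (f, g) \<in> composable C \<and> (f, h) \<in> composable C \<and> cmp C f g = cmp C f h \<longrightarrow> g = h)"

definition Stone_etale_epi :: "('o, 'm) tcat \<Rightarrow> bool" where
  "Stone_etale_epi C \<longleftrightarrow>
     etale_category C \<and> Stone_space (objs C) \<and> (\<forall>f\<in>Ar C. epi_arrow C f)"

section \<open>Multivalued functors\<close>

record ('o, 'm, 'p, 'n) mvf =
  fobj :: "'o \<Rightarrow> 'p"
  farr :: "('m \<times> 'n) set"

text \<open>As for homomorphisms, extensionality of the object part makes equality of records the
  equality of multivalued functors.\<close>

definition multivalued_functor ::
  "('o, 'm) tcat \<Rightarrow> ('p, 'n) tcat \<Rightarrow> ('o, 'm, 'p, 'n) mvf \<Rightarrow> bool" where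
  "multivalued_functor C D F \<longleftrightarrow>
     fobj F \<in> Ob C \<rightarrow>\<^sub>E Ob D \<and> farr F \<subseteq> Ar C \<times> Ar D \<and>
     (\<forall>(f, g)\<in>farr F. src D g = fobj F (src C f) \<and> tgt D g = fobj F (tgt C f)) \<and>
     (\<forall>x\<in>Ob C. (idn C x, idn D (fobj F x)) \<in> farr F) \<and>
     (\<forall>f1 f2 g1 g2. (f1, f2) \<in> composable C \<and> (f1, g1) \<in> farr F \<and> (f2, g2) \<in> farr F \<longrightarrow>
        (cmp C f1 f2, cmp D g1 g2) \<in> farr F)"

definition continuous_mvf ::
  "('o, 'm) tcat \<Rightarrow> ('p, 'n) tcat \<Rightarrow> ('o, 'm, 'p, 'n) mvf \<Rightarrow> bool" where
  "continuous_mvf C D F \<longleftrightarrow> continuous_map (objs C) (objs D) (fobj F) \<and>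
     (\<forall>U. openin (arrs D) U \<longrightarrow> openin (arrs C) {f \<in> Ar C. farr F `` {f} \<inter> U \<noteq> {}})"

definition star_injective ::
  "('o, 'm) tcat \<Rightarrow> ('o, 'm, 'p, 'n) mvf \<Rightarrow> bool" where
  "star_injective C F \<longleftrightarrow> (\<forall>f1\<in>Ar C. \<forall>f2\<in>Ar C.
     src C f1 = src C f2 \<and> farr F `` {f1} \<inter> farr F `` {f2} \<noteq> {} \<longrightarrow> f1 = f2)"

definition star_surjective ::
  "('o, 'm) tcat \<Rightarrow> ('p, 'n) tcat \<Rightarrow> ('o, 'm, 'p, 'n) mvf \<Rightarrow> bool" where
  "star_surjective C D F \<longleftrightarrow> (\<forall>x\<in>Ob C. \<forall>g\<in>Ar D. src D g = fobj F x \<longrightarrow>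
     (\<exists>f\<in>Ar C. src C f = x \<and> (f, g) \<in> farr F))"

definition co_pseudo_star_surjective ::
  "('o, 'm) tcat \<Rightarrow> ('p, 'n) tcat \<Rightarrow> ('o, 'm, 'p, 'n) mvf \<Rightarrow> bool" where
  "co_pseudo_star_surjective C D F \<longleftrightarrow>
     (\<forall>x\<in>Ob C. \<forall>U. openin (arrs D) U \<and> U \<inter> {g \<in> Ar D. tgt D g = fobj F x} \<noteq> {} \<longrightarrow>
        (\<exists>g\<in>U. \<exists>f\<in>Ar C. tgt C f = x \<and> (f, g) \<in> farr F))"

definition star_coherent ::
  "('o, 'm) tcat \<Rightarrow> ('p, 'n) tcat \<Rightarrow> ('o, 'm, 'p, 'n) mvf \<Rightarrow> bool" where
  "star_coherent C D F \<longleftrightarrow>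
     star_injective C F \<and> star_surjective C D F \<and> co_pseudo_star_surjective C D F"

definition cat_hom :: "('o, 'm) tcat \<Rightarrow> ('p, 'n) tcat \<Rightarrow> ('o, 'm, 'p, 'n) mvf set" where
  "cat_hom C D = {F. multivalued_functor C D F \<and> continuous_mvf C D F \<and> star_coherent C D F}"

definition cat_id :: "('o, 'm) tcat \<Rightarrow> ('o, 'm, 'o, 'm) mvf" where
  "cat_id C = \<lparr>fobj = (\<lambda>x\<in>Ob C. x), farr = Id_on (Ar C)\<rparr>"

text \<open>Diagrammatic order again: first \<open>F\<close>, then \<open>G\<close>.\<close>

definition cat_comp :: "('o, 'm) tcat \<Rightarrow> ('o, 'm, 'p, 'n) mvf \<Rightarrow> ('p, 'n, 'q, 'l) mvf \<Rightarrow>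
    ('o, 'm, 'q, 'l) mvf" where
  "cat_comp C F G = \<lparr>fobj = compose (Ob C) (fobj G) (fobj F), farr = farr F O farr G\<rparr>"

definition cat_iso :: "('o, 'm) tcat \<Rightarrow> ('p, 'n) tcat \<Rightarrow> ('o, 'm, 'p, 'n) mvf \<Rightarrow> bool" where
  "cat_iso C D F \<longleftrightarrow> F \<in> cat_hom C D \<and>
     (\<exists>G\<in>cat_hom D C. cat_comp C F G = cat_id C \<and> cat_comp D G F = cat_id D)"

section \<open>From algebras to categories\<close>

text \<open>The objects of the dual of \<open>A\<close> are the ultrafilters of the Boolean algebra of domain
  elements, with meet \<open>;\<close> and complement the antidomain. The arrows with source \<open>p\<close> are the
  germs at \<open>p\<close> of the elements \<open>a\<close> whose domain belongs to \<open>p\<close>, where \<open>a\<close> and \<open>b\<close> have the same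
  germ if they agree on some member of \<open>p\<close>. A germ is encoded as the set of elements having it;
  its source and target are recovered as the sets of domain elements that restrict some
  representative trivially on the left, respectively on the right.\<close>

definition dom_elems :: "'a alg \<Rightarrow> 'a set" where
  "dom_elems A = adom A ` carr A"

definition alg_ultrafilter :: "'a alg \<Rightarrow> 'a set \<Rightarrow> bool" where
  "alg_ultrafilter A p \<longleftrightarrow> p \<subseteq> dom_elems A \<and>
     (\<forall>d\<in>dom_elems A. \<forall>e\<in>dom_elems A. seq A d e \<in> p \<longleftrightarrow> d \<in> p \<and> e \<in> p) \<and>
     (\<forall>e\<in>dom_elems A. adom A e \<in> p \<longleftrightarrow> e \<notin> p)"

definition germ :: "'a alg \<Rightarrow> 'a set \<Rightarrow> 'a \<Rightarrow> 'a set" where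
  "germ A p a = {b \<in> carr A. \<exists>e\<in>p. seq A e a = seq A e b}"

definition germs :: "'a alg \<Rightarrow> 'a set set" where
  "germs A = {germ A p a |p a. alg_ultrafilter A p \<and> a \<in> carr A \<and> adom A (adom A a) \<in> p}"

definition germ_src :: "'a alg \<Rightarrow> 'a set \<Rightarrow> 'a set" where
  "germ_src A \<alpha> = {e \<in> dom_elems A. \<exists>a\<in>\<alpha>. seq A e a = a}"

definition germ_tgt :: "'a alg \<Rightarrow> 'a set \<Rightarrow> 'a set" where
  "germ_tgt A \<alpha> = {e \<in> dom_elems A. \<exists>a\<in>\<alpha>. seq A a e = a}"

definition dual_cat :: "'a alg \<Rightarrow> ('a set, 'a set) tcat" where
  "dual_cat A = \<lparr>
     objs = topology_generated_by {{p. alg_ultrafilter A p \<and> e \<in> p} |e. e \<in> dom_elems A},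
     arrs = topology_generated_by {{\<alpha> \<in> germs A. a \<in> \<alpha>} |a. a \<in> carr A},
     src = germ_src A,
     tgt = germ_tgt A,
     cmp = (\<lambda>\<alpha> \<beta>. \<Union>a\<in>\<alpha>. \<Union>b\<in>\<beta>. germ A (germ_src A \<alpha>) (seq A a b)),
     idn = (\<lambda>p. \<Union>e\<in>p. germ A p e)\<rparr>"

text \<open>A germ \<open>\<beta>\<close> of \<open>B\<close> is related to those germs \<open>\<alpha>\<close> of \<open>A\<close> all of whose representatives are sent
  by \<open>h\<close> to representatives of \<open>\<beta>\<close>.\<close>

definition dual_hom :: "'a alg \<Rightarrow> 'b alg \<Rightarrow> ('a \<Rightarrow> 'b) \<Rightarrow> ('b set, 'b set, 'a set, 'a set) mvf" where
  "dual_hom A B h = \<lparr>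
     fobj = (\<lambda>q\<in>Ob (dual_cat B). {e \<in> dom_elems A. h e \<in> q}),
     farr = {(\<beta>, \<alpha>). \<beta> \<in> Ar (dual_cat B) \<and> \<alpha> \<in> Ar (dual_cat A) \<and> h ` \<alpha> \<subseteq> \<beta>}\<rparr>"

section \<open>From categories to algebras\<close>

text \<open>The elements are the compact open sets of arrows on which the source map is injective.\<close>

definition sections_alg :: "('o, 'm) tcat \<Rightarrow> 'm set alg" where
  "sections_alg C = \<lparr>
     carr = {U. openin (arrs C) U \<and> compactin (arrs C) U \<and> inj_on (src C) U},
     seq = (\<lambda>U V. {cmp C f g |f g. f \<in> U \<and> g \<in> V \<and> tgt C f = src C g}),
     adom = (\<lambda>U. idn C ` (Ob C - src C ` U)),
     rng = (\<lambda>U. idn C ` (tgt C ` U)),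
     pref = (\<lambda>U V. U \<union> {g \<in> V. src C g \<notin> src C ` U})\<rparr>"

definition sections_hom :: "('o, 'm) tcat \<Rightarrow> ('p, 'n) tcat \<Rightarrow> ('o, 'm, 'p, 'n) mvf \<Rightarrow>
    'n set \<Rightarrow> 'm set" where
  "sections_hom C D F = (\<lambda>U\<in>carr (sections_alg D). {f \<in> Ar C. farr F `` {f} \<inter> U \<noteq> {}})"

section \<open>Unit and counit\<close>

definition alg_unit :: "'a alg \<Rightarrow> 'a \<Rightarrow> 'a set set" where
  "alg_unit A = (\<lambda>a\<in>carr A. {\<alpha> \<in> germs A. a \<in> \<alpha>})"

definition cat_unit :: "('o, 'm) tcat \<Rightarrow> ('o, 'm, 'm set set, 'm set set) mvf" where
  "cat_unit C = \<lparr>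
     fobj = (\<lambda>x\<in>Ob C. {U \<in> dom_elems (sections_alg C). idn C x \<in> U}),
     farr = {(f, {U \<in> carr (sections_alg C). f \<in> U}) |f. f \<in> Ar C}\<rparr>"

section \<open>The base type in the definition of representability is immaterial\<close>

lemma representable_overI:
  fixes A :: "'a alg" and X :: "'x set"
  assumes A: "algebra_sig A"
    and pf: "\<And>a. a \<in> carr A \<Longrightarrow> \<phi> a \<subseteq> X \<times> X \<and> single_valued (\<phi> a)"
    and inj: "inj_on \<phi> (carr A)"
    and un: "\<And>a. a \<in> carr A \<Longrightarrow> \<phi> (adom A a) = pf_adom X (\<phi> a) \<and> \<phi> (rng A a) = pf_rng (\<phi> a)"
    and bin: "\<And>a b. a \<in> carr A \<Longrightarrow> b \<in> carr A \<Longrightarrow>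
       \<phi> (seq A a b) = \<phi> a O \<phi> b \<and> \<phi> (pref A a b) = pf_pref (\<phi> a) (\<phi> b)"
  shows "representable_over TYPE('x) A"
proof -
  define \<F> where "\<F> = \<phi> ` carr A"
  define h where "h = restrict \<phi> (carr A)"
  define k where "k = restrict (inv_into (carr A) \<phi>) \<F>"
  have cl: "adom A a \<in> carr A" "rng A a \<in> carr A" if "a \<in> carr A" for a
    using A that by (auto simp: algebra_sig_def)
  have cl2: "seq A a b \<in> carr A" "pref A a b \<in> carr A" if "a \<in> carr A" "b \<in> carr A" for a b
    using A that by (auto simp: algebra_sig_def)
  have k\<phi>: "k (\<phi> a) = a" if "a \<in> carr A" for a
    using that inj by (auto simp: k_def \<F>_def)
  have un': "pf_adom X (\<phi> a) = \<phi> (adom A a)" "pf_rng (\<phi> a) = \<phi> (rng A a)" if "a \<in> carr A" for a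
    using un that by auto
  have bin': "\<phi> a O \<phi> b = \<phi> (seq A a b)" "pf_pref (\<phi> a) (\<phi> b) = \<phi> (pref A a b)"
    if "a \<in> carr A" "b \<in> carr A" for a b
    using bin that by auto
  have alg: "algebra_of_partial_functions X \<F>"
    using pf A cl cl2
    by (auto simp: algebra_of_partial_functions_def algebra_sig_def pf_alg_def \<F>_def un' bin')
  have h: "h \<in> alg_hom A (pf_alg X \<F>)"
    using un bin cl cl2 by (auto simp: alg_hom_def pf_alg_def \<F>_def h_def)
  have kmem: "k \<in> alg_hom (pf_alg X \<F>) A"
    unfolding alg_hom_def pf_alg_def
    by (auto simp: \<F>_def un' bin' k\<phi> cl cl2) (auto simp: k_def \<F>_def)
  have "alg_comp A h k = alg_id A" "alg_comp (pf_alg X \<F>) k h = alg_id (pf_alg X \<F>)"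
    by (auto simp: alg_comp_def alg_id_def compose_def fun_eq_iff h_def k\<phi> pf_alg_def \<F>_def)
  then show ?thesis
    using A alg h kmem unfolding representable_over_def alg_iso_def by blast
qed

lemma representable_overE:
  fixes A :: "'a alg"
  assumes "representable_over TYPE('x) A"
  obtains X :: "'x set" and \<phi> where "algebra_sig A"
    and "\<And>a. a \<in> carr A \<Longrightarrow> \<phi> a \<subseteq> X \<times> X \<and> single_valued (\<phi> a)"
    and "inj_on \<phi> (carr A)"
    and "\<And>a. a \<in> carr A \<Longrightarrow> \<phi> (adom A a) = pf_adom X (\<phi> a) \<and> \<phi> (rng A a) = pf_rng (\<phi> a)"
    and "\<And>a b. a \<in> carr A \<Longrightarrow> b \<in> carr A \<Longrightarrow>
       \<phi> (seq A a b) = \<phi> a O \<phi> b \<and> \<phi> (pref A a b) = pf_pref (\<phi> a) (\<phi> b)"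
proof -
  obtain X :: "'x set" and \<F> h where A: "algebra_sig A"
    and pf: "algebra_of_partial_functions X \<F>" and iso: "alg_iso A (pf_alg X \<F>) h"
    using assms unfolding representable_over_def by blast
  obtain k where h: "h \<in> alg_hom A (pf_alg X \<F>)" and k: "alg_comp A h k = alg_id A"
    using iso unfolding alg_iso_def by blast
  have "inj_on h (carr A)"
  proof (rule inj_on_inverseI)
    fix a assume "a \<in> carr A"
    then show "k (h a) = a"
      using fun_cong[OF k, of a] by (simp add: alg_comp_def alg_id_def compose_def)
  qed
  moreover have "h a \<in> \<F>" if "a \<in> carr A" for a
    using h that by (auto simp: alg_hom_def pf_alg_def)
  ultimately show thesis
    using that[of h X] A pf h
    by (auto simp: alg_hom_def pf_alg_def algebra_of_partial_functions_def)
qed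

text \<open>A base of any type can be cut down to a subset that is closed under images and under chosen
  preimages and still separates the elements of the algebra. The points of such a subset are named
  by words.\<close>

lemma representable_overD:
  fixes A :: "'a alg"
  assumes "representable_over TYPE('x) A"
  shows "representable A"
proof -
  obtain X :: "'x set" and \<phi> where A: "algebra_sig A"
    and pf: "\<And>a. a \<in> carr A \<Longrightarrow> \<phi> a \<subseteq> X \<times> X \<and> single_valued (\<phi> a)"
    and inj: "inj_on \<phi> (carr A)"
    and un: "\<And>a. a \<in> carr A \<Longrightarrow> \<phi> (adom A a) = pf_adom X (\<phi> a) \<and> \<phi> (rng A a) = pf_rng (\<phi> a)"
    and bin: "\<And>a b. a \<in> carr A \<Longrightarrow> b \<in> carr A \<Longrightarrow>
       \<phi> (seq A a b) = \<phi> a O \<phi> b \<and> \<phi> (pref A a b) = pf_pref (\<phi> a) (\<phi> b)"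
    using representable_overE[OF assms] by metis
  define wit where "wit a b = (SOME x. \<exists>y. (x, y) \<in> (\<phi> a - \<phi> b) \<union> (\<phi> b - \<phi> a))" for a b
  define step where "step = (\<lambda>(a, c) x.
     if c then (if \<exists>y. (x, y) \<in> \<phi> a then SOME y. (x, y) \<in> \<phi> a else x)
     else (if \<exists>y. (y, x) \<in> \<phi> a then SOME y. (y, x) \<in> \<phi> a else x))"
  define g where "g w = foldr step (tl (tl w)) (wit (fst (hd w)) (fst (hd (tl w))))" for w
  define S where "S = {(a, True) # (b, True) # w |a b w.
     a \<in> carr A \<and> b \<in> carr A \<and> a \<noteq> b \<and> w \<in> lists (carr A \<times> UNIV)}"
  define Y where "Y = g ` S"
  have wit: "\<exists>y. (wit a b, y) \<in> (\<phi> a - \<phi> b) \<union> (\<phi> b - \<phi> a)"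
    if "a \<in> carr A" "b \<in> carr A" "a \<noteq> b" for a b
  proof -
    have "\<phi> a \<noteq> \<phi> b" using inj that by (auto dest: inj_onD)
    then have "\<exists>x y. (x, y) \<in> (\<phi> a - \<phi> b) \<union> (\<phi> b - \<phi> a)" by (auto simp: set_eq_iff)
    then show ?thesis unfolding wit_def by (rule someI_ex)
  qed
  have stepY: "step (a, c) x \<in> Y" if xa: "x \<in> Y" "a \<in> carr A" for a c x
  proof -
    obtain b d w where x: "x = g ((b, True) # (d, True) # w)" and b: "b \<in> carr A" "d \<in> carr A" "b \<noteq> d"
      "w \<in> lists (carr A \<times> UNIV)" using xa(1) unfolding Y_def S_def by blast
    have "step (a, c) x = g ((b, True) # (d, True) # (a, c) # w)"
      unfolding x g_def by simp
    moreover have "(b, True) # (d, True) # (a, c) # w \<in> S"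
      unfolding S_def using b xa(2) by fastforce
    ultimately show ?thesis unfolding Y_def by blast
  qed
  have stepX: "step (a, c) x \<in> X" if "x \<in> X" "a \<in> carr A" for a c x
  proof -
    have "(x, SOME y. (x, y) \<in> \<phi> a) \<in> \<phi> a" if "\<exists>y. (x, y) \<in> \<phi> a" using that by (rule someI_ex)
    moreover have "(SOME y. (y, x) \<in> \<phi> a, x) \<in> \<phi> a" if "\<exists>y. (y, x) \<in> \<phi> a" using that by (rule someI_ex)
    ultimately show ?thesis using that pf[of a] unfolding step_def by auto
  qed
  have fwd: "y \<in> Y" if "x \<in> Y" "a \<in> carr A" "(x, y) \<in> \<phi> a" for a x y
  proof -
    have "(x, step (a, True) x) \<in> \<phi> a"
      using that(3) by (auto simp: step_def intro: someI)
    then have "y = step (a, True) x"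
      using that pf[of a] by (auto simp: single_valued_def)
    then show ?thesis using stepY that by auto
  qed
  have bwd: "\<exists>x\<in>Y. (x, y) \<in> \<phi> a" if "y \<in> Y" "a \<in> carr A" "(x, y) \<in> \<phi> a" for a x y
  proof -
    have "(step (a, False) y, y) \<in> \<phi> a"
      using that(3) by (auto simp: step_def intro: someI)
    then show ?thesis using stepY that by auto
  qed
  have witY: "wit a b \<in> Y" if "a \<in> carr A" "b \<in> carr A" "a \<noteq> b" for a b
  proof -
    have "wit a b = g [(a, True), (b, True)]" by (simp add: g_def)
    moreover have "[(a, True), (b, True)] \<in> S" using that by (auto simp: S_def)
    ultimately show ?thesis unfolding Y_def by blast
  qed
  have YX: "Y \<subseteq> X"
  proof
    fix x assume "x \<in> Y"
    then obtain a b w where x: "x = foldr step w (wit a b)" and ab: "a \<in> carr A" "b \<in> carr A" "a \<noteq> b"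
      and w: "w \<in> lists (carr A \<times> UNIV)" unfolding Y_def S_def g_def by (fastforce simp del: in_lists_conv_set)
    have "foldr step w (wit a b) \<in> X" using w
    proof (induction w)
      case Nil
      then show ?case using wit[OF ab] pf[of a] pf[of b] ab by auto
    next
      case (Cons p w)
      then show ?case using stepX by (cases p) auto
    qed
    then show "x \<in> X" using x by simp
  qed
  define c where "c = inv_into S g"
  have cinj: "c x = c y \<longleftrightarrow> x = y" if "x \<in> Y" "y \<in> Y" for x y
    using inj_onD[OF inj_on_inv_into[of Y g S]] that unfolding c_def Y_def by auto
  define \<psi> where "\<psi> a = {(c x, c y) |x y. x \<in> Y \<and> y \<in> Y \<and> (x, y) \<in> \<phi> a}" for a
  have \<psi>: "(c x, c y) \<in> \<psi> a \<longleftrightarrow> (x, y) \<in> \<phi> a" if "x \<in> Y" "y \<in> Y" for x y a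
    using that cinj unfolding \<psi>_def by blast
  have sub: "\<psi> a \<subseteq> c ` Y \<times> c ` Y" for a unfolding \<psi>_def by blast
  have relI: "R = Q" if "R \<subseteq> c ` Y \<times> c ` Y" "Q \<subseteq> c ` Y \<times> c ` Y"
    "\<And>x y. x \<in> Y \<Longrightarrow> y \<in> Y \<Longrightarrow> (c x, c y) \<in> R \<longleftrightarrow> (c x, c y) \<in> Q" for R Q
    using that by blast
  have ex: "(\<exists>v. (c x, v) \<in> \<psi> a) \<longleftrightarrow> (\<exists>y. (x, y) \<in> \<phi> a)" if "x \<in> Y" "a \<in> carr A" for x a
    using sub[of a] \<psi>[OF that(1), of _ a] fwd[OF that(1,2)] by blast
  have ex2: "(\<exists>v. (v, c y) \<in> \<psi> a) \<longleftrightarrow> (\<exists>x. (x, y) \<in> \<phi> a)" if "y \<in> Y" "a \<in> carr A" for y a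
    using sub[of a] \<psi>[OF _ that(1), of _ a] bwd[OF that(1,2)] by blast
  have "representable_over TYPE(('a \<times> bool) list) A"
  proof (rule representable_overI[where \<phi> = \<psi> and X = "c ` Y"])
    show "algebra_sig A" by (rule A)
  next
    fix a assume a: "a \<in> carr A"
    have "single_valued (\<psi> a)"
      using pf[OF a] cinj unfolding \<psi>_def single_valued_def by blast
    with sub show "\<psi> a \<subseteq> c ` Y \<times> c ` Y \<and> single_valued (\<psi> a)" by blast
    show "\<psi> (adom A a) = pf_adom (c ` Y) (\<psi> a) \<and> \<psi> (rng A a) = pf_rng (\<psi> a)"
    proof
      show "\<psi> (adom A a) = pf_adom (c ` Y) (\<psi> a)"
      proof (rule relI)
        fix x y assume xy: "x \<in> Y" "y \<in> Y"
        have "(c x, c y) \<in> pf_adom (c ` Y) (\<psi> a) \<longleftrightarrow> c x = c y \<and> \<not> (\<exists>v. (c x, v) \<in> \<psi> a)"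
          using xy by (auto simp: pf_adom_def)
        also have "\<dots> \<longleftrightarrow> (x, y) \<in> pf_adom X (\<phi> a)"
          using xy a YX by (auto simp: cinj ex pf_adom_def)
        finally show "(c x, c y) \<in> \<psi> (adom A a) \<longleftrightarrow> (c x, c y) \<in> pf_adom (c ` Y) (\<psi> a)"
          using un[OF a] \<psi>[OF xy] by simp
      qed (use sub in \<open>auto simp: pf_adom_def\<close>)
      show "\<psi> (rng A a) = pf_rng (\<psi> a)"
      proof (rule relI)
        fix x y assume xy: "x \<in> Y" "y \<in> Y"
        have "(c x, c y) \<in> pf_rng (\<psi> a) \<longleftrightarrow> c x = c y \<and> (\<exists>v. (v, c y) \<in> \<psi> a)"
          by (auto simp: pf_rng_def)
        also have "\<dots> \<longleftrightarrow> (x, y) \<in> pf_rng (\<phi> a)"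
          using xy a by (auto simp: cinj ex2 pf_rng_def)
        finally show "(c x, c y) \<in> \<psi> (rng A a) \<longleftrightarrow> (c x, c y) \<in> pf_rng (\<psi> a)"
          using un[OF a] \<psi>[OF xy] by simp
      qed (use sub in \<open>auto simp: pf_rng_def\<close>)
    qed
  next
    show "inj_on \<psi> (carr A)"
    proof (rule inj_onI, rule ccontr)
      fix a b assume ab: "a \<in> carr A" "b \<in> carr A" "\<psi> a = \<psi> b" "a \<noteq> b"
      obtain y where y: "(wit a b, y) \<in> (\<phi> a - \<phi> b) \<union> (\<phi> b - \<phi> a)" using wit ab by blast
      have "y \<in> Y" using y fwd witY ab by blast
      then show False using y \<psi>[OF witY[OF ab(1,2,4)]] ab(3) by blast
    qed
  next
    fix a b assume a: "a \<in> carr A" and b: "b \<in> carr A"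
    show "\<psi> (seq A a b) = \<psi> a O \<psi> b \<and> \<psi> (pref A a b) = pf_pref (\<psi> a) (\<psi> b)"
    proof
      show "\<psi> (seq A a b) = \<psi> a O \<psi> b"
      proof (rule relI)
        fix x y assume xy: "x \<in> Y" "y \<in> Y"
        have "(c x, c y) \<in> \<psi> a O \<psi> b \<longleftrightarrow> (\<exists>z\<in>Y. (c x, c z) \<in> \<psi> a \<and> (c z, c y) \<in> \<psi> b)"
          using sub by blast
        also have "\<dots> \<longleftrightarrow> (x, y) \<in> \<phi> a O \<phi> b"
          using xy fwd[OF xy(1) a] by (auto simp: \<psi>)
        finally show "(c x, c y) \<in> \<psi> (seq A a b) \<longleftrightarrow> (c x, c y) \<in> \<psi> a O \<psi> b"
          using bin[OF a b] \<psi>[OF xy] by simp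
      qed (use sub in blast)+
      show "\<psi> (pref A a b) = pf_pref (\<psi> a) (\<psi> b)"
      proof (rule relI)
        fix x y assume xy: "x \<in> Y" "y \<in> Y"
        have "(c x, c y) \<in> pf_pref (\<psi> a) (\<psi> b) \<longleftrightarrow>
           (c x, c y) \<in> \<psi> a \<or> (\<not> (\<exists>v. (c x, v) \<in> \<psi> a) \<and> (c x, c y) \<in> \<psi> b)"
          by (auto simp: pf_pref_def)
        also have "\<dots> \<longleftrightarrow> (x, y) \<in> pf_pref (\<phi> a) (\<phi> b)"
          unfolding ex[OF xy(1) a] \<psi>[OF xy] by (auto simp: pf_pref_def)
        finally show "(c x, c y) \<in> \<psi> (pref A a b) \<longleftrightarrow> (c x, c y) \<in> pf_pref (\<psi> a) (\<psi> b)"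
          using bin[OF a b] \<psi>[OF xy] by simp
      qed (use sub in \<open>auto simp: pf_pref_def\<close>)
    qed
  qed
  then show ?thesis unfolding representable_def .
qed

end

(*
  The duality assigns to an algebra the category of germs of its elements at the ultrafilters of its
  Boolean algebra of domain elements, and to a category its compact open sections of the source map.
  A representation by partial functions is used only to obtain a few equations, the existence of
  ultrafilters, and the fact that every ultrafilter containing the range of an element is the target
  of one of its germs (whence the target map is open). Conversely, sections are represented on pairs
  (x, S) of an object and a set S of arrows with source x: a section sends (d(u), S) to
  (r(u), {f. u f : S}). It reaches every pair at r(u) precisely because u is an epimorphism.
*)
theory Submission
  imports Defs
begin

section \<open>Topologies with a base closed under intersection\<close>

text \<open>The signature has no intersection, and this shapes the treatment of arrows. The
  ultrafilters at which two elements have the same germ form an open set that need not be closed, so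
  the space of arrows need not be Hausdorff and compact open sections need not be closed under
  intersection. Two operations take its place: restriction to a clopen set of objects, which is
  composition with a domain element, and preferential union, which glues sections lying over
  disjoint clopen sets. Morphisms are multivalued because a homomorphism \<open>h\<close> from
  \<open>A\<close> to \<open>B\<close> dualises to a function on ultrafilters but only to a relation
  on germs: elements with different germs at \<open>p\<close> may acquire equal germs at an
  ultrafilter of \<open>B\<close> above \<open>p\<close>, and a germ of \<open>B\<close> need not
  contain any \<open>h a\<close>. In the other direction, star injectivity makes preimages of
  sections injective over objects, star surjectivity makes taking preimages commute with domains and
  composition, and co-pseudo star surjectivity makes it commute with ranges.\<close>

lemma openin_topology_generated_by_base:
  assumes "\<And>S T x. S \<in> \<B> \<Longrightarrow> T \<in> \<B> \<Longrightarrow> x \<in> S \<inter> T \<Longrightarrow> \<exists>V\<in>\<B>. x \<in> V \<and> V \<subseteq> S \<inter> T"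
  shows "openin (topology_generated_by \<B>) W \<longleftrightarrow> (\<forall>x\<in>W. \<exists>V\<in>\<B>. x \<in> V \<and> V \<subseteq> W)"
proof
  assume "openin (topology_generated_by \<B>) W"
  then have "generate_topology_on \<B> W" by (rule openin_topology_generated_by)
  then show "\<forall>x\<in>W. \<exists>V\<in>\<B>. x \<in> V \<and> V \<subseteq> W"
  proof induction
    \<comment> \<open>The refinement hypothesis enters here. It does not ask for the intersection of
      two basic sets to be basic, which fails for germs.\<close>
    case (Int S T)
    show ?case
    proof
      fix x assume "x \<in> S \<inter> T"
      then obtain V1 V2 where "V1 \<in> \<B>" "V2 \<in> \<B>" "x \<in> V1 \<inter> V2" "V1 \<subseteq> S" "V2 \<subseteq> T"
        using Int.IH by blast
      then show "\<exists>V\<in>\<B>. x \<in> V \<and> V \<subseteq> S \<inter> T" using assms[of V1 V2 x] by blast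
    qed
  next
    case (UN K)
    show ?case
    proof
      fix x assume "x \<in> \<Union>K"
      then obtain k where k: "k \<in> K" "x \<in> k" by blast
      then obtain V where "V \<in> \<B>" "x \<in> V" "V \<subseteq> k" using UN.IH by blast
      with k show "\<exists>V\<in>\<B>. x \<in> V \<and> V \<subseteq> \<Union>K" by blast
    qed
  qed auto
next
  assume R: "\<forall>x\<in>W. \<exists>V\<in>\<B>. x \<in> V \<and> V \<subseteq> W"
  show "openin (topology_generated_by \<B>) W"
  proof (subst openin_subopen, intro ballI)
    fix x assume "x \<in> W"
    then obtain V where "V \<in> \<B>" "x \<in> V" "V \<subseteq> W" using R by blast
    then show "\<exists>T. openin (topology_generated_by \<B>) T \<and> x \<in> T \<and> T \<subseteq> W"
      using topology_generated_by_Basis by blast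
  qed
qed

section \<open>Ultrafilters of sets\<close>

text \<open>Zorn's lemma on families with the finite intersection property: a finite part of the
  union of a chain lies in one member of the chain. If a maximal family contained neither S nor its
  complement, one finite intersection of members would miss S and another would miss the complement,
  so that their common intersection would be empty.\<close>

lemma fip_maximal:
  assumes fip: "\<And>\<G>. finite \<G> \<Longrightarrow> \<G> \<subseteq> \<F> \<Longrightarrow> \<Inter>\<G> \<noteq> {}"
  obtains \<U> where "\<F> \<subseteq> \<U>" "\<And>\<G>. finite \<G> \<Longrightarrow> \<G> \<subseteq> \<U> \<Longrightarrow> \<Inter>\<G> \<noteq> {}" "\<And>S. S \<in> \<U> \<or> - S \<in> \<U>"
proof -
  define \<A> where "\<A> = {\<U>. \<F> \<subseteq> \<U> \<and> (\<forall>\<G>. finite \<G> \<longrightarrow> \<G> \<subseteq> \<U> \<longrightarrow> \<Inter>\<G> \<noteq> {})}"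
  have "\<exists>M\<in>\<A>. \<forall>Z\<in>\<A>. M \<subseteq> Z \<longrightarrow> Z = M"
  proof (rule subset_Zorn_nonempty)
    show "\<A> \<noteq> {}" using fip by (auto simp: \<A>_def)
    fix \<C> assume \<C>: "\<C> \<noteq> {}" "subset.chain \<A> \<C>"
    have "\<Inter>\<G> \<noteq> {}" if G: "finite \<G>" "\<G> \<subseteq> \<Union>\<C>" for \<G>
    proof -
      obtain U where "U \<in> \<C>" "\<G> \<subseteq> U"
        using finite_subset_Union_chain[OF G \<C>] by blast
      then show ?thesis using \<C>(2) G(1) unfolding \<A>_def subset_chain_def by blast
    qed
    then show "\<Union>\<C> \<in> \<A>" using \<C> unfolding \<A>_def subset_chain_def by blast
  qed
  then obtain \<U> where U: "\<U> \<in> \<A>" and max: "\<And>Z. Z \<in> \<A> \<Longrightarrow> \<U> \<subseteq> Z \<Longrightarrow> Z = \<U>" by blast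
  have ex: "\<exists>\<G>. finite \<G> \<and> \<G> \<subseteq> \<U> \<and> \<Inter>\<G> \<inter> S = {}" if S: "S \<notin> \<U>" for S
  proof -
    have "insert S \<U> \<notin> \<A>" using max[of "insert S \<U>"] S by blast
    then obtain \<G> where G: "finite \<G>" "\<G> \<subseteq> insert S \<U>" "\<Inter>\<G> = {}"
      using U unfolding \<A>_def by blast
    then have "finite (\<G> - {S})" "\<G> - {S} \<subseteq> \<U>" "\<Inter>(\<G> - {S}) \<inter> S = {}" by blast+
    then show ?thesis by blast
  qed
  have "S \<in> \<U> \<or> - S \<in> \<U>" for S
  proof (rule ccontr)
    assume "\<not> (S \<in> \<U> \<or> - S \<in> \<U>)"
    then obtain \<G> \<H> where G: "finite \<G>" "\<G> \<subseteq> \<U>" "\<Inter>\<G> \<inter> S = {}"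
      and H: "finite \<H>" "\<H> \<subseteq> \<U>" "\<Inter>\<H> \<inter> - S = {}"
      using ex[of S] ex[of "- S"] by blast
    then have "\<Inter>(\<G> \<union> \<H>) = {}" by blast
    moreover have "\<Inter>(\<G> \<union> \<H>) \<noteq> {}" using U G H unfolding \<A>_def by simp
    ultimately show False by blast
  qed
  then show thesis using U that[of \<U>] by (simp add: \<A>_def)
qed

section \<open>The arithmetic of algebras of partial functions\<close>

text \<open>A fixed faithful representation, with no target algebra mentioned, so that identities of
  \<open>A\<close> can be checked on relations. The type of base points stays free.\<close>

locale pf_rep =
  fixes A :: "'a alg" and X :: "'x set" and \<phi> :: "'a \<Rightarrow> ('x \<times> 'x) set"
  assumes sig: "algebra_sig A"
    and pf: "\<And>a. a \<in> carr A \<Longrightarrow> \<phi> a \<subseteq> X \<times> X \<and> single_valued (\<phi> a)"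
    and inj: "inj_on \<phi> (carr A)"
    and un: "\<And>a. a \<in> carr A \<Longrightarrow> \<phi> (adom A a) = pf_adom X (\<phi> a) \<and> \<phi> (rng A a) = pf_rng (\<phi> a)"
    and bin: "\<And>a b. a \<in> carr A \<Longrightarrow> b \<in> carr A \<Longrightarrow>
       \<phi> (seq A a b) = \<phi> a O \<phi> b \<and> \<phi> (pref A a b) = pf_pref (\<phi> a) (\<phi> b)"

lemma representable_pf_rep:
  fixes A :: "'a alg"
  assumes "representable A"
  obtains X :: "('a \<times> bool) list set" and \<phi> where "pf_rep A X \<phi>"
proof -
  obtain X :: "('a \<times> bool) list set" and \<phi> where "algebra_sig A"
    "\<And>a. a \<in> carr A \<Longrightarrow> \<phi> a \<subseteq> X \<times> X \<and> single_valued (\<phi> a)"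
    "inj_on \<phi> (carr A)"
    "\<And>a. a \<in> carr A \<Longrightarrow> \<phi> (adom A a) = pf_adom X (\<phi> a) \<and> \<phi> (rng A a) = pf_rng (\<phi> a)"
    "\<And>a b. a \<in> carr A \<Longrightarrow> b \<in> carr A \<Longrightarrow>
       \<phi> (seq A a b) = \<phi> a O \<phi> b \<and> \<phi> (pref A a b) = pf_pref (\<phi> a) (\<phi> b)"
    using representable_overE[OF assms[unfolded representable_def]] by metis
  then show thesis using that unfolding pf_rep_def by blast
qed

context pf_rep
begin

section \<open>Equations computed in the representation\<close>

abbreviation mult (infixl "\<cdot>" 70) where "a \<cdot> b \<equiv> seq A a b"
abbreviation E where "E \<equiv> dom_elems A"
abbreviation \<delta> where "\<delta> a \<equiv> adom A (adom A a)"

lemma closed [simp]: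
  "a \<in> carr A \<Longrightarrow> adom A a \<in> carr A" "a \<in> carr A \<Longrightarrow> rng A a \<in> carr A"
  "a \<in> carr A \<Longrightarrow> b \<in> carr A \<Longrightarrow> a \<cdot> b \<in> carr A"
  "a \<in> carr A \<Longrightarrow> b \<in> carr A \<Longrightarrow> pref A a b \<in> carr A"
  using sig by (auto simp: algebra_sig_def)

lemma E_carr [simp]: "e \<in> E \<Longrightarrow> e \<in> carr A"
  by (auto simp: dom_elems_def)

text \<open>Faithfulness of the representation. The equations below are obtained through it by
  computing both sides as relations.\<close>

lemma eqI: "a \<in> carr A \<Longrightarrow> b \<in> carr A \<Longrightarrow> \<phi> a = \<phi> b \<Longrightarrow> a = b"
  using inj by (auto dest: inj_onD)

lemma sv: "a \<in> carr A \<Longrightarrow> (x, y) \<in> \<phi> a \<Longrightarrow> (x, z) \<in> \<phi> a \<Longrightarrow> y = z"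
  using pf[of a] by (auto simp: single_valued_def)

lemma in_X: "a \<in> carr A \<Longrightarrow> (x, y) \<in> \<phi> a \<Longrightarrow> x \<in> X \<and> y \<in> X"
  using pf[of a] by auto

lemma phi_adom: "a \<in> carr A \<Longrightarrow> \<phi> (adom A a) = Id_on (X - Domain (\<phi> a))"
  using un[of a] by (auto simp: pf_adom_def)

lemma phi_rng: "a \<in> carr A \<Longrightarrow> \<phi> (rng A a) = Id_on (Range (\<phi> a))"
  using un[of a] by (auto simp: pf_rng_def)

lemma phi_seq: "a \<in> carr A \<Longrightarrow> b \<in> carr A \<Longrightarrow> \<phi> (a \<cdot> b) = \<phi> a O \<phi> b"
  using bin[of a b] by auto

lemma phi_pref: "a \<in> carr A \<Longrightarrow> b \<in> carr A \<Longrightarrow> \<phi> (pref A a b) = pf_pref (\<phi> a) (\<phi> b)"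
  using bin[of a b] by auto

lemma phi_delta: "a \<in> carr A \<Longrightarrow> \<phi> (\<delta> a) = Id_on (Domain (\<phi> a))"
  using pf[of a] by (auto simp: phi_adom)

text \<open>A domain element acts as the identity on a part of the base; \<open>supp\<close> is that
  part, and turns identities in \<open>E\<close> into identities of sets.\<close>

definition supp :: "'a \<Rightarrow> 'x set" where "supp e = {x. (x, x) \<in> \<phi> e}"

lemma phi_E: "e \<in> E \<Longrightarrow> \<phi> e = Id_on (supp e)"
  by (auto simp: dom_elems_def phi_adom supp_def)

lemma adom_E [simp]: "a \<in> carr A \<Longrightarrow> adom A a \<in> E"
  by (auto simp: dom_elems_def)

text \<open>An element acting as a partial identity equals its own double antidomain. Closure of
  \<open>E\<close> under composition and membership of ranges in \<open>E\<close> follow.\<close>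

lemma idE: assumes "a \<in> carr A" "\<phi> a = Id_on Y" shows "a \<in> E"
proof -
  have "a = \<delta> a" using assms by (intro eqI) (auto simp: phi_delta)
  then show ?thesis using adom_E[of "adom A a"] assms by simp
qed

lemma seq_E [simp]: "d \<in> E \<Longrightarrow> e \<in> E \<Longrightarrow> d \<cdot> e \<in> E"
  by (rule idE[of _ "supp d \<inter> supp e"]) (auto simp: phi_seq phi_E)

lemma rng_E [simp]: "a \<in> carr A \<Longrightarrow> rng A a \<in> E"
  by (rule idE) (auto simp: phi_rng)

lemma assoc: "a \<in> carr A \<Longrightarrow> b \<in> carr A \<Longrightarrow> c \<in> carr A \<Longrightarrow> a \<cdot> b \<cdot> c = a \<cdot> (b \<cdot> c)"
  by (rule eqI) (auto simp: phi_seq O_assoc)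

lemma phi_res: "e \<in> E \<Longrightarrow> a \<in> carr A \<Longrightarrow> \<phi> (e \<cdot> a) = {(x, y) \<in> \<phi> a. x \<in> supp e}"
  by (auto simp: phi_seq phi_E)

lemma phi_cores: "e \<in> E \<Longrightarrow> a \<in> carr A \<Longrightarrow> \<phi> (a \<cdot> e) = {(x, y) \<in> \<phi> a. y \<in> supp e}"
  by (auto simp: phi_seq phi_E)

lemma supp_seq: "d \<in> E \<Longrightarrow> e \<in> E \<Longrightarrow> supp (d \<cdot> e) = supp d \<inter> supp e"
  unfolding supp_def[of "d \<cdot> e"] supp_def[of d] by (auto simp: phi_cores)

lemma supp_adom: "a \<in> carr A \<Longrightarrow> supp (adom A a) = X - Domain (\<phi> a)"
  by (auto simp: supp_def phi_adom)

lemma supp_delta: "a \<in> carr A \<Longrightarrow> supp (\<delta> a) = Domain (\<phi> a)"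
  by (auto simp: supp_def phi_delta)

lemma supp_rng: "a \<in> carr A \<Longrightarrow> supp (rng A a) = Range (\<phi> a)"
  by (auto simp: supp_def phi_rng)

lemma supp_X: "e \<in> E \<Longrightarrow> supp e \<subseteq> X"
  by (auto simp: supp_def dest: in_X[OF E_carr])

lemma E_eqI: "d \<in> E \<Longrightarrow> e \<in> E \<Longrightarrow> supp d = supp e \<Longrightarrow> d = e"
  by (rule eqI) (auto simp: phi_E)

lemma E_comm: "d \<in> E \<Longrightarrow> e \<in> E \<Longrightarrow> d \<cdot> e = e \<cdot> d"
  by (rule E_eqI) (auto simp: supp_seq)

lemma E_idem [simp]: "e \<in> E \<Longrightarrow> e \<cdot> e = e"
  by (rule E_eqI) (auto simp: supp_seq)

lemma delta_E [simp]: "e \<in> E \<Longrightarrow> \<delta> e = e"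
  by (rule E_eqI) (auto simp: supp_delta phi_E)

lemma delta_seq [simp]: "a \<in> carr A \<Longrightarrow> \<delta> a \<cdot> a = a"
  by (rule eqI) (auto simp: phi_res supp_delta)

lemma seq_rng [simp]: "a \<in> carr A \<Longrightarrow> a \<cdot> rng A a = a"
  by (rule eqI) (auto simp: phi_cores supp_rng)

lemma delta_res: "e \<in> E \<Longrightarrow> a \<in> carr A \<Longrightarrow> \<delta> (e \<cdot> a) = e \<cdot> \<delta> a"
  by (rule E_eqI) (auto simp: phi_res supp_delta supp_seq)

lemma delta_seq_delta: "a \<in> carr A \<Longrightarrow> b \<in> carr A \<Longrightarrow> \<delta> (a \<cdot> b) = \<delta> (a \<cdot> \<delta> b)"
  by (rule E_eqI) (auto simp: supp_delta phi_seq phi_delta)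

text \<open>By single-valuedness, restricting the output of \<open>a\<close> to \<open>e\<close> is
  restricting its input to the points sent into \<open>e\<close>. Germs are defined by restriction
  on the left; this law moves a test from the right to the left and so gives access to
  targets.\<close>

lemma twist: "a \<in> carr A \<Longrightarrow> e \<in> E \<Longrightarrow> a \<cdot> e = \<delta> (a \<cdot> e) \<cdot> a"
  by (rule eqI) (auto simp: phi_res phi_cores supp_delta dest: sv)

text \<open>Together with \<open>delta_compl\<close>: the preimage map \<delta> (a \<cdot> e), as a
  function of \<open>e\<close>, is a Boolean homomorphism into the domain elements below \<delta> a,
  because \<open>a\<close> is single valued. This is why the target of a germ is an
  ultrafilter.\<close>

lemma delta_meet: "a \<in> carr A \<Longrightarrow> d \<in> E \<Longrightarrow> e \<in> E \<Longrightarrow> \<delta> (a \<cdot> (d \<cdot> e)) = \<delta> (a \<cdot> d) \<cdot> \<delta> (a \<cdot> e)"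
  by (rule E_eqI) (auto simp: supp_delta phi_cores supp_seq dest: sv)

lemma delta_compl: "a \<in> carr A \<Longrightarrow> e \<in> E \<Longrightarrow> \<delta> (a \<cdot> adom A e) = \<delta> a \<cdot> adom A (a \<cdot> e)"
  by (rule E_eqI) (auto simp: supp_delta phi_cores supp_adom supp_seq phi_E dest: sv in_X)

text \<open>A point \<open>y\<close> in the range of \<open>a\<close> comes from some
  \<open>x\<close> having no other image, so the values of \<open>b\<close> and \<open>c\<close> at
  \<open>y\<close> can be read off from the two composites at \<open>x\<close>. This is the
  algebraic source of the epimorphism property of germs.\<close>

lemma rng_cancel:
  assumes a: "a \<in> carr A" "b \<in> carr A" "c \<in> carr A" "a \<cdot> b = a \<cdot> c"
  shows "rng A a \<cdot> b = rng A a \<cdot> c"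
proof (rule eqI)
  have "\<phi> a O \<phi> b = \<phi> a O \<phi> c" using a by (metis phi_seq)
  then have "(y, z) \<in> \<phi> b \<longleftrightarrow> (y, z) \<in> \<phi> c" if "(x, y) \<in> \<phi> a" for x y z
    using sv[OF a(1) that] that by blast
  then show "\<phi> (rng A a \<cdot> b) = \<phi> (rng A a \<cdot> c)"
    using a by (auto simp: phi_res supp_rng)
qed (use a in auto)

text \<open>Together with \<open>pref_cores\<close> this determines the preferential union on the
  two complementary domain elements; germs will be split along them.\<close>

lemma pref_res: "a \<in> carr A \<Longrightarrow> b \<in> carr A \<Longrightarrow> \<delta> a \<cdot> pref A a b = a"
  by (rule eqI) (auto simp: phi_res supp_delta phi_pref pf_pref_def)

lemma pref_cores: "a \<in> carr A \<Longrightarrow> b \<in> carr A \<Longrightarrow> adom A a \<cdot> pref A a b = adom A a \<cdot> b"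
  by (rule eqI) (auto simp: phi_res supp_adom phi_pref pf_pref_def dest: in_X)

section \<open>Ultrafilters of domain elements\<close>

abbreviation uf where "uf \<equiv> alg_ultrafilter A"

lemma uf_E: "uf p \<Longrightarrow> e \<in> p \<Longrightarrow> e \<in> E"
  by (auto simp: alg_ultrafilter_def)

lemma uf_seq: "uf p \<Longrightarrow> d \<in> E \<Longrightarrow> e \<in> E \<Longrightarrow> d \<cdot> e \<in> p \<longleftrightarrow> d \<in> p \<and> e \<in> p"
  by (auto simp: alg_ultrafilter_def)

lemma uf_adom: "uf p \<Longrightarrow> e \<in> E \<Longrightarrow> adom A e \<in> p \<longleftrightarrow> e \<notin> p"
  by (auto simp: alg_ultrafilter_def)

lemma uf_le: "uf p \<Longrightarrow> d \<in> p \<Longrightarrow> e \<in> E \<Longrightarrow> d \<cdot> e = d \<Longrightarrow> e \<in> p"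
  by (metis uf_E uf_seq)

text \<open>The complement clause makes ultrafilters maximal. Below, sources and targets are often
  identified by proving a single inclusion.\<close>

lemma uf_eqI: "uf p \<Longrightarrow> uf q \<Longrightarrow> p \<subseteq> q \<Longrightarrow> p = q"
  by (metis adom_E E_carr subsetI subset_antisym subsetD uf_E uf_adom)

text \<open>Nonemptiness is not a clause of the definition: the carrier is inhabited, so there is a
  domain element, and it or its complement belongs to \<open>p\<close>.\<close>

lemma uf_ex: assumes "uf p" obtains e where "e \<in> p"
proof -
  obtain a where "a \<in> carr A" using sig by (auto simp: algebra_sig_def)
  then show thesis using that uf_adom[OF assms, of "adom A a"] by auto
qed

lemma uf_nonempty: assumes p: "uf p" "e \<in> p" shows "supp e \<noteq> {}"
proof
  have e: "e \<in> E" using uf_E p by blast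
  assume "supp e = {}"
  then have "e \<cdot> adom A e = e" using e by (intro E_eqI) (auto simp: supp_seq)
  then show False using p e uf_adom uf_seq by (metis E_carr adom_E)
qed

lemma uf_finite_meet:
  assumes p: "uf p" and G: "finite G" "G \<subseteq> p"
  shows "\<exists>e\<in>p. supp e \<subseteq> \<Inter>(supp ` G)"
  using G
proof (induction G)
  case empty
  then show ?case using uf_ex[OF p] by auto
next
  case (insert d G)
  then obtain e where e: "e \<in> p" "supp e \<subseteq> \<Inter>(supp ` G)" by blast
  have E: "d \<in> E" "e \<in> E" using uf_E p insert.prems e by blast+
  have "d \<cdot> e \<in> p" "supp (d \<cdot> e) \<subseteq> \<Inter>(supp ` insert d G)"
    using uf_seq[OF p E] supp_seq[OF E] insert.prems e by auto
  then show ?case by blast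
qed

text \<open>The extension is made among all subsets of the base, where \<open>fip_maximal\<close>
  applies, and is then pulled back along \<open>supp\<close>. Adding \<open>X\<close> to the
  supports forces the extension to live on the base, so that complements in \<open>X\<close> behave
  as complements.\<close>

lemma uf_extend:
  assumes F: "F \<subseteq> E"
    and fip: "\<And>G. finite G \<Longrightarrow> G \<subseteq> F \<Longrightarrow> \<exists>e\<in>E. supp e \<noteq> {} \<and> supp e \<subseteq> \<Inter>(supp ` G)"
  obtains p where "uf p" "F \<subseteq> p"
proof -
  have fip': "\<Inter>\<G> \<noteq> {}" if G: "finite \<G>" "\<G> \<subseteq> insert X (supp ` F)" for \<G>
  proof -
    have "finite (\<G> - {X})" "\<G> - {X} \<subseteq> supp ` F" using G by auto
    then obtain G where H: "finite G" "G \<subseteq> F" "\<G> - {X} = supp ` G"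
      by (meson finite_subset_image)
    then obtain e where e: "e \<in> E" "supp e \<noteq> {}" "supp e \<subseteq> \<Inter>(supp ` G)"
      using fip by meson
    have "supp e \<subseteq> S" if "S \<in> \<G>" for S
    proof (cases "S = X")
      case False
      then have "S \<in> supp ` G" using that H(3) by blast
      then show ?thesis using e(3) by blast
    qed (use supp_X[OF e(1)] in simp)
    then show ?thesis using e(2) by blast
  qed
  obtain \<U> where U: "insert X (supp ` F) \<subseteq> \<U>"
    and fipU: "\<And>\<G>. finite \<G> \<Longrightarrow> \<G> \<subseteq> \<U> \<Longrightarrow> \<Inter>\<G> \<noteq> {}" and ultra: "\<And>S. S \<in> \<U> \<or> - S \<in> \<U>"
  proof (rule fip_maximal)
    show "\<Inter>\<G> \<noteq> {}" if "finite \<G>" "\<G> \<subseteq> insert X (supp ` F)" for \<G>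
      using fip' that .
  qed (rule that)
  have meet: "S \<inter> T \<in> \<U>" if "S \<in> \<U>" "T \<in> \<U>" for S T
    using fipU[of "{S, T, - (S \<inter> T)}"] ultra[of "S \<inter> T"] that by auto
  have up: "T \<in> \<U>" if "S \<in> \<U>" "S \<subseteq> T" for S T
    using fipU[of "{S, - T}"] ultra[of "T"] that by auto
  have disj: "S \<inter> T \<noteq> {}" if "S \<in> \<U>" "T \<in> \<U>" for S T
    using fipU[of "{S, T}"] that by auto
  have compl: "X - S \<in> \<U> \<longleftrightarrow> S \<notin> \<U>" if "S \<subseteq> X" for S
  proof
    show "S \<notin> \<U>" if "X - S \<in> \<U>" using disj[OF that, of S] by blast
    assume "S \<notin> \<U>"
    then have "- S \<inter> X \<in> \<U>" using ultra meet U by blast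
    then show "X - S \<in> \<U>" by (rule up) blast
  qed
  have "uf {e \<in> E. supp e \<in> \<U>}"
    unfolding alg_ultrafilter_def
  proof (intro conjI ballI)
    fix d e assume "d \<in> E" "e \<in> E"
    then show "d \<cdot> e \<in> {e \<in> E. supp e \<in> \<U>} \<longleftrightarrow> d \<in> {e \<in> E. supp e \<in> \<U>} \<and> e \<in> {e \<in> E. supp e \<in> \<U>}"
      using meet up by (auto simp: supp_seq) (blast+)?
  next
    fix e assume e: "e \<in> E"
    then have "supp (adom A e) = X - supp e" by (auto simp: supp_adom phi_E)
    then show "adom A e \<in> {e \<in> E. supp e \<in> \<U>} \<longleftrightarrow> e \<notin> {e \<in> E. supp e \<in> \<U>}"
      using e compl[OF supp_X[OF e]] by auto
  qed auto
  moreover have "F \<subseteq> {e \<in> E. supp e \<in> \<U>}" using F U by auto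
  ultimately show thesis by (rule that)
qed

lemma uf_principal: "x \<in> X \<Longrightarrow> uf {e \<in> E. x \<in> supp e}"
  unfolding alg_ultrafilter_def by (auto simp: supp_seq supp_adom phi_E)

text \<open>A finite part of \<open>F\<close> lying in an ultrafilter has a lower bound in that
  ultrafilter, and members of an ultrafilter have nonempty support; this is the hypothesis of
  \<open>uf_extend\<close>.\<close>

lemma uf_compact:
  assumes "F \<subseteq> E" "\<And>G. finite G \<Longrightarrow> G \<subseteq> F \<Longrightarrow> \<exists>p. uf p \<and> G \<subseteq> p"
  obtains p where "uf p" "F \<subseteq> p"
proof (rule uf_extend[OF assms(1)])
  fix G assume G: "finite G" "G \<subseteq> F"
  then obtain p where p: "uf p" "G \<subseteq> p" using assms(2) by blast
  obtain e where "e \<in> p" "supp e \<subseteq> \<Inter>(supp ` G)"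
    using uf_finite_meet[OF p(1) G(1) p(2)] by (rule bexE)
  then show "\<exists>e\<in>E. supp e \<noteq> {} \<and> supp e \<subseteq> \<Inter>(supp ` G)"
    using uf_nonempty[OF p(1)] uf_E[OF p(1)] by (intro bexI[of _ e] conjI)
qed (rule that)

text \<open>The ultrafilter \<open>p\<close> is meant as the source of a germ of \<open>a\<close>
  with target \<open>q\<close>, so it must contain the preimage under \<open>a\<close> of each
  member of \<open>q\<close>. These preimages are finitely consistent: every \<open>e\<close> in
  \<open>q\<close> meets the range of \<open>a\<close>, since e \<cdot> R(a) is again in
  \<open>q\<close> and hence has nonempty support.\<close>

lemma uf_range:
  assumes q: "uf q" and a: "a \<in> carr A" and rng: "rng A a \<in> q"
  obtains p where "uf p" "\<And>e. e \<in> q \<Longrightarrow> \<delta> (a \<cdot> e) \<in> p"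
proof (rule uf_extend[of "(\<lambda>e. \<delta> (a \<cdot> e)) ` q"])
  show "(\<lambda>e. \<delta> (a \<cdot> e)) ` q \<subseteq> E" using a uf_E[OF q] by auto
  fix G assume "finite G" "G \<subseteq> (\<lambda>e. \<delta> (a \<cdot> e)) ` q"
  then obtain H where H: "H \<subseteq> q" "finite H" "G = (\<lambda>e. \<delta> (a \<cdot> e)) ` H"
    by (metis finite_subset_image)
  obtain e where e: "e \<in> q" "supp e \<subseteq> \<Inter>(supp ` H)" using uf_finite_meet[OF q H(2,1)] by blast
  have eE: "e \<in> E" using e uf_E[OF q] by blast
  have "e \<cdot> rng A a \<in> q" using uf_seq[OF q eE rng_E[OF a]] e rng by simp
  then have ne: "supp e \<inter> Range (\<phi> a) \<noteq> {}" using uf_nonempty[OF q] eE a by (metis rng_E supp_rng supp_seq)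
  have "supp (\<delta> (a \<cdot> e)) \<noteq> {}" using ne a eE by (auto simp: supp_delta phi_cores)
  moreover have "supp (\<delta> (a \<cdot> e)) \<subseteq> \<Inter>(supp ` G)"
  proof -
    have "supp (\<delta> (a \<cdot> e)) \<subseteq> supp (\<delta> (a \<cdot> d))" if d: "d \<in> H" for d
    proof -
      have "d \<in> E" "supp e \<subseteq> supp d" using d e(2) H(1) uf_E[OF q] by blast+
      then show ?thesis using a eE by (auto simp: supp_delta phi_cores)
    qed
    then show ?thesis using H(3) by blast
  qed
  ultimately show "\<exists>e\<in>E. supp e \<noteq> {} \<and> supp e \<subseteq> \<Inter>(supp ` G)"
    by (intro bexI[of _ "\<delta> (a \<cdot> e)"] conjI) (use a eE in auto)
next
  fix p assume "uf p" "(\<lambda>e. \<delta> (a \<cdot> e)) ` q \<subseteq> p"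
  then show thesis by (intro that) auto
qed

text \<open>Different elements have graphs that differ over some base point \<open>x\<close>, and
  the principal ultrafilter at \<open>x\<close> consists of restrictions that all keep this
  difference.\<close>

lemma separation:
  assumes ab: "a \<in> carr A" "b \<in> carr A" "a \<noteq> b"
  obtains p where "uf p" "\<delta> a \<in> p \<or> \<delta> b \<in> p" "\<And>e. e \<in> p \<Longrightarrow> e \<cdot> a \<noteq> e \<cdot> b"
proof -
  have "\<phi> a \<noteq> \<phi> b" using eqI ab by blast
  then obtain x y where xy: "(x, y) \<in> \<phi> a \<longleftrightarrow> (x, y) \<notin> \<phi> b" by auto
  then have "x \<in> X" using in_X ab by blast
  show thesis
  proof
    show "uf {e \<in> E. x \<in> supp e}" using uf_principal[OF \<open>x \<in> X\<close>] .
    show "\<delta> a \<in> {e \<in> E. x \<in> supp e} \<or> \<delta> b \<in> {e \<in> E. x \<in> supp e}"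
      using xy ab by (auto simp: supp_delta)
    fix e assume e: "e \<in> {e \<in> E. x \<in> supp e}"
    then have "(x, y) \<in> \<phi> (e \<cdot> a) \<longleftrightarrow> (x, y) \<notin> \<phi> (e \<cdot> b)"
      using xy ab by (auto simp: phi_res)
    then show "e \<cdot> a \<noteq> e \<cdot> b" by auto
  qed
qed

end

section \<open>The dual category of an algebra\<close>

context pf_rep
begin

section \<open>Germs, their sources and their targets\<close>

text \<open>Since domain elements commute, the product of the two witnesses of agreement works for
  the outer pair. Having the same germ is therefore an equivalence relation.\<close>

lemma germ_agree_trans:
  assumes "uf p" "a \<in> carr A" "b \<in> carr A" "c \<in> carr A" "d \<in> p" "e \<in> p" "d \<cdot> a = d \<cdot> b" "e \<cdot> b = e \<cdot> c"
  shows "d \<cdot> e \<in> p" "d \<cdot> e \<cdot> a = d \<cdot> e \<cdot> c"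
proof -
  have E: "d \<in> E" "e \<in> E" using assms uf_E by blast+
  show "d \<cdot> e \<in> p" using uf_seq[OF assms(1) E] assms by blast
  show "d \<cdot> e \<cdot> a = d \<cdot> e \<cdot> c" using assms E by (metis E_carr E_comm assoc)
qed

text \<open>Agreement on \<open>e\<close> gives e \<cdot> \<delta> a = e \<cdot> \<delta> b, so
  whether the domain belongs to \<open>p\<close> depends on the germ alone.\<close>

lemma germ_agree_delta:
  assumes "uf p" "a \<in> carr A" "b \<in> carr A" "e \<in> p" "e \<cdot> a = e \<cdot> b" "\<delta> a \<in> p"
  shows "\<delta> b \<in> p"
proof -
  have e: "e \<in> E" using assms uf_E by blast
  have "e \<cdot> \<delta> b = e \<cdot> \<delta> a" using assms e delta_res by metis
  then show ?thesis using assms e uf_seq by (metis adom_E closed(1))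
qed

lemma germ_self: assumes "uf p" "a \<in> carr A" shows "a \<in> germ A p a"
  using uf_ex[OF assms(1)] assms by (auto simp: germ_def)

lemma germ_eq: assumes p: "uf p" and a: "a \<in> carr A" and b: "b \<in> germ A p a"
  shows "germ A p b = germ A p a"
proof -
  obtain e where e: "b \<in> carr A" "e \<in> p" "e \<cdot> a = e \<cdot> b" using b by (auto simp: germ_def)
  have "c \<in> germ A p a" if c: "c \<in> carr A" "d \<in> p" "d \<cdot> b = d \<cdot> c" for c d
    using germ_agree_trans[OF p a e(1) c(1) e(2) c(2) e(3) c(3)] c by (auto simp: germ_def)
  moreover have "c \<in> germ A p b" if c: "c \<in> carr A" "d \<in> p" "d \<cdot> a = d \<cdot> c" for c d
    using germ_agree_trans[OF p e(1) a c(1) e(2) c(2) e(3)[symmetric] c(3)] c by (auto simp: germ_def)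
  ultimately show ?thesis unfolding germ_def[of A p a] germ_def[of A p b]
    by (auto simp: germ_def)
qed

text \<open>Justifies the encoding of sources. If \<open>e\<close> fixes a representative
  \<open>b\<close> then \<delta> b, a member of \<open>p\<close>, lies below \<open>e\<close>;
  conversely a member \<open>e\<close> of \<open>p\<close> fixes the representative e \<cdot>
  a.\<close>

lemma germ_src_germ: assumes p: "uf p" and a: "a \<in> carr A" "\<delta> a \<in> p" shows "germ_src A (germ A p a) = p"
proof (intro equalityI subsetI)
  fix e assume "e \<in> germ_src A (germ A p a)"
  then obtain b d where b: "e \<in> E" "b \<in> carr A" "e \<cdot> b = b" "d \<in> p" "d \<cdot> a = d \<cdot> b"
    by (auto simp: germ_src_def germ_def)
  then have "\<delta> b \<in> p" using germ_agree_delta p a by blast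
  moreover have "e \<cdot> \<delta> b = \<delta> b" using b delta_res by metis
  ultimately show "e \<in> p" using uf_seq[OF p b(1), of "\<delta> b"] b(2) by auto
next
  fix e assume e: "e \<in> p"
  then have E: "e \<in> E" using uf_E p by blast
  have ea: "e \<cdot> (e \<cdot> a) = e \<cdot> a" using E a by (metis assoc E_carr E_idem)
  then have "e \<cdot> a \<in> germ A p a" using e E a unfolding germ_def mem_Collect_eq by (intro conjI bexI[of _ e]) simp_all
  then show "e \<in> germ_src A (germ A p a)" using E ea unfolding germ_src_def by blast
qed

lemma germ_in_germs: "uf p \<Longrightarrow> a \<in> carr A \<Longrightarrow> \<delta> a \<in> p \<Longrightarrow> germ A p a \<in> germs A"
  by (auto simp: germs_def)

lemma uf_germ_src: "\<alpha> \<in> germs A \<Longrightarrow> uf (germ_src A \<alpha>)"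
  by (auto simp: germs_def germ_src_germ)

lemma germ_nonempty: assumes "\<alpha> \<in> germs A" obtains a where "a \<in> \<alpha>"
  using assms germ_self by (auto simp: germs_def)

text \<open>Any member may serve as representative, and the base ultrafilter is recovered from the
  set. A germ can thus be handled through its source and its members, without the \<open>p\<close>
  and \<open>a\<close> it was built from.\<close>

lemma germ_rep:
  assumes "\<alpha> \<in> germs A" "a \<in> \<alpha>"
  shows "a \<in> carr A" "\<delta> a \<in> germ_src A \<alpha>" "\<alpha> = germ A (germ_src A \<alpha>) a"
proof -
  obtain p b where p: "\<alpha> = germ A p b" "uf p" "b \<in> carr A" "\<delta> b \<in> p"
    using assms(1) by (auto simp: germs_def)
  have s: "germ_src A \<alpha> = p" using p germ_src_germ by simp
  show a: "a \<in> carr A" using assms p by (auto simp: germ_def)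
  obtain e where "e \<in> p" "e \<cdot> b = e \<cdot> a" using assms(2) p(1) by (auto simp: germ_def)
  then show "\<delta> a \<in> germ_src A \<alpha>" using germ_agree_delta[OF p(2,3) a] p(4) s by blast
  show "\<alpha> = germ A (germ_src A \<alpha>) a" using germ_eq[OF p(2,3)] assms(2) p(1) s by auto
qed

text \<open>Germs over one ultrafilter are equivalence classes. Equality of arrows is proved below
  by comparing sources and exhibiting a common member.\<close>

lemma germ_eqI: "\<alpha> \<in> germs A \<Longrightarrow> \<beta> \<in> germs A \<Longrightarrow> germ_src A \<alpha> = germ_src A \<beta> \<Longrightarrow> a \<in> \<alpha> \<Longrightarrow> a \<in> \<beta> \<Longrightarrow> \<alpha> = \<beta>"
  by (metis germ_rep(3))

lemma germ_memI:
  assumes "\<alpha> \<in> germs A" "a \<in> \<alpha>" "b \<in> carr A" "e \<in> germ_src A \<alpha>" "e \<cdot> a = e \<cdot> b"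
  shows "b \<in> \<alpha>"
  by (subst germ_rep(3)[OF assms(1,2)]) (use assms in \<open>auto simp: germ_def\<close>)

lemma germ_memE:
  assumes "\<alpha> \<in> germs A" "a \<in> \<alpha>" "b \<in> \<alpha>"
  obtains e where "e \<in> germ_src A \<alpha>" "e \<cdot> a = e \<cdot> b"
proof -
  have "b \<in> germ A (germ_src A \<alpha>) a" using germ_rep(3)[OF assms(1,2)] assms by simp
  then show thesis using that by (auto simp: germ_def)
qed

lemma germ_res: assumes "\<alpha> \<in> germs A" "a \<in> \<alpha>" "e \<in> germ_src A \<alpha>" shows "e \<cdot> a \<in> \<alpha>"
proof (rule germ_memI[OF assms(1,2) _ assms(3)])
  have "e \<in> E" "a \<in> carr A" using assms uf_E uf_germ_src germ_rep by blast+
  then show "e \<cdot> a \<in> carr A" "e \<cdot> a = e \<cdot> (e \<cdot> a)" by (simp_all flip: assoc)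
qed

text \<open>The domain of e \<cdot> a is e \<cdot> \<delta> a. In terms of open sets,
  \<open>ar (e \<cdot> a)\<close> is the part of \<open>ar a\<close> lying over
  \<open>ob e\<close>.\<close>

lemma germ_res_iff:
  assumes "\<alpha> \<in> germs A" "e \<in> E" "a \<in> carr A"
  shows "e \<cdot> a \<in> \<alpha> \<longleftrightarrow> e \<in> germ_src A \<alpha> \<and> a \<in> \<alpha>"
proof
  assume ea: "e \<cdot> a \<in> \<alpha>"
  then have "e \<cdot> \<delta> a \<in> germ_src A \<alpha>" using germ_rep(2) assms delta_res by metis
  then have e: "e \<in> germ_src A \<alpha>" using uf_seq[OF uf_germ_src] assms by simp
  have "e \<cdot> (e \<cdot> a) = e \<cdot> a" using assms by (simp flip: assoc)
  then show "e \<in> germ_src A \<alpha> \<and> a \<in> \<alpha>" using e germ_memI[OF assms(1) ea assms(3) e] by simp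
qed (use germ_res assms in blast)

lemma germ_mem_src: "\<alpha> \<in> germs A \<Longrightarrow> e \<in> E \<Longrightarrow> e \<in> \<alpha> \<Longrightarrow> e \<in> germ_src A \<alpha>"
  using germ_rep(2)[of \<alpha> e] by simp

text \<open>By \<open>twist\<close> the restriction on the right is one on the left, to which
  \<open>germ_res_iff\<close> applies.\<close>

lemma germ_cores_iff:
  assumes "\<alpha> \<in> germs A" "a \<in> \<alpha>" "e \<in> E"
  shows "a \<cdot> e \<in> \<alpha> \<longleftrightarrow> \<delta> (a \<cdot> e) \<in> germ_src A \<alpha>"
proof -
  have "a \<in> carr A" using germ_rep assms by blast
  then show ?thesis using germ_res_iff[OF assms(1), of "\<delta> (a \<cdot> e)" a] assms twist[of a e] by simp
qed

text \<open>Makes one fixed representative decide the target, where the definition quantifies over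
  all of them: if b \<cdot> e = b and \<open>b\<close> agrees with \<open>a\<close> on
  \<open>d\<close>, then \<open>b\<close> agrees with a \<cdot> e on \<open>d\<close>, so both lie
  in the germ.\<close>

lemma germ_tgt_iff:
  assumes \<alpha>: "\<alpha> \<in> germs A" and a: "a \<in> \<alpha>"
  shows "e \<in> germ_tgt A \<alpha> \<longleftrightarrow> e \<in> E \<and> a \<cdot> e \<in> \<alpha>"
proof
  have ac: "a \<in> carr A" using germ_rep assms by blast
  show "e \<in> germ_tgt A \<alpha>" if "e \<in> E \<and> a \<cdot> e \<in> \<alpha>"
  proof -
    have "a \<cdot> e \<cdot> e = a \<cdot> e" using that ac assoc E_carr E_idem by metis
    with that show ?thesis by (auto simp: germ_tgt_def)
  qed
  assume "e \<in> germ_tgt A \<alpha>"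
  then obtain b where b: "e \<in> E" "b \<in> \<alpha>" "b \<cdot> e = b" by (auto simp: germ_tgt_def)
  have bc: "b \<in> carr A" using germ_rep assms b by blast
  obtain d where d: "d \<in> germ_src A \<alpha>" "d \<cdot> a = d \<cdot> b" using germ_memE[OF \<alpha> a b(2)] .
  then have "d \<in> carr A" using uf_E uf_germ_src \<alpha> E_carr by blast
  then have "d \<cdot> b = d \<cdot> (a \<cdot> e)" using d(2) b bc ac E_carr assoc by metis
  then show "e \<in> E \<and> a \<cdot> e \<in> \<alpha>" using germ_memI[OF \<alpha> b(2) _ d(1)] b ac by simp
qed

text \<open>With \<open>a\<close> fixed, the target is the preimage of the source under the Boolean
  homomorphism of \<open>delta_meet\<close> and \<open>delta_compl\<close>; the factor \<delta> a in
  the latter is harmless because \<delta> a is in the source.\<close>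

lemma uf_germ_tgt: assumes \<alpha>: "\<alpha> \<in> germs A" shows "uf (germ_tgt A \<alpha>)"
proof -
  obtain a where a: "a \<in> \<alpha>" using germ_nonempty \<alpha> .
  have ac: "a \<in> carr A" "\<delta> a \<in> germ_src A \<alpha>" using germ_rep \<alpha> a by blast+
  have iff: "e \<in> germ_tgt A \<alpha> \<longleftrightarrow> e \<in> E \<and> \<delta> (a \<cdot> e) \<in> germ_src A \<alpha>" for e
    using germ_tgt_iff[OF \<alpha> a] germ_cores_iff[OF \<alpha> a] by blast
  note s = uf_seq[OF uf_germ_src[OF \<alpha>]]
  show ?thesis unfolding alg_ultrafilter_def
  proof (intro conjI ballI)
    show "germ_tgt A \<alpha> \<subseteq> E" using iff by blast
  next
    fix d e assume de: "d \<in> E" "e \<in> E"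
    then show "d \<cdot> e \<in> germ_tgt A \<alpha> \<longleftrightarrow> d \<in> germ_tgt A \<alpha> \<and> e \<in> germ_tgt A \<alpha>"
      using ac by (simp add: iff delta_meet s)
  next
    fix e assume e: "e \<in> E"
    have "adom A (a \<cdot> e) = adom A (\<delta> (a \<cdot> e))" using ac e by simp
    then have "adom A (a \<cdot> e) \<in> germ_src A \<alpha> \<longleftrightarrow> \<delta> (a \<cdot> e) \<notin> germ_src A \<alpha>"
      using uf_adom[OF uf_germ_src[OF \<alpha>], of "\<delta> (a \<cdot> e)"] ac e by simp
    then show "adom A e \<in> germ_tgt A \<alpha> \<longleftrightarrow> e \<notin> germ_tgt A \<alpha>"
      using ac e by (simp add: iff delta_compl s)
  qed
qed

lemma rng_in_germ_tgt: "\<alpha> \<in> germs A \<Longrightarrow> a \<in> \<alpha> \<Longrightarrow> rng A a \<in> germ_tgt A \<alpha>"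
  using germ_tgt_iff[of \<alpha> a] germ_rep(1)[of \<alpha> a] by simp

text \<open>The germ of \<open>a\<close> at the ultrafilter given by \<open>uf_range\<close> has a
  target containing \<open>q\<close>, and maximality makes this an equality.\<close>

lemma germ_onto_tgt:
  assumes q: "uf q" and a: "a \<in> carr A" and r: "rng A a \<in> q"
  obtains \<alpha> where "\<alpha> \<in> germs A" "a \<in> \<alpha>" "germ_tgt A \<alpha> = q"
proof -
  obtain p where p: "uf p" "\<And>e. e \<in> q \<Longrightarrow> \<delta> (a \<cdot> e) \<in> p" using uf_range[OF q a r] by blast
  have "\<delta> a \<in> p" using p(2)[OF r] a by simp
  then have \<alpha>: "germ A p a \<in> germs A" "a \<in> germ A p a" "germ_src A (germ A p a) = p"
    using p a germ_in_germs germ_self germ_src_germ by auto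
  have "q \<subseteq> germ_tgt A (germ A p a)"
    using germ_tgt_iff[OF \<alpha>(1,2)] germ_cores_iff[OF \<alpha>(1,2)] p(2) uf_E[OF q] \<alpha>(3) by auto
  then have "germ_tgt A (germ A p a) = q"
    using uf_eqI[OF q uf_germ_tgt[OF \<alpha>(1)]] by simp
  with \<alpha> show thesis using that by blast
qed

section \<open>Composition and identities of germs\<close>

abbreviation \<C> where "\<C> \<equiv> dual_cat A"

lemma dual_simps [simp]: "src \<C> = germ_src A" "tgt \<C> = germ_tgt A"
  by (simp_all add: dual_cat_def)

text \<open>The composite is encoded as a union over all representatives, so the point is that they
  all yield one germ. Replacing \<open>a0\<close> by \<open>a\<close> costs a restriction on the
  left. Replacing \<open>b0\<close> by \<open>b\<close> costs a restriction by some \<open>e\<close>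
  in the target of \<alpha>, which \<open>twist\<close> turns into the restriction \<delta> (a0
  \<cdot> e), a member of the source.\<close>

lemma germ_comp:
  assumes \<alpha>: "\<alpha> \<in> germs A" and \<beta>: "\<beta> \<in> germs A" and st: "germ_tgt A \<alpha> = germ_src A \<beta>"
  shows "cmp \<C> \<alpha> \<beta> \<in> germs A" "germ_src A (cmp \<C> \<alpha> \<beta>) = germ_src A \<alpha>"
    "germ_tgt A (cmp \<C> \<alpha> \<beta>) = germ_tgt A \<beta>"
    "a \<in> \<alpha> \<Longrightarrow> b \<in> \<beta> \<Longrightarrow> a \<cdot> b \<in> cmp \<C> \<alpha> \<beta>"
proof -
  let ?p = "germ_src A \<alpha>"
  note p = uf_germ_src[OF \<alpha>]
  have dom: "\<delta> (a \<cdot> b) \<in> ?p" if ab: "a \<in> \<alpha>" "b \<in> \<beta>" for a b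
  proof -
    have c: "a \<in> carr A" "b \<in> carr A" using germ_rep \<alpha> \<beta> ab by blast+
    have "\<delta> b \<in> germ_tgt A \<alpha>" using germ_rep(2)[OF \<beta> ab(2)] st by simp
    then have "\<delta> (a \<cdot> \<delta> b) \<in> ?p" using germ_tgt_iff[OF \<alpha> ab(1)] germ_cores_iff[OF \<alpha> ab(1)] by blast
    then show ?thesis using delta_seq_delta[OF c] by simp
  qed
  obtain a0 b0 where ab0: "a0 \<in> \<alpha>" "b0 \<in> \<beta>" using germ_nonempty \<alpha> \<beta> by metis
  have c0: "a0 \<in> carr A" "b0 \<in> carr A" using germ_rep \<alpha> \<beta> ab0 by blast+
  let ?\<gamma> = "germ A ?p (a0 \<cdot> b0)"
  have \<gamma>: "?\<gamma> \<in> germs A" "a0 \<cdot> b0 \<in> ?\<gamma>" "germ_src A ?\<gamma> = ?p"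
    using germ_in_germs germ_self germ_src_germ p c0 dom[OF ab0] by simp_all
  have mem: "a \<cdot> b \<in> ?\<gamma>" if ab: "a \<in> \<alpha>" "b \<in> \<beta>" for a b
  proof -
    have c: "a \<in> carr A" "b \<in> carr A" using germ_rep \<alpha> \<beta> ab by blast+
    obtain d where d: "d \<in> ?p" "d \<cdot> a0 = d \<cdot> a" using germ_memE[OF \<alpha> ab0(1) ab(1)] .
    obtain e where e: "e \<in> germ_src A \<beta>" "e \<cdot> b0 = e \<cdot> b" using germ_memE[OF \<beta> ab0(2) ab(2)] .
    have E: "d \<in> E" "e \<in> E" using d e uf_E uf_germ_src \<alpha> \<beta> by blast+
    have f: "\<delta> (a0 \<cdot> e) \<in> ?p" using e st germ_tgt_iff[OF \<alpha> ab0(1)] germ_cores_iff[OF \<alpha> ab0(1)] by blast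
    have "\<delta> (a0 \<cdot> e) \<cdot> (a0 \<cdot> b0) = a0 \<cdot> (e \<cdot> b0)" 
      using c0 E twist[of a0 e] by (simp flip: assoc)
    also have "\<dots> = \<delta> (a0 \<cdot> e) \<cdot> (a0 \<cdot> b)"
      using c0 c E e(2) twist[of a0 e] by (simp flip: assoc)
    finally have 1: "a0 \<cdot> b \<in> ?\<gamma>" using germ_memI[OF \<gamma>(1,2)] f \<gamma>(3) c0 c by simp
    have "d \<cdot> (a0 \<cdot> b) = d \<cdot> (a \<cdot> b)" using c c0 E d(2) by (simp flip: assoc)
    then show ?thesis using germ_memI[OF \<gamma>(1) 1] \<gamma>(3) d(1) c by simp
  qed
  have eq: "germ A ?p (a \<cdot> b) = ?\<gamma>" if ab: "a \<in> \<alpha>" "b \<in> \<beta>" for a b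
    using germ_rep(3)[OF \<gamma>(1) mem[OF ab]] \<gamma>(3) by simp
  have "cmp \<C> \<alpha> \<beta> = (\<Union>a\<in>\<alpha>. \<Union>b\<in>\<beta>. germ A ?p (a \<cdot> b))" by (simp add: dual_cat_def)
  also have "\<dots> = (\<Union>a\<in>\<alpha>. \<Union>b\<in>\<beta>. ?\<gamma>)" by (intro SUP_cong refl eq)
  also have "\<dots> = ?\<gamma>" using ab0 by blast
  finally have cmp: "cmp \<C> \<alpha> \<beta> = ?\<gamma>" .
  show "cmp \<C> \<alpha> \<beta> \<in> germs A" "germ_src A (cmp \<C> \<alpha> \<beta>) = ?p" using cmp \<gamma> by simp_all
  show "a \<cdot> b \<in> cmp \<C> \<alpha> \<beta>" if "a \<in> \<alpha>" "b \<in> \<beta>" using cmp mem that by simp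
  have "germ_tgt A \<beta> \<subseteq> germ_tgt A ?\<gamma>"
  proof
    fix e assume e: "e \<in> germ_tgt A \<beta>"
    then have "e \<in> E" "b0 \<cdot> e \<in> \<beta>" using germ_tgt_iff[OF \<beta> ab0(2)] by blast+
    then show "e \<in> germ_tgt A ?\<gamma>" using mem[of a0 "b0 \<cdot> e"] ab0 c0 germ_tgt_iff[OF \<gamma>(1,2)] by (simp add: assoc)
  qed
  then show "germ_tgt A (cmp \<C> \<alpha> \<beta>) = germ_tgt A \<beta>"
    using uf_eqI[OF uf_germ_tgt[OF \<beta>] uf_germ_tgt[OF \<gamma>(1)]] cmp by simp
qed

text \<open>Any two members of \<open>p\<close> agree on their product, so the union encoding the
  identity is a union of copies of a single germ.\<close>

lemma germ_idn:
  assumes p: "uf p"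
  shows "idn \<C> p \<in> germs A" "germ_src A (idn \<C> p) = p" "germ_tgt A (idn \<C> p) = p"
    "e \<in> p \<Longrightarrow> e \<in> idn \<C> p"
proof -
  obtain e0 where e0: "e0 \<in> p" using uf_ex[OF p] .
  let ?\<gamma> = "germ A p e0"
  have E: "e \<in> p \<Longrightarrow> e \<in> E" for e using uf_E[OF p] .
  have \<gamma>: "?\<gamma> \<in> germs A" "e0 \<in> ?\<gamma>" "germ_src A ?\<gamma> = p"
    using germ_in_germs germ_self germ_src_germ p e0 E[OF e0] by simp_all
  have mem: "e \<in> ?\<gamma>" if e: "e \<in> p" for e
  proof -
    have "e \<cdot> e0 \<in> ?\<gamma>" using germ_res[OF \<gamma>(1,2)] \<gamma>(3) e by simp
    then have "e0 \<cdot> e \<in> ?\<gamma>" using E_comm E e e0 by simp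
    then show ?thesis using germ_res_iff[OF \<gamma>(1)] E e e0 by simp
  qed
  have eq: "germ A p e = ?\<gamma>" if e: "e \<in> p" for e
    using germ_rep(3)[OF \<gamma>(1) mem[OF e]] \<gamma>(3) by simp
  have "idn \<C> p = (\<Union>e\<in>p. germ A p e)" by (simp add: dual_cat_def)
  also have "\<dots> = (\<Union>e\<in>p. ?\<gamma>)" by (intro SUP_cong refl eq)
  also have "\<dots> = ?\<gamma>" using e0 by blast
  finally have idn: "idn \<C> p = ?\<gamma>" .
  show "idn \<C> p \<in> germs A" "germ_src A (idn \<C> p) = p" using idn \<gamma> by simp_all
  show "e \<in> idn \<C> p" if "e \<in> p" using idn mem that by simp
  have "e \<in> germ_tgt A ?\<gamma>" if "e \<in> p" for e
    using germ_tgt_iff[OF \<gamma>(1) mem[OF that]] E that mem by simp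
  then show "germ_tgt A (idn \<C> p) = p"
    using uf_eqI[OF p uf_germ_tgt[OF \<gamma>(1)]] idn by auto
qed

section \<open>Basic open sets of ultrafilters and of germs\<close>

abbreviation ob where "ob e \<equiv> {p. uf p \<and> e \<in> p}"
abbreviation ar where "ar a \<equiv> {\<alpha> \<in> germs A. a \<in> \<alpha>}"

lemma openin_objs: "openin (objs \<C>) W \<longleftrightarrow> (\<forall>p\<in>W. \<exists>e\<in>E. uf p \<and> e \<in> p \<and> ob e \<subseteq> W)"
proof -
  have "openin (objs \<C>) W \<longleftrightarrow> (\<forall>p\<in>W. \<exists>V\<in>{ob e |e. e \<in> E}. p \<in> V \<and> V \<subseteq> W)"
    unfolding dual_cat_def tcat.simps
  proof (rule openin_topology_generated_by_base)
    fix S T p assume "S \<in> {ob e |e. e \<in> E}" "T \<in> {ob e |e. e \<in> E}" "p \<in> S \<inter> T"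
    then obtain d e where de: "d \<in> E" "e \<in> E" "S = ob d" "T = ob e" "p \<in> ob d" "p \<in> ob e" by blast
    then have "ob (d \<cdot> e) = S \<inter> T" using uf_seq by blast
    then show "\<exists>V\<in>{ob e |e. e \<in> E}. p \<in> V \<and> V \<subseteq> S \<inter> T" using de seq_E[OF de(1,2)] by blast
  qed
  also have "\<dots> \<longleftrightarrow> (\<forall>p\<in>W. \<exists>e\<in>E. uf p \<and> e \<in> p \<and> ob e \<subseteq> W)" by (rule ball_cong) blast+
  finally show ?thesis .
qed

lemma Ob_dual: "Ob \<C> = {p. uf p}"
proof -
  have "p \<in> (\<Union>e\<in>E. ob e)" if p: "uf p" for p
  proof -
    obtain e where "e \<in> p" using uf_ex[OF p] .
    then show ?thesis using uf_E[OF p] p by blast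
  qed
  moreover have "Ob \<C> = (\<Union>e\<in>E. ob e)" unfolding dual_cat_def by auto
  ultimately show ?thesis by blast
qed

text \<open>A germ containing both \<open>a\<close> and \<open>b\<close> supplies an
  \<open>e\<close> on which they agree, and \<open>ar (e \<cdot> a)\<close> is a basic neighbourhood
  of it inside both basic sets.\<close>

lemma openin_arrs: "openin (arrs \<C>) W \<longleftrightarrow> (\<forall>\<alpha>\<in>W. \<exists>a\<in>carr A. \<alpha> \<in> germs A \<and> a \<in> \<alpha> \<and> ar a \<subseteq> W)"
proof -
  have "openin (arrs \<C>) W \<longleftrightarrow> (\<forall>\<alpha>\<in>W. \<exists>V\<in>{ar a |a. a \<in> carr A}. \<alpha> \<in> V \<and> V \<subseteq> W)"
    unfolding dual_cat_def tcat.simps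
  proof (rule openin_topology_generated_by_base)
    fix S T \<alpha> assume "S \<in> {ar a |a. a \<in> carr A}" "T \<in> {ar a |a. a \<in> carr A}" "\<alpha> \<in> S \<inter> T"
    then obtain a b where ab: "a \<in> carr A" "b \<in> carr A" "S = ar a" "T = ar b" "\<alpha> \<in> germs A" "a \<in> \<alpha>" "b \<in> \<alpha>" by blast
    obtain e where e: "e \<in> germ_src A \<alpha>" "e \<cdot> a = e \<cdot> b" using germ_memE[OF ab(5-7)] .
    have E: "e \<in> E" using uf_E e uf_germ_src ab(5) by blast
    have "e \<cdot> a \<in> \<alpha>" using germ_res e ab by blast
    moreover have "ar (e \<cdot> a) \<subseteq> ar a" using germ_res_iff E ab(1) by blast
    moreover have "ar (e \<cdot> a) \<subseteq> ar b" using germ_res_iff E ab(2) e(2) by auto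
    ultimately show "\<exists>V\<in>{ar e |e. e \<in> carr A}. \<alpha> \<in> V \<and> V \<subseteq> S \<inter> T"
      using ab E by (intro bexI[of _ "ar (e \<cdot> a)"]) auto
  qed
  also have "\<dots> \<longleftrightarrow> (\<forall>\<alpha>\<in>W. \<exists>a\<in>carr A. \<alpha> \<in> germs A \<and> a \<in> \<alpha> \<and> ar a \<subseteq> W)" by (rule ball_cong) blast+
  finally show ?thesis .
qed

lemma Ar_dual: "Ar \<C> = germs A"
proof -
  have "\<alpha> \<in> (\<Union>a\<in>carr A. ar a)" if \<alpha>: "\<alpha> \<in> germs A" for \<alpha>
  proof -
    obtain a where "a \<in> \<alpha>" using germ_nonempty[OF \<alpha>] .
    then show ?thesis using germ_rep(1)[OF \<alpha>] \<alpha> by blast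
  qed
  moreover have "Ar \<C> = (\<Union>a\<in>carr A. ar a)" unfolding dual_cat_def by auto
  ultimately show ?thesis by blast
qed

lemma openin_ob: "e \<in> E \<Longrightarrow> openin (objs \<C>) (ob e)"
  by (auto simp: openin_objs)

lemma openin_ar: "a \<in> carr A \<Longrightarrow> openin (arrs \<C>) (ar a)"
  by (auto simp: openin_arrs)

lemma src_ar: assumes "a \<in> carr A" shows "germ_src A ` ar a = ob (\<delta> a)"
proof
  show "germ_src A ` ar a \<subseteq> ob (\<delta> a)" using germ_rep uf_germ_src by blast
  show "ob (\<delta> a) \<subseteq> germ_src A ` ar a"
  proof
    fix p assume "p \<in> ob (\<delta> a)"
    then have "germ A p a \<in> ar a" "p = germ_src A (germ A p a)"
      using assms germ_in_germs germ_self germ_src_germ by auto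
    then show "p \<in> germ_src A ` ar a" by (rule rev_image_eqI)
  qed
qed

text \<open>The inclusion from right to left is \<open>germ_onto_tgt\<close>. The image is again
  basic, and \<open>open_map_arrsI\<close> will turn this into openness of the target map.\<close>

lemma tgt_ar: assumes "a \<in> carr A" shows "germ_tgt A ` ar a = ob (rng A a)"
proof
  show "germ_tgt A ` ar a \<subseteq> ob (rng A a)" using rng_in_germ_tgt uf_germ_tgt by blast
  show "ob (rng A a) \<subseteq> germ_tgt A ` ar a"
    using germ_onto_tgt[OF _ assms] by (smt (verit, ccfv_threshold) image_iff mem_Collect_eq subsetI)
qed

lemma inj_src_ar: "inj_on (germ_src A) (ar a)"
  by (rule inj_onI) (use germ_eqI in blast)

lemma composable_dual:
  "(\<alpha>, \<beta>) \<in> composable \<C> \<longleftrightarrow> \<alpha> \<in> germs A \<and> \<beta> \<in> germs A \<and> germ_tgt A \<alpha> = germ_src A \<beta>"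
  by (simp add: composable_def Ar_dual)

text \<open>The unit and associative laws reduce to \<open>germ_eqI\<close>: both sides have the
  same source and contain the same product of representatives.\<close>

lemma small_category_dual: "small_category \<C>"
  unfolding small_category_def
proof (intro conjI ballI allI impI)
  fix \<alpha> assume "\<alpha> \<in> Ar \<C>"
  then show "src \<C> \<alpha> \<in> Ob \<C>" "tgt \<C> \<alpha> \<in> Ob \<C>"
    by (simp_all add: Ar_dual Ob_dual uf_germ_src uf_germ_tgt)
next
  fix p assume "p \<in> Ob \<C>"
  then show "idn \<C> p \<in> Ar \<C>" "src \<C> (idn \<C> p) = p" "tgt \<C> (idn \<C> p) = p"
    by (simp_all add: Ar_dual Ob_dual germ_idn)
next
  fix x assume "x \<in> composable \<C>"
  then show "case x of (f, g) \<Rightarrow> cmp \<C> f g \<in> Ar \<C> \<and> src \<C> (cmp \<C> f g) = src \<C> f \<and> tgt \<C> (cmp \<C> f g) = tgt \<C> g"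
    by (cases x) (simp add: composable_dual Ar_dual germ_comp)
next
  fix \<alpha> assume "\<alpha> \<in> Ar \<C>"
  then have \<alpha>: "\<alpha> \<in> germs A" by (simp add: Ar_dual)
  then obtain a where a: "a \<in> \<alpha>" by (rule germ_nonempty)
  note ac = germ_rep[OF \<alpha> a]
  note s = germ_idn[OF uf_germ_src[OF \<alpha>]] and t = germ_idn[OF uf_germ_tgt[OF \<alpha>]]
  note 1 = germ_comp[OF s(1) \<alpha> s(3)] and 2 = germ_comp[OF \<alpha> t(1) t(2)[symmetric]]
  have "a \<in> cmp \<C> (idn \<C> (germ_src A \<alpha>)) \<alpha>"
    using 1(4)[OF s(4)[OF ac(2)] a] ac by simp
  then show "cmp \<C> (idn \<C> (src \<C> \<alpha>)) \<alpha> = \<alpha>"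
    using germ_eqI[OF 1(1) \<alpha>] 1(2) s(2) a by simp
  have "a \<in> cmp \<C> \<alpha> (idn \<C> (germ_tgt A \<alpha>))"
    using 2(4)[OF a t(4)[OF rng_in_germ_tgt[OF \<alpha> a]]] ac by simp
  then show "cmp \<C> \<alpha> (idn \<C> (tgt \<C> \<alpha>)) = \<alpha>"
    using germ_eqI[OF 2(1) \<alpha>] 2(2) a by simp
next
  fix \<alpha> \<beta> \<gamma> assume "(\<alpha>, \<beta>) \<in> composable \<C> \<and> (\<beta>, \<gamma>) \<in> composable \<C>"
  then have g: "\<alpha> \<in> germs A" "\<beta> \<in> germs A" "\<gamma> \<in> germs A"
    and st: "germ_tgt A \<alpha> = germ_src A \<beta>" "germ_tgt A \<beta> = germ_src A \<gamma>"
    by (simp_all add: composable_dual)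
  obtain a b c where abc: "a \<in> \<alpha>" "b \<in> \<beta>" "c \<in> \<gamma>" using germ_nonempty g by metis
  note 1 = germ_comp[OF g(1,2) st(1)] and 2 = germ_comp[OF g(2,3) st(2)]
  note 3 = germ_comp[OF 1(1) g(3) trans[OF 1(3) st(2)]] and 4 = germ_comp[OF g(1) 2(1) trans[OF st(1) 2(2)[symmetric]]]
  have "a \<cdot> b \<cdot> c = a \<cdot> (b \<cdot> c)" using abc germ_rep(1) g assoc by blast
  then show "cmp \<C> (cmp \<C> \<alpha> \<beta>) \<gamma> = cmp \<C> \<alpha> (cmp \<C> \<beta> \<gamma>)"
    using germ_eqI[OF 3(1) 4(1), of "a \<cdot> b \<cdot> c"] 3(2,4) 4(2,4) 1(2,4) 2(4) abc by metis
qed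

section \<open>Continuity and openness of the structure maps\<close>

lemma continuous_src: "continuous_map (arrs \<C>) (objs \<C>) (germ_src A)"
  unfolding continuous_map_def
proof (intro conjI allI impI)
  show "germ_src A \<in> Ar \<C> \<rightarrow> Ob \<C>" by (auto simp: Ar_dual Ob_dual uf_germ_src)
  fix U assume U: "openin (objs \<C>) U"
  show "openin (arrs \<C>) {\<alpha> \<in> Ar \<C>. germ_src A \<alpha> \<in> U}"
    unfolding openin_arrs Ar_dual
  proof
    fix \<alpha> assume \<alpha>: "\<alpha> \<in> {\<alpha> \<in> germs A. germ_src A \<alpha> \<in> U}"
    then obtain e where e: "e \<in> E" "e \<in> germ_src A \<alpha>" "ob e \<subseteq> U"
      using U unfolding openin_objs by blast
    obtain a where a: "a \<in> \<alpha>" using germ_nonempty \<alpha> by blast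
    have ac: "a \<in> carr A" using germ_rep \<alpha> a by blast
    have "e \<cdot> a \<in> \<alpha>" using germ_res \<alpha> a e by blast
    moreover have "ar (e \<cdot> a) \<subseteq> {\<alpha> \<in> germs A. germ_src A \<alpha> \<in> U}"
      using germ_res_iff[OF _ e(1) ac] e(3) uf_germ_src by blast
    ultimately show "\<exists>a\<in>carr A. \<alpha> \<in> germs A \<and> a \<in> \<alpha> \<and> ar a \<subseteq> {\<alpha> \<in> germs A. germ_src A \<alpha> \<in> U}"
      using e(1) ac \<alpha> by (intro bexI[of _ "e \<cdot> a"]) auto
  qed
qed

text \<open>If \<open>e\<close> is in the target of a germ, some representative \<open>a\<close>
  satisfies a \<cdot> e = a, and this equation puts \<open>e\<close> into the target of every germ
  containing \<open>a\<close>.\<close>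

lemma continuous_tgt: "continuous_map (arrs \<C>) (objs \<C>) (germ_tgt A)"
  unfolding continuous_map_def
proof (intro conjI allI impI)
  show "germ_tgt A \<in> Ar \<C> \<rightarrow> Ob \<C>" by (auto simp: Ar_dual Ob_dual uf_germ_tgt)
  fix U assume U: "openin (objs \<C>) U"
  show "openin (arrs \<C>) {\<alpha> \<in> Ar \<C>. germ_tgt A \<alpha> \<in> U}"
    unfolding openin_arrs Ar_dual
  proof
    fix \<alpha> assume \<alpha>: "\<alpha> \<in> {\<alpha> \<in> germs A. germ_tgt A \<alpha> \<in> U}"
    then obtain e where e: "e \<in> E" "e \<in> germ_tgt A \<alpha>" "ob e \<subseteq> U"
      using U unfolding openin_objs by blast
    then obtain a where a: "a \<in> \<alpha>" "a \<cdot> e = a" unfolding germ_tgt_def by blast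
    have "ar a \<subseteq> {\<alpha> \<in> germs A. germ_tgt A \<alpha> \<in> U}"
    proof
      fix \<beta> assume "\<beta> \<in> ar a"
      then have "\<beta> \<in> germs A" "e \<in> germ_tgt A \<beta>" using a(2) e(1) unfolding germ_tgt_def by blast+
      then show "\<beta> \<in> {\<alpha> \<in> germs A. germ_tgt A \<alpha> \<in> U}" using e(3) uf_germ_tgt by blast
    qed
    then show "\<exists>a\<in>carr A. \<alpha> \<in> germs A \<and> a \<in> \<alpha> \<and> ar a \<subseteq> {\<alpha> \<in> germs A. germ_tgt A \<alpha> \<in> U}"
      using a \<alpha> germ_rep(1) by (intro bexI[of _ a]) auto
  qed
qed

lemma open_map_arrsI:
  assumes "\<And>a. a \<in> carr A \<Longrightarrow> \<exists>e\<in>E. f ` ar a = ob e"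
  shows "open_map (arrs \<C>) (objs \<C>) f"
  unfolding open_map_def
proof (intro allI impI)
  fix U assume U: "openin (arrs \<C>) U"
  show "openin (objs \<C>) (f ` U)"
    unfolding openin_objs
  proof
    fix p assume "p \<in> f ` U"
    then obtain \<alpha> where \<alpha>: "\<alpha> \<in> U" "p = f \<alpha>" by blast
    then obtain a where a: "a \<in> carr A" "\<alpha> \<in> ar a" "ar a \<subseteq> U" using U unfolding openin_arrs by blast
    obtain e where e: "e \<in> E" "f ` ar a = ob e" using assms[OF a(1)] by blast
    have "p \<in> ob e" using \<alpha>(2) a(2) e(2)[symmetric] by blast
    moreover have "ob e \<subseteq> f ` U" unfolding e(2)[symmetric] using a(3) by (rule image_mono)
    ultimately show "\<exists>e\<in>E. uf p \<and> e \<in> p \<and> ob e \<subseteq> f ` U" using e(1) by blast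
  qed
qed

lemma open_map_src: "open_map (arrs \<C>) (objs \<C>) (germ_src A)"
  by (rule open_map_arrsI) (metis adom_E closed(1) src_ar)

lemma open_map_tgt: "open_map (arrs \<C>) (objs \<C>) (germ_tgt A)"
  by (rule open_map_arrsI) (metis rng_E tgt_ar)

text \<open>If \<open>c\<close> represents the composite of \<alpha> and \<beta>, it agrees with a
  \<cdot> b on some \<open>e\<close> in the source of \<alpha>. The same equation holds for every
  composable pair in \<open>ar (e \<cdot> a)\<close> \<times> \<open>ar b\<close>, so all their
  composites contain \<open>c\<close>.\<close>

lemma continuous_cmp:
  "continuous_map (subtopology (prod_topology (arrs \<C>) (arrs \<C>)) (composable \<C>)) (arrs \<C>) (\<lambda>(f, g). cmp \<C> f g)"
  unfolding continuous_map_def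
proof (intro conjI allI impI)
  show "(\<lambda>(f, g). cmp \<C> f g) \<in> topspace (subtopology (prod_topology (arrs \<C>) (arrs \<C>)) (composable \<C>)) \<rightarrow> Ar \<C>"
    by (auto simp: composable_dual Ar_dual germ_comp)
  fix U assume U: "openin (arrs \<C>) U"
  let ?P = "{x \<in> topspace (subtopology (prod_topology (arrs \<C>) (arrs \<C>)) (composable \<C>)). (\<lambda>(f, g). cmp \<C> f g) x \<in> U}"
  show "openin (subtopology (prod_topology (arrs \<C>) (arrs \<C>)) (composable \<C>)) ?P"
  proof (subst openin_subopen, intro ballI)
    fix x assume x: "x \<in> ?P"
    obtain \<alpha> \<beta> where ab: "x = (\<alpha>, \<beta>)" by (cases x)
    have c: "(\<alpha>, \<beta>) \<in> composable \<C>" "cmp \<C> \<alpha> \<beta> \<in> U" using x ab by auto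
    then have g: "\<alpha> \<in> germs A" "\<beta> \<in> germs A" "germ_tgt A \<alpha> = germ_src A \<beta>" by (auto simp: composable_dual)
    note 1 = germ_comp[OF g]
    obtain c where c: "c \<in> carr A" "c \<in> cmp \<C> \<alpha> \<beta>" "ar c \<subseteq> U" using U c(2) unfolding openin_arrs by blast
    obtain a b where a: "a \<in> \<alpha>" "b \<in> \<beta>" using germ_nonempty g by metis
    have ac: "a \<in> carr A" "b \<in> carr A" using germ_rep g a by blast+
    obtain e where e: "e \<in> germ_src A \<alpha>" "e \<cdot> c = e \<cdot> (a \<cdot> b)" using germ_memE[OF 1(1) c(2) 1(4)[OF a]] 1(2) by auto
    have E: "e \<in> E" using uf_E[OF uf_germ_src[OF g(1)] e(1)] .
    let ?V = "(ar (e \<cdot> a) \<times> ar b) \<inter> composable \<C>"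
    have "openin (subtopology (prod_topology (arrs \<C>) (arrs \<C>)) (composable \<C>)) ?V"
      using ac E by (intro openin_subtopology_Int openin_prod_Times_iff[THEN iffD2] disjI2 conjI openin_ar) auto
    moreover have "x \<in> ?V" using ab x germ_res[OF g(1) a(1) e(1)] a g by auto
    moreover have "?V \<subseteq> ?P"
    proof
      fix y assume y: "y \<in> ?V"
      obtain \<alpha>' \<beta>' where ab': "y = (\<alpha>', \<beta>')" by (cases y)
      have g': "\<alpha>' \<in> germs A" "\<beta>' \<in> germs A" "germ_tgt A \<alpha>' = germ_src A \<beta>'"
        and m: "e \<cdot> a \<in> \<alpha>'" "b \<in> \<beta>'" using y ab' by (auto simp: composable_dual)
      note 2 = germ_comp[OF g']
      have eq: "e \<cdot> (e \<cdot> a \<cdot> b) = e \<cdot> c" using E ac e(2) by (simp flip: assoc)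
      have "e \<in> germ_src A \<alpha>'" using germ_res_iff g' m E ac by blast
      then have "c \<in> cmp \<C> \<alpha>' \<beta>'" using germ_memI[OF 2(1) 2(4)[OF m] c(1) _ eq] 2(2) by simp
      then have "cmp \<C> \<alpha>' \<beta>' \<in> U" using c(3) 2(1) by blast
      then show "y \<in> ?P" using y ab' by (simp add: composable_dual Ar_dual)
    qed
    ultimately show "\<exists>T. openin (subtopology (prod_topology (arrs \<C>) (arrs \<C>)) (composable \<C>)) T \<and> x \<in> T \<and> T \<subseteq> ?P"
      by blast
  qed
qed

text \<open>A representative \<open>a\<close> of the identity at \<open>p\<close> agrees with some
  \<open>d\<close> in \<open>p\<close> on some \<open>e\<close> in \<open>p\<close>; the identity at
  any ultrafilter containing e \<cdot> d then contains \<open>a\<close> too.\<close>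

lemma continuous_idn: "continuous_map (objs \<C>) (arrs \<C>) (idn \<C>)"
  unfolding continuous_map_def
proof (intro conjI allI impI)
  show "idn \<C> \<in> Ob \<C> \<rightarrow> Ar \<C>" by (auto simp: Ar_dual Ob_dual germ_idn)
  fix U assume U: "openin (arrs \<C>) U"
  show "openin (objs \<C>) {p \<in> Ob \<C>. idn \<C> p \<in> U}"
    unfolding openin_objs Ob_dual
  proof
    fix p assume "p \<in> {p \<in> {p. uf p}. idn \<C> p \<in> U}"
    then have p: "uf p" "idn \<C> p \<in> U" by auto
    obtain a where a: "a \<in> carr A" "a \<in> idn \<C> p" "ar a \<subseteq> U" using U p(2) unfolding openin_arrs by blast
    note i = germ_idn[OF p(1)]
    obtain d where d: "d \<in> p" using uf_ex[OF p(1)] .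
    obtain e where e: "e \<in> p" "e \<cdot> d = e \<cdot> a" using germ_memE[OF i(1) i(4)[OF d] a(2)] i(2) by auto
    have E: "d \<in> E" "e \<in> E" using uf_E[OF p(1)] d e by blast+
    have "ob (e \<cdot> d) \<subseteq> {p \<in> {p. uf p}. idn \<C> p \<in> U}"
    proof
      fix q assume "q \<in> ob (e \<cdot> d)"
      then have q: "uf q" "e \<in> q" "d \<in> q" using uf_seq E by blast+
      note j = germ_idn[OF q(1)]
      have "a \<in> idn \<C> q" using germ_memI[OF j(1) j(4)[OF q(3)] a(1)] j(2) q(2) e(2) by simp
      then show "q \<in> {p \<in> {p. uf p}. idn \<C> p \<in> U}" using q(1) a(3) j(1) by blast
    qed
    moreover have "e \<cdot> d \<in> p" using uf_seq[OF p(1)] E d e by blast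
    ultimately show "\<exists>e\<in>E. uf p \<and> e \<in> p \<and> ob e \<subseteq> {p \<in> {p. uf p}. idn \<C> p \<in> U}"
      using p(1) E seq_E by blast
  qed
qed

end

text \<open>Serves twice for the source map: it gives local charts on the dual category, and it
  transfers compactness between a section and its image.\<close>

lemma open_inj_homeomorphic_map:
  assumes "continuous_map X Y f" "open_map X Y f" "openin X U" "inj_on f U"
  shows "homeomorphic_map (subtopology X U) (subtopology Y (f ` U)) f"
proof (rule bijective_open_imp_homeomorphic_map)
  have U: "U \<subseteq> topspace X" using assms(3) openin_subset by blast
  have fU: "f ` U \<subseteq> topspace Y" using assms(1) U continuous_map_image_subset_topspace by blast
  show "continuous_map (subtopology X U) (subtopology Y (f ` U)) f"
    using assms(1) by (simp add: continuous_map_in_subtopology continuous_map_from_subtopology image_subset_iff)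
  show "open_map (subtopology X U) (subtopology Y (f ` U)) f"
    unfolding open_map_def
  proof (intro allI impI)
    fix V assume "openin (subtopology X U) V"
    then have "openin X V" "V \<subseteq> U" using assms(3) openin_open_subtopology by blast+
    then show "openin (subtopology Y (f ` U)) (f ` V)"
      using assms(2) unfolding open_map_def by (meson image_mono openin_subset_topspace_eq openin_subtopology_self subset_openin_subtopology)
  qed
  show "f ` topspace (subtopology X U) = topspace (subtopology Y (f ` U))"
    using U fU by (simp add: Int_absorb1)
  show "inj_on f (topspace (subtopology X U))"
    using assms(4) by (auto intro: inj_on_subset)
qed

section \<open>The dual is a Stone etale category with epimorphic arrows\<close>

context pf_rep
begin

lemma compact_objs: "compact_space (objs \<C>)"
  unfolding compact_space_alt
proof (intro allI impI)
  fix \<U> assume "(\<forall>U\<in>\<U>. openin (objs \<C>) U) \<and> Ob \<C> \<subseteq> \<Union>\<U>"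
  then have U: "\<And>U. U \<in> \<U> \<Longrightarrow> openin (objs \<C>) U" and cov: "\<And>p. uf p \<Longrightarrow> \<exists>U\<in>\<U>. p \<in> U"
    by (auto simp: Ob_dual)
  \<comment> \<open>These are the domain elements whose complement is a basic set inside some member
    of the cover. Without a finite subcover they are finitely consistent, and an ultrafilter
    containing all of them lies in no member of the cover.\<close>
  define F where "F = {e \<in> E. \<exists>U\<in>\<U>. ob (adom A e) \<subseteq> U}"
  show "\<exists>\<F>. finite \<F> \<and> \<F> \<subseteq> \<U> \<and> Ob \<C> \<subseteq> \<Union>\<F>"
  proof (rule ccontr)
    assume no: "\<not> (\<exists>\<F>. finite \<F> \<and> \<F> \<subseteq> \<U> \<and> Ob \<C> \<subseteq> \<Union>\<F>)"
    have fin: "\<exists>p. uf p \<and> G \<subseteq> p" if G: "finite G" "G \<subseteq> F" for G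
    proof -
      have "\<forall>e\<in>G. \<exists>U. U \<in> \<U> \<and> ob (adom A e) \<subseteq> U"
      proof
        fix e assume "e \<in> G"
        then have "e \<in> F" using G(2) by (rule rev_subsetD)
        then show "\<exists>U. U \<in> \<U> \<and> ob (adom A e) \<subseteq> U" by (simp add: F_def Bex_def)
      qed
      then obtain u where u: "\<forall>e\<in>G. u e \<in> \<U> \<and> ob (adom A e) \<subseteq> u e" using bchoice by meson
      have "finite (u ` G)" "u ` G \<subseteq> \<U>" using G(1) u by auto
      then have "\<not> Ob \<C> \<subseteq> \<Union>(u ` G)" using no by blast
      then obtain p where p: "uf p" "p \<notin> \<Union>(u ` G)" unfolding Ob_dual by blast
      have "e \<in> p" if "e \<in> G" for e
      proof -
        have "e \<in> E" using that G(2) F_def by blast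
        moreover have "adom A e \<notin> p" using that p u by blast
        ultimately show ?thesis using uf_adom[OF p(1)] by blast
      qed
      then show ?thesis using p(1) by blast
    qed
    have "F \<subseteq> E" by (auto simp: F_def)
    then obtain p where p: "uf p" "F \<subseteq> p" using uf_compact[OF _ fin] by blast
    obtain U where "U \<in> \<U>" "p \<in> U" using cov[OF p(1)] by blast
    then obtain e where e: "e \<in> E" "e \<in> p" "ob e \<subseteq> U" using U unfolding openin_objs by blast
    have "adom A e \<in> F" using e \<open>U \<in> \<U>\<close> by (auto simp: F_def)
    then have "adom A e \<in> p" using p(2) by blast
    then show False using uf_adom[OF p(1) e(1)] e(2) by blast
  qed
qed

lemma clopen_ob: assumes e: "e \<in> E" shows "closedin (objs \<C>) (ob e)"
proof -
  have "Ob \<C> - ob e = ob (adom A e)" using uf_adom e unfolding Ob_dual by blast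
  then show ?thesis unfolding closedin_def Ob_dual using openin_ob[of "adom A e"] e by (simp add: Ob_dual) blast
qed

lemma Stone_space_dual: "Stone_space (objs \<C>)"
  unfolding Stone_space_def totally_separated_space_def
proof (intro conjI ballI impI compact_objs)
  fix p q assume "p \<in> Ob \<C>" "q \<in> Ob \<C>" "p \<noteq> q"
  then obtain e where "uf p" "e \<in> p" "e \<notin> q" using uf_eqI unfolding Ob_dual by blast
  then show "\<exists>U. openin (objs \<C>) U \<and> closedin (objs \<C>) U \<and> p \<in> U \<and> q \<notin> U"
    using openin_ob clopen_ob uf_E by (intro exI[of _ "ob e"]) auto
qed

text \<open>Equal composites give an \<open>e\<close> in the source with e \<cdot> a \<cdot> b = e
  \<cdot> a \<cdot> c. Cancelling e \<cdot> a leaves agreement of \<open>b\<close> and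
  \<open>c\<close> on R(e \<cdot> a), which lies in the target of \<alpha> because e \<cdot> a is a
  representative of \<alpha> too.\<close>

lemma epi_dual:
  assumes \<alpha>: "\<alpha> \<in> germs A" shows "epi_arrow \<C> \<alpha>"
  unfolding epi_arrow_def composable_dual
proof clarify
  fix \<beta> \<gamma> assume \<beta>: "\<beta> \<in> germs A" "germ_tgt A \<alpha> = germ_src A \<beta>"
    and \<gamma>: "\<gamma> \<in> germs A" "germ_tgt A \<alpha> = germ_src A \<gamma>" and eq: "cmp \<C> \<alpha> \<beta> = cmp \<C> \<alpha> \<gamma>"
  obtain a b c where abc: "a \<in> \<alpha>" "b \<in> \<beta>" "c \<in> \<gamma>" using germ_nonempty \<alpha> \<beta> \<gamma> by metis
  have c: "a \<in> carr A" "b \<in> carr A" "c \<in> carr A" using abc germ_rep \<alpha> \<beta> \<gamma> by blast+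
  note 1 = germ_comp[OF \<alpha> \<beta>] and 2 = germ_comp[OF \<alpha> \<gamma>]
  have "a \<cdot> b \<in> cmp \<C> \<alpha> \<beta>" "a \<cdot> c \<in> cmp \<C> \<alpha> \<beta>" using 1(4) 2(4) abc eq by auto
  then obtain e where e: "e \<in> germ_src A \<alpha>" "e \<cdot> (a \<cdot> b) = e \<cdot> (a \<cdot> c)" using germ_memE[OF 1(1)] 1(2) by metis
  have E: "e \<in> E" using uf_E[OF uf_germ_src[OF \<alpha>] e(1)] .
  have "rng A (e \<cdot> a) \<cdot> b = rng A (e \<cdot> a) \<cdot> c" using e(2) E c by (intro rng_cancel) (simp_all add: assoc)
  moreover have "rng A (e \<cdot> a) \<in> germ_src A \<beta>"
    using rng_in_germ_tgt[OF \<alpha> germ_res[OF \<alpha> abc(1) e(1)]] \<beta>(2) by simp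
  ultimately have "c \<in> \<beta>" using germ_memI[OF \<beta>(1) abc(2) c(3)] by simp
  then show "\<beta> = \<gamma>" using germ_eqI[OF \<beta>(1) \<gamma>(1) _ _ abc(3)] \<beta>(2) \<gamma>(2) by simp
qed

lemma Stone_etale_epi_dual: "Stone_etale_epi \<C>"
  unfolding Stone_etale_epi_def etale_category_def topological_category_def local_homeomorphism_def
proof (intro conjI ballI)
  fix \<alpha> assume "\<alpha> \<in> Ar \<C>"
  then have \<alpha>: "\<alpha> \<in> germs A" by (simp add: Ar_dual)
  then obtain a where a: "a \<in> \<alpha>" by (rule germ_nonempty)
  have ac: "a \<in> carr A" using germ_rep \<alpha> a by blast
  show "\<exists>U. openin (arrs \<C>) U \<and> \<alpha> \<in> U \<and> openin (objs \<C>) (src \<C> ` U) \<and>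
      homeomorphic_map (subtopology (arrs \<C>) U) (subtopology (objs \<C>) (src \<C> ` U)) (src \<C>)"
    using open_inj_homeomorphic_map[OF continuous_src open_map_src openin_ar[OF ac] inj_src_ar]
      openin_ar[OF ac] open_map_src \<alpha> a unfolding open_map_def dual_simps by blast
qed (use small_category_dual continuous_src continuous_tgt continuous_cmp continuous_idn open_map_tgt
      Stone_space_dual epi_dual in \<open>simp_all add: Ar_dual\<close>)

end

section \<open>Duals of homomorphisms\<close>

text \<open>The two representations are unrelated to each other and to \<open>h\<close>; they only
  make the facts of \<open>pf_rep\<close> available on both sides.\<close>

locale pf_rep_hom = A: pf_rep A X \<phi> + B: pf_rep B Y \<psi>
  for A :: "'a alg" and X :: "'x set" and \<phi> and B :: "'b alg" and Y :: "'y set" and \<psi> +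
  fixes h :: "'a \<Rightarrow> 'b"
  assumes h: "h \<in> alg_hom A B"
begin

lemma hom_carr [simp]: "a \<in> carr A \<Longrightarrow> h a \<in> carr B"
  using h by (auto simp: alg_hom_def)

lemma hom_ops [simp]:
  "a \<in> carr A \<Longrightarrow> h (adom A a) = adom B (h a)"
  "a \<in> carr A \<Longrightarrow> h (rng A a) = rng B (h a)"
  "a \<in> carr A \<Longrightarrow> b \<in> carr A \<Longrightarrow> h (seq A a b) = seq B (h a) (h b)"
  using h by (auto simp: alg_hom_def)

lemma hom_E [simp]: "e \<in> A.E \<Longrightarrow> h e \<in> B.E"
  by (auto simp: dom_elems_def)

abbreviation pull where "pull q \<equiv> {e \<in> A.E. h e \<in> q}"

lemma uf_pull: assumes "B.uf q" shows "A.uf (pull q)"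
  unfolding alg_ultrafilter_def
  using B.uf_seq[OF assms] B.uf_adom[OF assms] by auto

text \<open>Agreement on \<open>e\<close> is carried to agreement on \<open>h e\<close>, which lies
  in the source of \<beta>. One representative therefore decides whether two germs are
  related.\<close>

lemma hom_germ_subset:
  assumes \<alpha>: "\<alpha> \<in> germs A" "a \<in> \<alpha>" and \<beta>: "\<beta> \<in> germs B" "h a \<in> \<beta>"
    and s: "germ_src A \<alpha> \<subseteq> pull (germ_src B \<beta>)"
  shows "h ` \<alpha> \<subseteq> \<beta>"
proof
  fix y assume "y \<in> h ` \<alpha>"
  then obtain b where b: "b \<in> \<alpha>" "y = h b" by blast
  obtain e where e: "e \<in> germ_src A \<alpha>" "seq A e a = seq A e b" using A.germ_memE[OF \<alpha> b(1)] .
  have c: "e \<in> carr A" "a \<in> carr A" "b \<in> carr A"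
    using A.germ_rep \<alpha> b A.uf_E[OF A.uf_germ_src[OF \<alpha>(1)] e(1)] by auto
  have "seq B (h e) (h a) = seq B (h e) (h b)" using e(2) c hom_ops(3) by metis
  moreover have "h e \<in> germ_src B \<beta>" using e(1) s by blast
  ultimately show "y \<in> \<beta>" using B.germ_memI[OF \<beta>] b(2) c by simp
qed

text \<open>The germ of \<open>a\<close> at the pulled back ultrafilter does it; its domain
  condition comes from that of \<open>h a\<close> in \<beta>.\<close>

lemma hom_germ_ex:
  assumes \<beta>: "\<beta> \<in> germs B" and a: "a \<in> carr A" "h a \<in> \<beta>"
  obtains \<alpha> where "\<alpha> \<in> germs A" "a \<in> \<alpha>" "h ` \<alpha> \<subseteq> \<beta>" "germ_src A \<alpha> = pull (germ_src B \<beta>)"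
proof -
  let ?p = "pull (germ_src B \<beta>)"
  have p: "A.uf ?p" using uf_pull B.uf_germ_src \<beta> by blast
  have d: "A.\<delta> a \<in> ?p" using B.germ_rep(2)[OF \<beta> a(2)] a(1) by simp
  note \<alpha> = A.germ_in_germs[OF p a(1) d] A.germ_self[OF p a(1)] A.germ_src_germ[OF p a(1) d]
  then show thesis using that hom_germ_subset[OF \<alpha>(1,2) \<beta> a(2)] by blast
qed

text \<open>All four sets are ultrafilters, so two inclusions suffice. They come from applying
  \<open>h\<close> to e \<cdot> a and to a \<cdot> e, which are again representatives of
  \<alpha>.\<close>

lemma hom_germ_src_tgt:
  assumes \<alpha>: "\<alpha> \<in> germs A" and \<beta>: "\<beta> \<in> germs B" and s: "h ` \<alpha> \<subseteq> \<beta>"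
  shows "germ_src A \<alpha> = pull (germ_src B \<beta>)" "germ_tgt A \<alpha> = pull (germ_tgt B \<beta>)"
proof -
  obtain a where a: "a \<in> \<alpha>" using A.germ_nonempty \<alpha> .
  have ac: "a \<in> carr A" "h a \<in> \<beta>" using A.germ_rep \<alpha> a s by blast+
  have "e \<in> pull (germ_src B \<beta>)" if e: "e \<in> germ_src A \<alpha>" for e
  proof -
    have E: "e \<in> A.E" using A.uf_E[OF A.uf_germ_src[OF \<alpha>] e] .
    have "h (seq A e a) \<in> \<beta>" using A.germ_res[OF \<alpha> a e] s by blast
    then show ?thesis using B.germ_res_iff[OF \<beta> hom_E[OF E]] ac E by simp
  qed
  then show "germ_src A \<alpha> = pull (germ_src B \<beta>)"
    by (intro A.uf_eqI A.uf_germ_src uf_pull B.uf_germ_src \<alpha> \<beta> subsetI)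
  have "e \<in> pull (germ_tgt B \<beta>)" if e: "e \<in> germ_tgt A \<alpha>" for e
  proof -
    have E: "e \<in> A.E" "seq A a e \<in> \<alpha>" using A.germ_tgt_iff[OF \<alpha> a] e by blast+
    have "h (seq A a e) \<in> \<beta>" using E s by blast
    then show ?thesis using B.germ_tgt_iff[OF \<beta> ac(2)] ac E by simp
  qed
  then show "germ_tgt A \<alpha> = pull (germ_tgt B \<beta>)"
    by (intro A.uf_eqI A.uf_germ_tgt uf_pull B.uf_germ_tgt \<alpha> \<beta> subsetI)
qed

abbreviation F where "F \<equiv> dual_hom A B h"

lemma fobj_dual_hom: "B.uf q \<Longrightarrow> fobj F q = pull q"
  by (simp add: dual_hom_def B.Ob_dual)

lemma farr_dual_hom: "(\<beta>, \<alpha>) \<in> farr F \<longleftrightarrow> \<beta> \<in> germs B \<and> \<alpha> \<in> germs A \<and> h ` \<alpha> \<subseteq> \<beta>"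
  by (simp add: dual_hom_def B.Ar_dual A.Ar_dual)

text \<open>The inclusion from right to left is \<open>hom_germ_ex\<close>. Preimages of basic sets
  are basic, and the identity also expresses naturality of the unit.\<close>

lemma dual_hom_preimage:
  assumes "a \<in> carr A"
  shows "{\<beta> \<in> germs B. farr F `` {\<beta>} \<inter> A.ar a \<noteq> {}} = B.ar (h a)"
proof (intro equalityI subsetI)
  fix \<beta> assume "\<beta> \<in> {\<beta> \<in> germs B. farr F `` {\<beta>} \<inter> A.ar a \<noteq> {}}"
  then obtain \<alpha> where "(\<beta>, \<alpha>) \<in> farr F" "a \<in> \<alpha>" by blast
  then show "\<beta> \<in> B.ar (h a)" unfolding farr_dual_hom by blast
next
  fix \<beta> assume \<beta>: "\<beta> \<in> B.ar (h a)"
  then obtain \<alpha> where "\<alpha> \<in> germs A" "a \<in> \<alpha>" "h ` \<alpha> \<subseteq> \<beta>" using hom_germ_ex assms by blast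
  then have "(\<beta>, \<alpha>) \<in> farr F" "\<alpha> \<in> A.ar a" using \<beta> unfolding farr_dual_hom by blast+
  then show "\<beta> \<in> {\<beta> \<in> germs B. farr F `` {\<beta>} \<inter> A.ar a \<noteq> {}}" using \<beta> by blast
qed

lemma multivalued_functor_dual_hom: "multivalued_functor B.\<C> A.\<C> F"
  unfolding multivalued_functor_def
proof (intro conjI ballI allI impI)
  show "fobj F \<in> Ob B.\<C> \<rightarrow>\<^sub>E Ob A.\<C>"
    by (auto simp: dual_hom_def B.Ob_dual A.Ob_dual uf_pull)
  show "farr F \<subseteq> Ar B.\<C> \<times> Ar A.\<C>" by (auto simp: dual_hom_def)
next
  fix x assume x: "x \<in> farr F"
  obtain \<beta> \<alpha> where ba: "x = (\<beta>, \<alpha>)" by (cases x)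
  have g: "\<beta> \<in> germs B" "\<alpha> \<in> germs A" "h ` \<alpha> \<subseteq> \<beta>" using x ba farr_dual_hom by auto
  show "case x of (f, g) \<Rightarrow> src A.\<C> g = fobj F (src B.\<C> f) \<and> tgt A.\<C> g = fobj F (tgt B.\<C> f)"
    using hom_germ_src_tgt[OF g(2,1,3)] fobj_dual_hom B.uf_germ_src B.uf_germ_tgt g ba by simp
next
  fix q assume "q \<in> Ob B.\<C>"
  then have q: "B.uf q" by (simp add: B.Ob_dual)
  note p = uf_pull[OF q]
  note i = A.germ_idn[OF p] and j = B.germ_idn[OF q]
  obtain e where e: "e \<in> pull q" using A.uf_ex[OF p] by blast
  have "h ` (idn A.\<C> (pull q)) \<subseteq> idn B.\<C> q"
    by (rule hom_germ_subset[OF i(1) i(4)[OF e] j(1) j(4)]) (use e i j in auto)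
  then show "(idn B.\<C> q, idn A.\<C> (fobj F q)) \<in> farr F"
    using i(1) j(1) by (simp add: farr_dual_hom fobj_dual_hom[OF q])
next
  fix \<beta>1 \<beta>2 \<alpha>1 \<alpha>2
  assume "(\<beta>1, \<beta>2) \<in> composable B.\<C> \<and> (\<beta>1, \<alpha>1) \<in> farr F \<and> (\<beta>2, \<alpha>2) \<in> farr F"
  then have b: "\<beta>1 \<in> germs B" "\<beta>2 \<in> germs B" "germ_tgt B \<beta>1 = germ_src B \<beta>2"
    and a: "\<alpha>1 \<in> germs A" "\<alpha>2 \<in> germs A" "h ` \<alpha>1 \<subseteq> \<beta>1" "h ` \<alpha>2 \<subseteq> \<beta>2"
    by (auto simp: B.composable_dual farr_dual_hom)
  have st: "germ_tgt A \<alpha>1 = germ_src A \<alpha>2" using hom_germ_src_tgt(2)[OF a(1) b(1) a(3)] hom_germ_src_tgt(1)[OF a(2) b(2) a(4)] b(3) by simp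
  obtain a1 a2 where a12: "a1 \<in> \<alpha>1" "a2 \<in> \<alpha>2" using A.germ_nonempty a by metis
  note 1 = A.germ_comp[OF a(1,2) st] and 2 = B.germ_comp[OF b]
  have "a1 \<in> carr A" "a2 \<in> carr A" using A.germ_rep a a12 by blast+
  moreover have "seq B (h a1) (h a2) \<in> cmp B.\<C> \<beta>1 \<beta>2" using 2(4) a12 a by blast
  ultimately have "h (seq A a1 a2) \<in> cmp B.\<C> \<beta>1 \<beta>2" by simp
  then have "h ` cmp A.\<C> \<alpha>1 \<alpha>2 \<subseteq> cmp B.\<C> \<beta>1 \<beta>2"
    using hom_germ_subset[OF 1(1) 1(4)[OF a12] 2(1)] 1(2) 2(2) hom_germ_src_tgt(1)[OF a(1) b(1) a(3)] by simp
  then show "(cmp B.\<C> \<beta>1 \<beta>2, cmp A.\<C> \<alpha>1 \<alpha>2) \<in> farr F" using 1(1) 2(1) farr_dual_hom by simp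
qed

lemma continuous_dual_hom: "continuous_mvf B.\<C> A.\<C> F"
  unfolding continuous_mvf_def
proof (intro conjI allI impI)
  show "continuous_map (objs B.\<C>) (objs A.\<C>) (fobj F)"
    unfolding continuous_map_def
  proof (intro conjI allI impI)
    show "fobj F \<in> Ob B.\<C> \<rightarrow> Ob A.\<C>" by (auto simp: B.Ob_dual A.Ob_dual fobj_dual_hom uf_pull)
    fix U assume U: "openin (objs A.\<C>) U"
    show "openin (objs B.\<C>) {q \<in> Ob B.\<C>. fobj F q \<in> U}"
      unfolding B.openin_objs B.Ob_dual
    proof
      fix q assume "q \<in> {q \<in> {q. B.uf q}. fobj F q \<in> U}"
      then have q: "B.uf q" "pull q \<in> U" by (auto simp: fobj_dual_hom)
      have "\<exists>e\<in>A.E. A.uf (pull q) \<and> e \<in> pull q \<and> A.ob e \<subseteq> U"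
        using U q(2) unfolding A.openin_objs by (rule bspec)
      then obtain e where "e \<in> A.E" "e \<in> pull q" and e3: "A.ob e \<subseteq> U" by (elim bexE conjE)
      then have e: "e \<in> A.E" "h e \<in> q" by simp_all
      have "B.ob (h e) \<subseteq> {q \<in> {q. B.uf q}. fobj F q \<in> U}"
      proof
        fix r assume "r \<in> B.ob (h e)"
        then have r: "B.uf r" "h e \<in> r" by auto
        have "pull r \<in> A.ob e" using uf_pull[OF r(1)] r(2) e(1) by simp
        then show "r \<in> {q \<in> {q. B.uf q}. fobj F q \<in> U}" using subsetD[OF e3] r(1) fobj_dual_hom by simp
      qed
      then show "\<exists>e\<in>B.E. B.uf q \<and> e \<in> q \<and> B.ob e \<subseteq> {q \<in> {q. B.uf q}. fobj F q \<in> U}"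
        using e q hom_E by blast
    qed
  qed
next
  fix U assume U: "openin (arrs A.\<C>) U"
  show "openin (arrs B.\<C>) {\<beta> \<in> Ar B.\<C>. farr F `` {\<beta>} \<inter> U \<noteq> {}}"
    unfolding B.openin_arrs B.Ar_dual
  proof
    fix \<beta> assume "\<beta> \<in> {\<beta> \<in> germs B. farr F `` {\<beta>} \<inter> U \<noteq> {}}"
    then obtain \<alpha> where \<alpha>: "\<beta> \<in> germs B" "\<alpha> \<in> U" "(\<beta>, \<alpha>) \<in> farr F" by blast
    then obtain a where a: "a \<in> carr A" "\<alpha> \<in> A.ar a" "A.ar a \<subseteq> U" using U unfolding A.openin_arrs by blast
    then have "\<beta> \<in> B.ar (h a)" using \<alpha> unfolding farr_dual_hom by blast
    moreover have "B.ar (h a) \<subseteq> {\<beta> \<in> germs B. farr F `` {\<beta>} \<inter> U \<noteq> {}}"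
      using a(3) unfolding dual_hom_preimage[OF a(1), symmetric] by blast
    ultimately show "\<exists>b\<in>carr B. \<beta> \<in> germs B \<and> b \<in> \<beta> \<and> B.ar b \<subseteq> {\<beta> \<in> germs B. farr F `` {\<beta>} \<inter> U \<noteq> {}}"
      using a(1) by (intro bexI[of _ "h a"]) auto
  qed
qed

text \<open>For star injectivity, two germs of \<open>B\<close> with one source share an element
  \<open>h a\<close>. For star surjectivity, the germ of \<open>h a\<close> at \<open>q\<close> is
  related to \<alpha>. For the third condition, \<open>h\<close> preserves ranges, so some germ of
  \<open>h a\<close> has target \<open>q\<close>; it is related to a germ \<gamma> of the same
  \<open>a\<close>, which lies in \<open>U\<close> but need not be the given \<alpha>. This is why
  only the weakened form of surjectivity on targets is obtained.\<close>

lemma star_coherent_dual_hom: "star_coherent B.\<C> A.\<C> F"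
  unfolding star_coherent_def
proof (intro conjI)
  show "star_injective B.\<C> F"
    unfolding star_injective_def B.Ar_dual B.dual_simps
  proof (intro ballI impI, elim conjE)
    fix \<beta>1 \<beta>2 assume b: "\<beta>1 \<in> germs B" "\<beta>2 \<in> germs B" "germ_src B \<beta>1 = germ_src B \<beta>2"
      "farr F `` {\<beta>1} \<inter> farr F `` {\<beta>2} \<noteq> {}"
    then obtain \<alpha> where \<alpha>: "\<alpha> \<in> germs A" "h ` \<alpha> \<subseteq> \<beta>1" "h ` \<alpha> \<subseteq> \<beta>2" by (auto simp: farr_dual_hom)
    obtain a where "a \<in> \<alpha>" using A.germ_nonempty \<alpha>(1) .
    then show "\<beta>1 = \<beta>2" using B.germ_eqI[OF b(1-3), of "h a"] \<alpha> by blast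
  qed
  show "star_surjective B.\<C> A.\<C> F"
    unfolding star_surjective_def B.Ar_dual A.Ar_dual B.Ob_dual B.dual_simps A.dual_simps
  proof (intro ballI impI)
    fix q \<alpha> assume "q \<in> {q. B.uf q}" and \<alpha>: "\<alpha> \<in> germs A" "germ_src A \<alpha> = fobj F q"
    then have q: "B.uf q" and s: "germ_src A \<alpha> = pull q" by (simp_all add: fobj_dual_hom)
    obtain a where a: "a \<in> \<alpha>" using A.germ_nonempty \<alpha>(1) .
    then have ac: "a \<in> carr A" "A.\<delta> a \<in> pull q" using A.germ_rep(1,2)[OF \<alpha>(1)] s by auto
    then have d: "B.\<delta> (h a) \<in> q" by simp
    note \<beta> = B.germ_in_germs[OF q hom_carr[OF ac(1)] d] B.germ_self[OF q hom_carr[OF ac(1)]]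
      B.germ_src_germ[OF q hom_carr[OF ac(1)] d]
    have "h ` \<alpha> \<subseteq> germ B q (h a)"
      by (rule hom_germ_subset[OF \<alpha>(1) a \<beta>(1,2)]) (simp add: s \<beta>(3))
    then show "\<exists>f\<in>germs B. germ_src B f = q \<and> (f, \<alpha>) \<in> farr F"
      using \<beta> \<alpha>(1) farr_dual_hom by blast
  qed
  show "co_pseudo_star_surjective B.\<C> A.\<C> F"
    unfolding co_pseudo_star_surjective_def B.Ar_dual A.Ar_dual B.Ob_dual B.dual_simps A.dual_simps
  proof (intro ballI allI impI, elim conjE)
    fix q U assume "q \<in> {q. B.uf q}" and U: "openin (arrs A.\<C>) U" and ne: "U \<inter> {g \<in> germs A. germ_tgt A g = fobj F q} \<noteq> {}"
    then have q: "B.uf q" by simp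
    obtain \<alpha> where \<alpha>: "\<alpha> \<in> U" "\<alpha> \<in> germs A" "germ_tgt A \<alpha> = pull q"
      using ne fobj_dual_hom[OF q] by auto
    then obtain a where a: "a \<in> carr A" "a \<in> \<alpha>" "A.ar a \<subseteq> U" using U unfolding A.openin_arrs by blast
    have "rng B (h a) \<in> q" using A.rng_in_germ_tgt[OF \<alpha>(2) a(2)] \<alpha>(3) a(1) by simp
    then obtain \<beta> where \<beta>: "\<beta> \<in> germs B" "h a \<in> \<beta>" "germ_tgt B \<beta> = q"
      using B.germ_onto_tgt[OF q hom_carr[OF a(1)]] by blast
    obtain \<gamma> where \<gamma>: "\<gamma> \<in> germs A" "a \<in> \<gamma>" "h ` \<gamma> \<subseteq> \<beta>" "germ_src A \<gamma> = pull (germ_src B \<beta>)"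
      using hom_germ_ex[OF \<beta>(1) a(1) \<beta>(2)] .
    then have "\<gamma> \<in> U" using a(3) by blast
    moreover have "(\<beta>, \<gamma>) \<in> farr F" using \<gamma> \<beta> farr_dual_hom by simp
    ultimately show "\<exists>g\<in>U. \<exists>f\<in>germs B. germ_tgt B f = q \<and> (f, g) \<in> farr F"
      using \<beta> by blast
  qed
qed

lemma dual_hom_in_cat_hom: "F \<in> cat_hom B.\<C> A.\<C>"
  using multivalued_functor_dual_hom continuous_dual_hom star_coherent_dual_hom
  by (simp add: cat_hom_def)

end

lemma (in pf_rep) dual_hom_alg_id: "dual_hom A A (alg_id A) = cat_id \<C>"
proof -
  have "(\<lambda>q\<in>Ob \<C>. {e \<in> E. alg_id A e \<in> q}) = (\<lambda>x\<in>Ob \<C>. x)"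
  proof (rule restrict_ext)
    fix q assume "q \<in> Ob \<C>"
    then have "uf q" by (simp add: Ob_dual)
    then show "{e \<in> E. alg_id A e \<in> q} = q" using uf_E by (auto simp: alg_id_def)
  qed
  moreover have "{(\<beta>, \<alpha>). \<beta> \<in> Ar \<C> \<and> \<alpha> \<in> Ar \<C> \<and> alg_id A ` \<alpha> \<subseteq> \<beta>} = Id_on (Ar \<C>)"
  proof -
    have "\<alpha> = \<beta>" if g: "\<beta> \<in> germs A" "\<alpha> \<in> germs A" and s: "alg_id A ` \<alpha> \<subseteq> \<beta>" for \<alpha> \<beta>
    proof -
      have sub: "\<alpha> \<subseteq> \<beta>" using s germ_rep(1)[OF g(2)] by (auto simp: alg_id_def image_subset_iff)
      obtain a where a: "a \<in> \<alpha>" using germ_nonempty[OF g(2)] .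
      \<comment> \<open>The encoded source is monotone in the germ, so inclusion of germs becomes
        inclusion, hence equality, of their sources.\<close>
      have "germ_src A \<alpha> \<subseteq> germ_src A \<beta>" using sub unfolding germ_src_def by blast
      then have "germ_src A \<alpha> = germ_src A \<beta>" using uf_eqI uf_germ_src g by blast
      then show ?thesis using germ_eqI[OF g(2,1)] a sub by blast
    qed
    moreover have "alg_id A ` \<alpha> \<subseteq> \<alpha>" if "\<alpha> \<in> germs A" for \<alpha>
      using germ_rep(1)[OF that] by (auto simp: alg_id_def)
    ultimately show ?thesis unfolding Ar_dual Id_on_def by blast
  qed
  ultimately show ?thesis by (simp add: dual_hom_def cat_id_def)
qed

text \<open>On arrows the composite is defined by an inclusion, whereas the relational composite
  asks for an intermediate germ of \<open>B\<close>. That germ is the one of \<open>h a\<close>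
  below \<gamma> for a representative \<open>a\<close> of \<alpha>, and it contains the image of all
  of \<alpha> by \<open>hom_germ_subset\<close>.\<close>

lemma dual_hom_alg_comp:
  assumes "pf_rep A X \<phi>" "pf_rep B Y \<psi>" "pf_rep C Z \<rho>" "h \<in> alg_hom A B" "k \<in> alg_hom B C"
  shows "dual_hom A C (alg_comp A h k) = cat_comp (dual_cat C) (dual_hom B C k) (dual_hom A B h)"
proof -
  interpret h: pf_rep_hom A X \<phi> B Y \<psi> h using assms by (simp add: pf_rep_hom_def pf_rep_hom_axioms_def)
  interpret k: pf_rep_hom B Y \<psi> C Z \<rho> k using assms by (simp add: pf_rep_hom_def pf_rep_hom_axioms_def)
  let ?D = "dual_cat C"
  have hk: "alg_comp A h k a = k (h a)" if "a \<in> carr A" for a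
    using that by (simp add: alg_comp_def compose_def)
  have "(\<lambda>q\<in>Ob ?D. {e \<in> h.A.E. alg_comp A h k e \<in> q}) = compose (Ob ?D) (fobj (dual_hom A B h)) (fobj (dual_hom B C k))"
    unfolding compose_def
  proof (rule restrict_ext)
    fix q assume "q \<in> Ob ?D"
    then have q: "k.B.uf q" by (simp add: k.B.Ob_dual)
    show "{e \<in> h.A.E. alg_comp A h k e \<in> q} = fobj (dual_hom A B h) (fobj (dual_hom B C k) q)"
      unfolding k.fobj_dual_hom[OF q] h.fobj_dual_hom[OF k.uf_pull[OF q]] using hk by auto
  qed
  moreover have "{(\<gamma>, \<alpha>). \<gamma> \<in> Ar ?D \<and> \<alpha> \<in> Ar (dual_cat A) \<and> alg_comp A h k ` \<alpha> \<subseteq> \<gamma>}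
      = farr (dual_hom B C k) O farr (dual_hom A B h)" (is "?L = ?R")
  proof -
    have "(\<gamma>, \<alpha>) \<in> ?L \<longleftrightarrow> (\<gamma>, \<alpha>) \<in> ?R" for \<gamma> \<alpha>
    proof (cases "\<gamma> \<in> germs C \<and> \<alpha> \<in> germs A")
      case True
      then have \<gamma>: "\<gamma> \<in> germs C" and \<alpha>: "\<alpha> \<in> germs A" by auto
      have im: "alg_comp A h k ` \<alpha> = k ` h ` \<alpha>"
        unfolding image_image by (rule image_cong) (use hk h.A.germ_rep(1)[OF \<alpha>] in auto)
      have mid: "(\<exists>\<beta>\<in>germs B. k ` \<beta> \<subseteq> \<gamma> \<and> h ` \<alpha> \<subseteq> \<beta>) \<longleftrightarrow> k ` h ` \<alpha> \<subseteq> \<gamma>"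
      proof
        assume s: "k ` h ` \<alpha> \<subseteq> \<gamma>"
        obtain a where a: "a \<in> \<alpha>" using h.A.germ_nonempty \<alpha> .
        have ac: "h a \<in> carr B" "k (h a) \<in> \<gamma>" using a s h.A.germ_rep(1)[OF \<alpha> a] by auto
        obtain \<beta> where \<beta>: "\<beta> \<in> germs B" "h a \<in> \<beta>" "k ` \<beta> \<subseteq> \<gamma>" "germ_src B \<beta> = k.pull (germ_src C \<gamma>)"
          using k.hom_germ_ex[OF \<gamma> ac] .
        have "germ_src A \<alpha> \<subseteq> h.pull (germ_src B \<beta>)"
        proof
          fix e assume e: "e \<in> germ_src A \<alpha>"
          have E: "e \<in> h.A.E" using h.A.uf_E[OF h.A.uf_germ_src[OF \<alpha>] e] .
          have "k (h (seq A e a)) \<in> \<gamma>" using h.A.germ_res[OF \<alpha> a e] s by blast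
          then have "k (h e) \<in> germ_src C \<gamma>"
            using k.B.germ_res_iff[OF \<gamma>] E h.A.germ_rep(1)[OF \<alpha> a] by simp
          then show "e \<in> h.pull (germ_src B \<beta>)" using E \<beta>(4) by simp
        qed
        then have "h ` \<alpha> \<subseteq> \<beta>" using h.hom_germ_subset[OF \<alpha> a \<beta>(1,2)] by blast
        then show "\<exists>\<beta>\<in>germs B. k ` \<beta> \<subseteq> \<gamma> \<and> h ` \<alpha> \<subseteq> \<beta>" using \<beta> by blast
      qed blast
      have "(\<gamma>, \<alpha>) \<in> ?L \<longleftrightarrow> k ` h ` \<alpha> \<subseteq> \<gamma>" using True by (simp add: k.B.Ar_dual h.A.Ar_dual im)
      also have "\<dots> \<longleftrightarrow> (\<gamma>, \<alpha>) \<in> ?R"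
        unfolding mid[symmetric] relcomp_unfold mem_Collect_eq case_prod_conv h.farr_dual_hom k.farr_dual_hom
        using True by blast
      finally show ?thesis .
    next
      case False
      then show ?thesis
        unfolding relcomp_unfold mem_Collect_eq case_prod_conv h.farr_dual_hom k.farr_dual_hom
          k.B.Ar_dual h.A.Ar_dual by blast
    qed
    then show ?thesis by (intro set_eqI) (simp add: split_paired_all)
  qed
  ultimately show ?thesis by (simp add: dual_hom_def[of A C] cat_comp_def)
qed

section \<open>The algebra of compact open sections\<close>

text \<open>Points outside \<open>U\<close> are separated from \<open>x\<close> by clopen sets; by
  compactness of the complement of \<open>U\<close>, finitely many of these already exclude it, and
  their intersection is clopen.\<close>

lemma clopen_base:
  assumes X: "compact_space X" "totally_separated_space X" and U: "openin X U" "x \<in> U"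
  obtains K where "openin X K" "closedin X K" "x \<in> K" "K \<subseteq> U"
proof -
  have x: "x \<in> topspace X" using U openin_subset by blast
  define \<U> where "\<U> = {topspace X - V |V. openin X V \<and> closedin X V \<and> x \<in> V}"
  have "compactin X (topspace X - U)" using X(1) U(1) by (simp add: closedin_compact_space openin_closedin_eq)
  moreover have "\<forall>V\<in>\<U>. openin X V" unfolding \<U>_def by auto
  moreover have "topspace X - U \<subseteq> \<Union>\<U>"
  proof
    fix y assume y: "y \<in> topspace X - U"
    then have "x \<noteq> y" using U by blast
    then obtain V where "openin X V" "closedin X V" "x \<in> V" "y \<notin> V"
      using X(2) x y unfolding totally_separated_space_def by blast
    then show "y \<in> \<Union>\<U>" using y unfolding \<U>_def by blast
  qed
  ultimately obtain \<F> where F: "finite \<F>" "\<F> \<subseteq> \<U>" "topspace X - U \<subseteq> \<Union>\<F>"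
    unfolding compactin_def by meson
  have "openin X (\<Union>\<F>)" using F(2) unfolding \<U>_def by (intro openin_Union) auto
  moreover have "closedin X (\<Union>\<F>)" using F(1,2) unfolding \<U>_def by (intro closedin_Union) auto
  moreover have "x \<notin> \<Union>\<F>" using F(2) unfolding \<U>_def by blast
  moreover have "topspace X - \<Union>\<F> \<subseteq> U" using F(3) by blast
  ultimately show thesis using that[of "topspace X - \<Union>\<F>"] x by (simp add: closedin_diff openin_diff)
qed

lemma totally_separated_Hausdorff:
  assumes "totally_separated_space X" shows "Hausdorff_space X"
  unfolding Hausdorff_space_def
proof clarify
  fix x y assume xy: "x \<in> topspace X" "y \<in> topspace X" "x \<noteq> y"
  then obtain U where "openin X U" "closedin X U" "x \<in> U" "y \<notin> U"
    using assms unfolding totally_separated_space_def by blast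
  then show "\<exists>U V. openin X U \<and> openin X V \<and> x \<in> U \<and> y \<in> V \<and> disjnt U V"
    using xy by (intro exI[of _ U] exI[of _ "topspace X - U"]) (auto simp: disjnt_def)
qed

lemma local_homeomorphism_imp_open_map:
  assumes "local_homeomorphism X Y p" shows "open_map X Y p"
  unfolding open_map_def
proof (intro allI impI)
  fix V assume V: "openin X V"
  show "openin Y (p ` V)"
  proof (subst openin_subopen, intro ballI)
    fix y assume "y \<in> p ` V"
    then obtain x where x: "x \<in> V" "y = p x" by blast
    then have "x \<in> topspace X" using V openin_subset by blast
    then obtain U where U: "openin X U" "x \<in> U" "openin Y (p ` U)"
      "homeomorphic_map (subtopology X U) (subtopology Y (p ` U)) p"
      using assms unfolding local_homeomorphism_def by blast
    have "openin (subtopology X U) (U \<inter> V)" using V by (simp add: openin_subtopology_Int2)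
    then have "openin (subtopology Y (p ` U)) (p ` (U \<inter> V))"
      using homeomorphic_imp_open_map[OF U(4)] unfolding open_map_def by blast
    then have "openin Y (p ` (U \<inter> V))" using U(3) openin_trans_full by blast
    then show "\<exists>T. openin Y T \<and> y \<in> T \<and> T \<subseteq> p ` V" using x U(2) by blast
  qed
qed

section \<open>Stone etale categories and clopen sets of objects\<close>

locale stone_etale =
  fixes C :: "('o, 'm) tcat"
  assumes see: "Stone_etale_epi C"
begin

lemma topcat: "topological_category C" and objs_compact: "compact_space (objs C)"
  and objs_ts: "totally_separated_space (objs C)"
  and loc: "local_homeomorphism (arrs C) (objs C) (src C)"
  and open_tgt: "open_map (arrs C) (objs C) (tgt C)"
  and epi: "f \<in> Ar C \<Longrightarrow> epi_arrow C f"
  using see by (auto simp: Stone_etale_epi_def etale_category_def Stone_space_def)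

lemma cat: "small_category C" and cont_src: "continuous_map (arrs C) (objs C) (src C)"
  and cont_tgt: "continuous_map (arrs C) (objs C) (tgt C)"
  and cont_cmp: "continuous_map (subtopology (prod_topology (arrs C) (arrs C)) (composable C)) (arrs C) (\<lambda>(f, g). cmp C f g)"
  and cont_idn: "continuous_map (objs C) (arrs C) (idn C)"
  using topcat by (auto simp: topological_category_def)

lemma st_Ob [simp]: "f \<in> Ar C \<Longrightarrow> src C f \<in> Ob C" "f \<in> Ar C \<Longrightarrow> tgt C f \<in> Ob C"
  using cat by (auto simp: small_category_def)

lemma idn_simps [simp]: "x \<in> Ob C \<Longrightarrow> idn C x \<in> Ar C" "x \<in> Ob C \<Longrightarrow> src C (idn C x) = x" "x \<in> Ob C \<Longrightarrow> tgt C (idn C x) = x"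
  using cat by (auto simp: small_category_def)

lemma cmp_simps [simp]:
  assumes "f \<in> Ar C" "g \<in> Ar C" "tgt C f = src C g"
  shows "cmp C f g \<in> Ar C" "src C (cmp C f g) = src C f" "tgt C (cmp C f g) = tgt C g"
  using cat assms unfolding small_category_def composable_def by blast+

lemma cmp_idn [simp]: "f \<in> Ar C \<Longrightarrow> cmp C (idn C (src C f)) f = f" "f \<in> Ar C \<Longrightarrow> cmp C f (idn C (tgt C f)) = f"
  using cat by (auto simp: small_category_def)

lemma cmp_assoc:
  assumes "f \<in> Ar C" "g \<in> Ar C" "h \<in> Ar C" "tgt C f = src C g" "tgt C g = src C h"
  shows "cmp C (cmp C f g) h = cmp C f (cmp C g h)"
  using cat assms unfolding small_category_def composable_def by blast

lemma cmp_cancel: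
  assumes "f \<in> Ar C" "g \<in> Ar C" "h \<in> Ar C" "tgt C f = src C g" "tgt C f = src C h" "cmp C f g = cmp C f h"
  shows "g = h"
  using epi[OF assms(1)] assms unfolding epi_arrow_def composable_def by blast

lemma open_src: "open_map (arrs C) (objs C) (src C)"
  by (rule local_homeomorphism_imp_open_map[OF loc])

lemma objs_Hausdorff: "Hausdorff_space (objs C)"
  by (rule totally_separated_Hausdorff[OF objs_ts])

lemma preimage_open:
  "openin (objs C) K \<Longrightarrow> openin (arrs C) {f \<in> Ar C. src C f \<in> K}"
  "openin (objs C) K \<Longrightarrow> openin (arrs C) {f \<in> Ar C. tgt C f \<in> K}"
  using cont_src cont_tgt by (auto simp: continuous_map_def)

definition clopen where "clopen K \<longleftrightarrow> openin (objs C) K \<and> closedin (objs C) K"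

lemma clopen_Ob: "clopen K \<Longrightarrow> K \<subseteq> Ob C"
  by (auto simp: clopen_def openin_subset)

lemma clopen_Int: "clopen K \<Longrightarrow> clopen L \<Longrightarrow> clopen (K \<inter> L)"
  and clopen_compl: "clopen K \<Longrightarrow> clopen (Ob C - K)"
  and clopen_full: "clopen (Ob C)"
  by (auto simp: clopen_def openin_diff closedin_diff)

lemma clopenI: "openin (objs C) K \<Longrightarrow> compactin (objs C) K \<Longrightarrow> clopen K"
  using compactin_imp_closedin[OF objs_Hausdorff] by (simp add: clopen_def)

lemma clopen_ex: assumes "openin (objs C) U" "x \<in> U"
  obtains K where "clopen K" "x \<in> K" "K \<subseteq> U"
  using clopen_base[OF objs_compact objs_ts assms] by (auto simp: clopen_def)

section \<open>Compact open sections\<close>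

abbreviation \<A> where "\<A> \<equiv> sections_alg C"
abbreviation \<S> where "\<S> \<equiv> carr \<A>"

text \<open>On an open set where it is injective, the source map is a homeomorphism onto its image.
  Compactness can thus be tested among the objects, which form a compact Hausdorff space, so that
  compact open means clopen there.\<close>

lemma sections_iff: "U \<in> \<S> \<longleftrightarrow> openin (arrs C) U \<and> inj_on (src C) U \<and> clopen (src C ` U)"
proof -
  have "compactin (arrs C) U \<longleftrightarrow> clopen (src C ` U)" if U: "openin (arrs C) U" "inj_on (src C) U"
  proof
    have op: "openin (objs C) (src C ` U)" using open_src U(1) by (simp add: open_map_def)
    show "clopen (src C ` U)" if "compactin (arrs C) U"
      using clopenI[OF op image_compactin[OF that cont_src]] .
    assume "clopen (src C ` U)"
    then have "compactin (objs C) (src C ` U)" using objs_compact by (simp add: clopen_def closedin_compact_space)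
    then have "compactin (subtopology (objs C) (src C ` U)) (src C ` U)" by (simp add: compactin_subtopology)
    moreover have "U \<subseteq> topspace (subtopology (arrs C) U)" using openin_subset[OF U(1)] by simp
    ultimately have "compactin (subtopology (arrs C) U) U"
      using homeomorphic_map_compactness_eq[OF open_inj_homeomorphic_map[OF cont_src open_src U]] by blast
    then show "compactin (arrs C) U" by (simp add: compactin_subtopology)
  qed
  then show ?thesis unfolding sections_alg_def by auto
qed

lemma section_Ar: "U \<in> \<S> \<Longrightarrow> f \<in> U \<Longrightarrow> f \<in> Ar C"
  unfolding sections_iff using openin_subset by blast

lemma section_inj: "U \<in> \<S> \<Longrightarrow> f \<in> U \<Longrightarrow> g \<in> U \<Longrightarrow> src C f = src C g \<Longrightarrow> f = g"
  unfolding sections_iff by (auto dest: inj_onD)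

lemma section_open: "U \<in> \<S> \<Longrightarrow> openin (arrs C) U"
  by (simp add: sections_iff)

lemma section_src: "U \<in> \<S> \<Longrightarrow> clopen (src C ` U)"
  by (simp add: sections_iff)

lemma section_tgt: assumes "U \<in> \<S>" shows "clopen (tgt C ` U)"
proof (rule clopenI)
  show "openin (objs C) (tgt C ` U)" using open_tgt section_open[OF assms] by (simp add: open_map_def)
  have "compactin (arrs C) U" using assms by (simp add: sections_alg_def)
  then show "compactin (objs C) (tgt C ` U)" using image_compactin cont_tgt by blast
qed

lemma section_res: assumes U: "U \<in> \<S>" and K: "clopen K" shows "{f \<in> U. src C f \<in> K} \<in> \<S>"
  unfolding sections_iff
proof (intro conjI)
  have "{f \<in> U. src C f \<in> K} = U \<inter> {f \<in> Ar C. src C f \<in> K}" using section_Ar U by blast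
  then show "openin (arrs C) {f \<in> U. src C f \<in> K}"
    using preimage_open(1) K section_open[OF U] by (simp add: clopen_def openin_Int)
  show "inj_on (src C) {f \<in> U. src C f \<in> K}" using U unfolding sections_iff by (auto intro: inj_on_subset)
  have "src C ` {f \<in> U. src C f \<in> K} = src C ` U \<inter> K" by blast
  then show "clopen (src C ` {f \<in> U. src C f \<in> K})" using clopen_Int[OF section_src[OF U] K] by simp
qed

text \<open>Sections form a base: inside a chart of the source map, cut down to a clopen set of
  sources.\<close>

lemma section_ex: assumes W: "openin (arrs C) W" "f \<in> W"
  obtains U where "U \<in> \<S>" "f \<in> U" "U \<subseteq> W"
proof -
  have f: "f \<in> Ar C" using W openin_subset by blast
  then obtain V where V: "openin (arrs C) V" "f \<in> V" "homeomorphic_map (subtopology (arrs C) V) (subtopology (objs C) (src C ` V)) (src C)"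
    using loc unfolding local_homeomorphism_def by blast
  have inj: "inj_on (src C) V"
    using homeomorphic_imp_injective_map[OF V(3)] openin_subset[OF V(1)] by (simp add: Int_absorb1)
  have "openin (objs C) (src C ` (V \<inter> W))" using open_src V(1) W(1) by (simp add: open_map_def openin_Int)
  then obtain K where K: "clopen K" "src C f \<in> K" "K \<subseteq> src C ` (V \<inter> W)"
    using clopen_ex V(2) W(2) by blast
  let ?U = "(V \<inter> W) \<inter> {g \<in> Ar C. src C g \<in> K}"
  have "src C ` ?U = K" using K(3) openin_subset[OF V(1)] by blast
  moreover have "openin (arrs C) ?U"
    using preimage_open(1) K(1) V(1) W(1) by (intro openin_Int) (auto simp: clopen_def)
  moreover have "inj_on (src C) ?U" using inj by (rule inj_on_subset) blast
  ultimately have "?U \<in> \<S>" using K(1) by (simp add: sections_iff)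
  then show thesis using that[of ?U] K(2) V(2) W(2) f by blast
qed

text \<open>The point is that identities form an open set. A section \<open>W\<close> through the
  identity at \<open>x\<close> contains, by continuity, the identities at all nearby objects, and
  having one arrow per source it contains no other arrow over them.\<close>

lemma idn_section: assumes K: "clopen K" shows "idn C ` K \<in> \<S>"
  unfolding sections_iff
proof (intro conjI)
  have KO: "K \<subseteq> Ob C" using clopen_Ob K .
  have s: "src C (idn C x) = x" if "x \<in> K" for x using that KO by auto
  show "inj_on (src C) (idn C ` K)" using s by (auto intro: inj_onI)
  have "src C ` idn C ` K = K" using s by force
  then show "clopen (src C ` idn C ` K)" using K by simp
  show "openin (arrs C) (idn C ` K)"
  proof (subst openin_subopen, intro ballI)
    fix f assume "f \<in> idn C ` K"
    then obtain x where x: "x \<in> K" "f = idn C x" by blast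
    then have xO: "x \<in> Ob C" using KO by blast
    have "f \<in> Ar C" using x xO by simp
    then obtain W where W: "W \<in> \<S>" "f \<in> W" by (rule section_ex[OF openin_topspace])
    have "openin (objs C) {y \<in> Ob C. idn C y \<in> W}"
      using cont_idn section_open[OF W(1)] by (auto simp: continuous_map_def)
    then have "openin (objs C) ({y \<in> Ob C. idn C y \<in> W} \<inter> K)" using K by (simp add: clopen_def openin_Int)
    then have "openin (arrs C) (W \<inter> {g \<in> Ar C. src C g \<in> {y \<in> Ob C. idn C y \<in> W} \<inter> K})"
      by (rule openin_Int[OF section_open[OF W(1)] preimage_open(1)])
    moreover have "f \<in> W \<inter> {g \<in> Ar C. src C g \<in> {y \<in> Ob C. idn C y \<in> W} \<inter> K}" using W(2) x xO by auto
    moreover have "W \<inter> {g \<in> Ar C. src C g \<in> {y \<in> Ob C. idn C y \<in> W} \<inter> K} \<subseteq> idn C ` K"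
    proof
      fix g assume g: "g \<in> W \<inter> {g \<in> Ar C. src C g \<in> {y \<in> Ob C. idn C y \<in> W} \<inter> K}"
      then have "g = idn C (src C g)" using section_inj[OF W(1), of g "idn C (src C g)"] by auto
      then show "g \<in> idn C ` K" using g by blast
    qed
    ultimately show "\<exists>T. openin (arrs C) T \<and> f \<in> T \<and> T \<subseteq> idn C ` K" by blast
  qed
qed

abbreviation prd where "prd U V \<equiv> {cmp C f g |f g. f \<in> U \<and> g \<in> V \<and> tgt C f = src C g}"

lemma ops [simp]:
  "seq \<A> U V = prd U V"
  "adom \<A> U = idn C ` (Ob C - src C ` U)"
  "rng \<A> U = idn C ` (tgt C ` U)"
  "pref \<A> U V = U \<union> {g \<in> V. src C g \<notin> src C ` U}"
  by (simp_all add: sections_alg_def)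

lemma section_seq: assumes U: "U \<in> \<S>" and V: "V \<in> \<S>" shows "prd U V \<in> \<S>"
  unfolding sections_iff
proof (intro conjI)
  note UA = section_Ar[OF U] and VA = section_Ar[OF V]
  show "inj_on (src C) (prd U V)"
  proof (rule inj_onI)
    fix a b assume "a \<in> prd U V" "b \<in> prd U V" and eq: "src C a = src C b"
    then obtain f g f' g' where a: "a = cmp C f g" "f \<in> U" "g \<in> V" "tgt C f = src C g"
      and b: "b = cmp C f' g'" "f' \<in> U" "g' \<in> V" "tgt C f' = src C g'" by blast
    then have "f = f'" using section_inj[OF U] eq UA VA by simp
    moreover then have "g = g'" using section_inj[OF V] a b by simp
    ultimately show "a = b" using a b by simp
  qed
  show "clopen (src C ` prd U V)"
  proof (rule clopenI)
    have op: "openin (arrs C) (U \<inter> {f \<in> Ar C. tgt C f \<in> src C ` V})"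
      using section_src[OF V] section_open[OF U] by (intro openin_Int preimage_open(2)) (simp_all add: clopen_def)
    \<comment> \<open>A closed set meets a compact one in a compact set even when the space is not
      Hausdorff, as may happen for arrows.\<close>
    have "closedin (arrs C) {f \<in> Ar C. tgt C f \<in> src C ` V}"
      using cont_tgt section_src[OF V] by (auto simp: clopen_def intro: closedin_continuous_map_preimage)
    moreover have "compactin (arrs C) U" using U by (simp add: sections_alg_def)
    ultimately have "compactin (arrs C) (U \<inter> {f \<in> Ar C. tgt C f \<in> src C ` V})"
      by (metis closed_Int_compactin inf_commute)
    moreover have eq: "src C ` prd U V = src C ` (U \<inter> {f \<in> Ar C. tgt C f \<in> src C ` V})"
    proof
      show "src C ` prd U V \<subseteq> src C ` (U \<inter> {f \<in> Ar C. tgt C f \<in> src C ` V})"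
      proof
        fix x assume "x \<in> src C ` prd U V"
        then obtain f g where "f \<in> U" "g \<in> V" "tgt C f = src C g" "x = src C (cmp C f g)" by blast
        moreover then have "x = src C f" using UA VA by simp
        ultimately show "x \<in> src C ` (U \<inter> {f \<in> Ar C. tgt C f \<in> src C ` V})" using UA by blast
      qed
      show "src C ` (U \<inter> {f \<in> Ar C. tgt C f \<in> src C ` V}) \<subseteq> src C ` prd U V"
      proof
        fix x assume "x \<in> src C ` (U \<inter> {f \<in> Ar C. tgt C f \<in> src C ` V})"
        then obtain f g where fg: "f \<in> U" "g \<in> V" "tgt C f = src C g" "x = src C f" by blast
        then have "x = src C (cmp C f g)" using UA VA by simp
        then show "x \<in> src C ` prd U V" using fg by blast
      qed
    qed
    ultimately show "compactin (objs C) (src C ` prd U V)" using image_compactin[OF _ cont_src] by simp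
    show "openin (objs C) (src C ` prd U V)" unfolding eq using open_src op by (simp add: open_map_def)
  qed
  show "openin (arrs C) (prd U V)"
  proof (subst openin_subopen, intro ballI)
    fix h assume "h \<in> prd U V"
    then obtain f g where fg: "f \<in> U" "g \<in> V" "tgt C f = src C g" "h = cmp C f g" by blast
    have h: "h \<in> Ar C" "src C h = src C f" using fg UA VA by simp_all
    \<comment> \<open>A section through \<open>h\<close> serves as a frame. By continuity of
      composition, composites of arrows near \<open>f\<close> and \<open>g\<close> stay in
      \<open>W\<close>, and since \<open>W\<close> has one arrow per source, the arrows of
      \<open>W\<close> over the sources of such composites are these composites.\<close>
    obtain W where W: "W \<in> \<S>" "h \<in> W" using h(1) by (rule section_ex[OF openin_topspace])
    let ?T = "subtopology (prod_topology (arrs C) (arrs C)) (composable C)"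
    have "openin ?T {x \<in> topspace ?T. (\<lambda>(f, g). cmp C f g) x \<in> W}"
      using cont_cmp section_open[OF W(1)] unfolding continuous_map_def by blast
    then obtain N where N: "openin (prod_topology (arrs C) (arrs C)) N"
      "{x \<in> topspace ?T. (\<lambda>(f, g). cmp C f g) x \<in> W} = N \<inter> composable C"
      unfolding openin_subtopology by blast
    have "(f, g) \<in> {x \<in> topspace ?T. (\<lambda>(f, g). cmp C f g) x \<in> W}"
      using fg W(2) UA VA by (auto simp: composable_def)
    then have fgN: "(f, g) \<in> N" using N(2) by blast
    have "\<exists>U' V'. openin (arrs C) U' \<and> openin (arrs C) V' \<and> f \<in> U' \<and> g \<in> V' \<and> U' \<times> V' \<subseteq> N"
      using N(1) fgN unfolding openin_prod_topology_alt by simp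
    then obtain U' V' where U': "openin (arrs C) U'" "openin (arrs C) V'" "f \<in> U'" "g \<in> V'" "U' \<times> V' \<subseteq> N"
      by (elim exE conjE)
    have cW: "cmp C f' g' \<in> W" if "f' \<in> U'" "g' \<in> V'" "tgt C f' = src C g'" for f' g'
    proof -
      have "f' \<in> Ar C" "g' \<in> Ar C" using that U' openin_subset by blast+
      then have "(f', g') \<in> N \<inter> composable C" using that U'(5) by (auto simp: composable_def)
      then show ?thesis unfolding N(2)[symmetric] by simp
    qed
    \<comment> \<open>The arrows of \<open>U\<close> near \<open>f\<close> that can be continued by
      an arrow of \<open>V\<close> near \<open>g\<close>; open because the source map is open and
      the target map continuous.\<close>
    let ?D = "U' \<inter> U \<inter> {f \<in> Ar C. tgt C f \<in> src C ` (V' \<inter> V)}"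
    have "openin (objs C) (src C ` (V' \<inter> V))"
      using open_src U'(2) section_open[OF V] by (simp add: open_map_def openin_Int)
    then have "openin (arrs C) ?D" using U'(1) section_open[OF U] by (intro openin_Int preimage_open(2))
    then have "openin (objs C) (src C ` ?D)" using open_src by (simp add: open_map_def)
    then have "openin (arrs C) (W \<inter> {k \<in> Ar C. src C k \<in> src C ` ?D})"
      using section_open[OF W(1)] by (intro openin_Int preimage_open(1))
    moreover have "f \<in> ?D" using fg U' UA by blast
    then have "h \<in> W \<inter> {k \<in> Ar C. src C k \<in> src C ` ?D}" using W(2) h by simp
    moreover have "W \<inter> {k \<in> Ar C. src C k \<in> src C ` ?D} \<subseteq> prd U V"
    proof
      fix k assume k: "k \<in> W \<inter> {k \<in> Ar C. src C k \<in> src C ` ?D}"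
      then obtain f' where f': "f' \<in> ?D" "src C k = src C f'" by blast
      then obtain g' where g': "g' \<in> V' \<inter> V" "tgt C f' = src C g'" by blast
      have "cmp C f' g' \<in> W" using cW f' g' by blast
      moreover have "src C (cmp C f' g') = src C k" using f' g' UA VA by simp
      ultimately have "k = cmp C f' g'" using section_inj[OF W(1)] k by simp
      then show "k \<in> prd U V" using f' g' by blast
    qed
    ultimately show "\<exists>T. openin (arrs C) T \<and> h \<in> T \<and> T \<subseteq> prd U V" by blast
  qed
qed

lemma section_pref: assumes U: "U \<in> \<S>" and V: "V \<in> \<S>"
  shows "U \<union> {g \<in> V. src C g \<notin> src C ` U} \<in> \<S>"
  unfolding sections_iff
proof (intro conjI)
  have "{g \<in> V. src C g \<notin> src C ` U} = {g \<in> V. src C g \<in> Ob C - src C ` U}" using section_Ar[OF V] by auto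
  then have W: "{g \<in> V. src C g \<notin> src C ` U} \<in> \<S>" using section_res[OF V clopen_compl[OF section_src[OF U]]] by simp
  then show "openin (arrs C) (U \<union> {g \<in> V. src C g \<notin> src C ` U})"
    using section_open[OF U] section_open by (intro openin_Un)
  show "inj_on (src C) (U \<union> {g \<in> V. src C g \<notin> src C ` U})"
    by (rule inj_onI) (use section_inj[OF U] section_inj[OF V] in \<open>auto simp: image_iff; metis\<close>)
  show "clopen (src C ` (U \<union> {g \<in> V. src C g \<notin> src C ` U}))"
    using section_src[OF U] section_src[OF W] by (simp add: image_Un clopen_def openin_Un closedin_Un)
qed

lemma section_empty: "{} \<in> \<S>"
  by (simp add: sections_alg_def)

lemma algebra_sig_sections: "algebra_sig \<A>"
  unfolding algebra_sig_def ops
proof (intro conjI ballI)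
  show "\<S> \<noteq> {}" using section_empty by (rule ex_in_conv[THEN iffD1, OF exI])
qed (auto simp del: ops intro!: section_seq section_pref idn_section clopen_compl section_src section_tgt)

lemma dom_elems_sections: "dom_elems \<A> = {idn C ` K |K. clopen K}"
proof (intro equalityI subsetI)
  fix e assume "e \<in> dom_elems \<A>"
  then show "e \<in> {idn C ` K |K. clopen K}"
    unfolding dom_elems_def ops using clopen_compl[OF section_src] by blast
next
  fix e assume "e \<in> {idn C ` K |K. clopen K}"
  then obtain K where K: "clopen K" "e = idn C ` K" by blast
  have "src C ` idn C ` (Ob C - K) = Ob C - K" by force
  then have "e = adom \<A> (idn C ` (Ob C - K))" using K clopen_Ob[OF K(1)] by (simp add: double_diff)
  then show "e \<in> dom_elems \<A>"
    unfolding dom_elems_def using idn_section[OF clopen_compl[OF K(1)]] by blast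
qed

text \<open>Objects alone would not separate sections with the same sources and targets; the second
  component does. Taking preimages under composition is contravariant on arrows, so
  \<open>act\<close> composes in diagrammatic order. The base type is free to choose by
  \<open>representable_overD\<close>.\<close>

lemma representable_sections: "representable \<A>"
proof (rule representable_overD, rule representable_overI)
  define X where "X = {(x, S). x \<in> Ob C \<and> S \<subseteq> Ar C \<and> (\<forall>f\<in>S. src C f = x)}"
  define act where "act u S = {f \<in> Ar C. src C f = tgt C u \<and> cmp C u f \<in> S}" for u S
  define \<phi> where "\<phi> U = {((src C u, S), (tgt C u, act u S)) |u S. u \<in> U \<and> (src C u, S) \<in> X}" for U
  have act_X: "(tgt C u, act u S) \<in> X" if "u \<in> Ar C" for u S
    using that by (auto simp: X_def act_def)
  have act_idn: "act (idn C x) S = S" if "(x, S) \<in> X" for x S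
    using that by (auto simp: X_def act_def) (metis cmp_idn(1) subsetD)
  have act_cmp: "act (cmp C u v) S = act v (act u S)"
    if "u \<in> Ar C" "v \<in> Ar C" "tgt C u = src C v" for u v S
    using that by (auto simp: act_def cmp_assoc)
  \<comment> \<open>The witness is the image of \<open>T\<close> under composition with
    \<open>u\<close>; cancellation prevents arrows outside \<open>T\<close> from being sent into
    it.\<close>
  have act_onto: "\<exists>S. (src C u, S) \<in> X \<and> act u S = T" if u: "u \<in> Ar C" and T: "(tgt C u, T) \<in> X" for u T
  proof (intro exI conjI)
    show "(src C u, cmp C u ` T) \<in> X" using u T by (auto simp: X_def)
    have "cmp C u f = cmp C u g \<longleftrightarrow> f = g" if "f \<in> Ar C" "src C f = tgt C u" "g \<in> T" for f g
      using cmp_cancel[of u f g] u T that by (auto simp: X_def)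
    then show "act u (cmp C u ` T) = T" using T by (fastforce simp: act_def X_def)
  qed
  have mem: "((x, S), (y, T)) \<in> \<phi> U \<longleftrightarrow> (\<exists>u\<in>U. x = src C u \<and> y = tgt C u \<and> (x, S) \<in> X \<and> T = act u S)" for x S y T U
    unfolding \<phi>_def by blast
  have idn: "((x, S), (y, T)) \<in> \<phi> (idn C ` K) \<longleftrightarrow> x \<in> K \<and> (x, S) \<in> X \<and> (y, T) = (x, S)"
    if "K \<subseteq> Ob C" for x S y T K
    unfolding mem using that act_idn by (auto simp: subset_iff)
  show "algebra_sig \<A>" by (rule algebra_sig_sections)
  show "\<phi> U \<subseteq> X \<times> X \<and> single_valued (\<phi> U)" if U: "U \<in> \<S>" for U
  proof
    show "\<phi> U \<subseteq> X \<times> X" using act_X section_Ar[OF U] unfolding \<phi>_def by blast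
    show "single_valued (\<phi> U)" unfolding single_valued_def
      by (clarsimp simp: mem) (metis section_inj[OF U])
  qed
  show "inj_on \<phi> \<S>"
  proof (rule inj_onI)
    have sub: "U \<subseteq> V" if U: "U \<in> \<S>" and V: "V \<in> \<S>" and eq: "\<phi> U = \<phi> V" for U V
    proof
      fix u assume u: "u \<in> U"
      then have uA: "u \<in> Ar C" using section_Ar U by blast
      \<comment> \<open>The singleton of \<open>u\<close> detects \<open>u\<close>: its image under
        \<open>u\<close> contains an identity, and an arrow \<open>v\<close> with the same image
        must satisfy that \<open>v\<close> composed with this identity is \<open>u\<close>.\<close>
      then have "((src C u, {u}), (tgt C u, act u {u})) \<in> \<phi> U" using u by (auto simp: mem X_def)
      then obtain v where v: "v \<in> V" "src C u = src C v" "tgt C u = tgt C v" "act u {u} = act v {u}"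
        unfolding eq mem by blast
      have vA: "v \<in> Ar C" using section_Ar V v by blast
      have "idn C (tgt C u) \<in> act u {u}" using uA by (simp add: act_def)
      then have "cmp C v (idn C (tgt C v)) = u" unfolding v(4) using v(3) by (simp add: act_def)
      then show "u \<in> V" using vA v(1) by simp
    qed
    show "U = V" if "U \<in> \<S>" "V \<in> \<S>" "\<phi> U = \<phi> V" for U V
      using sub[of U V] sub[of V U] that by auto
  qed
  show "\<phi> (adom \<A> U) = pf_adom X (\<phi> U) \<and> \<phi> (rng \<A> U) = pf_rng (\<phi> U)"
    if U: "U \<in> \<S>" for U
  proof
    have dom: "(\<exists>z. ((x, S), z) \<in> \<phi> U) \<longleftrightarrow> (x, S) \<in> X \<and> x \<in> src C ` U" for x S
      unfolding split_paired_Ex mem by blast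
    have "((x, S), (y, T)) \<in> \<phi> (idn C ` (Ob C - src C ` U)) \<longleftrightarrow> ((x, S), (y, T)) \<in> pf_adom X (\<phi> U)" for x S y T
    proof -
      have "((x, S), (y, T)) \<in> pf_adom X (\<phi> U) \<longleftrightarrow> (x, S) = (y, T) \<and> (x, S) \<in> X \<and> \<not> (\<exists>z. ((x, S), z) \<in> \<phi> U)"
        unfolding pf_adom_def by blast
      then show ?thesis unfolding dom idn[OF Diff_subset] by (auto simp: X_def)
    qed
    then show "\<phi> (adom \<A> U) = pf_adom X (\<phi> U)" unfolding ops by (intro set_eqI) (simp only: split_paired_all)
    have ran: "(\<exists>z. (z, (y, T)) \<in> \<phi> U) \<longleftrightarrow> (y, T) \<in> X \<and> y \<in> tgt C ` U" for y T
    proof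
      assume "(y, T) \<in> X \<and> y \<in> tgt C ` U"
      then obtain u where u: "u \<in> U" "y = tgt C u" "(tgt C u, T) \<in> X" by blast
      then obtain S where "(src C u, S) \<in> X" "act u S = T" using act_onto section_Ar[OF U] by blast
      then have "((src C u, S), (y, T)) \<in> \<phi> U" using u unfolding mem by blast
      then show "\<exists>z. (z, (y, T)) \<in> \<phi> U" by blast
    next
      assume "\<exists>z. (z, (y, T)) \<in> \<phi> U"
      then obtain u S where "u \<in> U" "y = tgt C u" "T = act u S" unfolding split_paired_Ex mem by blast
      then show "(y, T) \<in> X \<and> y \<in> tgt C ` U" using act_X section_Ar[OF U] by blast
    qed
    have "((x, S), (y, T)) \<in> \<phi> (idn C ` (tgt C ` U)) \<longleftrightarrow> ((x, S), (y, T)) \<in> pf_rng (\<phi> U)" for x S y T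
    proof -
      have "((x, S), (y, T)) \<in> pf_rng (\<phi> U) \<longleftrightarrow> (x, S) = (y, T) \<and> (\<exists>z. (z, (y, T)) \<in> \<phi> U)"
        unfolding pf_rng_def by blast
      then show ?thesis unfolding ran idn[OF clopen_Ob[OF section_tgt[OF U]]] by auto
    qed
    then show "\<phi> (rng \<A> U) = pf_rng (\<phi> U)" unfolding ops by (intro set_eqI) (simp only: split_paired_all)
  qed
  show "\<phi> (seq \<A> U V) = \<phi> U O \<phi> V \<and> \<phi> (pref \<A> U V) = pf_pref (\<phi> U) (\<phi> V)"
    if U: "U \<in> \<S>" and V: "V \<in> \<S>" for U V
  proof
    note UA = section_Ar[OF U] and VA = section_Ar[OF V]
    have "((x, S), (y, T)) \<in> \<phi> (prd U V) \<longleftrightarrow> ((x, S), (y, T)) \<in> \<phi> U O \<phi> V" for x S y T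
    proof
      assume "((x, S), (y, T)) \<in> \<phi> (prd U V)"
      then obtain u v where uv: "u \<in> U" "v \<in> V" "tgt C u = src C v" "x = src C (cmp C u v)" "y = tgt C (cmp C u v)"
        "(x, S) \<in> X" "T = act (cmp C u v) S" unfolding mem by blast
      have c: "u \<in> Ar C" "v \<in> Ar C" using uv UA VA by blast+
      have "(src C v, act u S) \<in> X" using act_X[OF c(1), of S] uv(3) by simp
      then have "((tgt C u, act u S), (y, T)) \<in> \<phi> V"
        unfolding mem using uv c by (intro bexI[of _ v]) (simp_all add: act_cmp)
      moreover have "((x, S), (tgt C u, act u S)) \<in> \<phi> U"
        unfolding mem using uv c by (intro bexI[of _ u]) simp_all
      ultimately show "((x, S), (y, T)) \<in> \<phi> U O \<phi> V" by blast
    next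
      assume "((x, S), (y, T)) \<in> \<phi> U O \<phi> V"
      then obtain z R where "((x, S), (z, R)) \<in> \<phi> U" "((z, R), (y, T)) \<in> \<phi> V" by auto
      then obtain u v where uv: "u \<in> U" "v \<in> V" "x = src C u" "tgt C u = src C v" "y = tgt C v"
        "(x, S) \<in> X" "T = act v (act u S)" unfolding mem by auto
      then show "((x, S), (y, T)) \<in> \<phi> (prd U V)"
        unfolding mem using UA VA by (intro bexI[of _ "cmp C u v"]) (auto simp: act_cmp)
    qed
    then show "\<phi> (seq \<A> U V) = \<phi> U O \<phi> V" unfolding ops by (intro set_eqI) (simp only: split_paired_all)
    have dom: "(\<exists>z. ((x, S), z) \<in> \<phi> U) \<longleftrightarrow> (x, S) \<in> X \<and> x \<in> src C ` U" for x S
      unfolding split_paired_Ex mem by blast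
    have "((x, S), (y, T)) \<in> \<phi> (U \<union> {g \<in> V. src C g \<notin> src C ` U}) \<longleftrightarrow> ((x, S), (y, T)) \<in> pf_pref (\<phi> U) (\<phi> V)" for x S y T
      unfolding pf_pref_def mem_Collect_eq case_prod_conv dom unfolding mem bex_Un
      by (rule arg_cong2[where f = "(\<or>)", OF refl]) auto
    then show "\<phi> (pref \<A> U V) = pf_pref (\<phi> U) (\<phi> V)" unfolding ops by (intro set_eqI) (simp only: split_paired_all)
  qed
qed

end

section \<open>Star-coherent functors and preimages of sections\<close>

lemma cat_homD:
  assumes "F \<in> cat_hom C D"
  shows "fobj F \<in> Ob C \<rightarrow>\<^sub>E Ob D"
    and "(f, g) \<in> farr F \<Longrightarrow> f \<in> Ar C \<and> g \<in> Ar D \<and> src D g = fobj F (src C f) \<and> tgt D g = fobj F (tgt C f)"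
    and "x \<in> Ob C \<Longrightarrow> (idn C x, idn D (fobj F x)) \<in> farr F"
    and "(f1, f2) \<in> composable C \<Longrightarrow> (f1, g1) \<in> farr F \<Longrightarrow> (f2, g2) \<in> farr F \<Longrightarrow> (cmp C f1 f2, cmp D g1 g2) \<in> farr F"
    and "continuous_map (objs C) (objs D) (fobj F)"
    and "openin (arrs D) U \<Longrightarrow> openin (arrs C) {f \<in> Ar C. farr F `` {f} \<inter> U \<noteq> {}}"
    and "(f1, g1) \<in> farr F \<Longrightarrow> (f2, g1) \<in> farr F \<Longrightarrow> src C f1 = src C f2 \<Longrightarrow> f1 = f2"
    and "x \<in> Ob C \<Longrightarrow> g \<in> Ar D \<Longrightarrow> src D g = fobj F x \<Longrightarrow> \<exists>f\<in>Ar C. src C f = x \<and> (f, g) \<in> farr F"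
    and "x \<in> Ob C \<Longrightarrow> openin (arrs D) U \<Longrightarrow> g \<in> U \<Longrightarrow> g \<in> Ar D \<Longrightarrow> tgt D g = fobj F x \<Longrightarrow>
      \<exists>g\<in>U. \<exists>f\<in>Ar C. tgt C f = x \<and> (f, g) \<in> farr F"
proof -
  have mf: "multivalued_functor C D F" and co: "continuous_mvf C D F"
    and si: "star_injective C F" and ss: "star_surjective C D F" and cp: "co_pseudo_star_surjective C D F"
    using assms by (simp_all add: cat_hom_def star_coherent_def)
  show "fobj F \<in> Ob C \<rightarrow>\<^sub>E Ob D" using mf by (simp add: multivalued_functor_def)
  show 2: "(f, g) \<in> farr F \<Longrightarrow> f \<in> Ar C \<and> g \<in> Ar D \<and> src D g = fobj F (src C f) \<and> tgt D g = fobj F (tgt C f)" for f g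
    using mf unfolding multivalued_functor_def by blast
  show "x \<in> Ob C \<Longrightarrow> (idn C x, idn D (fobj F x)) \<in> farr F"
    using mf by (simp add: multivalued_functor_def)
  show "(f1, f2) \<in> composable C \<Longrightarrow> (f1, g1) \<in> farr F \<Longrightarrow> (f2, g2) \<in> farr F \<Longrightarrow> (cmp C f1 f2, cmp D g1 g2) \<in> farr F"
    using mf by (simp add: multivalued_functor_def)
  show "continuous_map (objs C) (objs D) (fobj F)"
    and "openin (arrs D) U \<Longrightarrow> openin (arrs C) {f \<in> Ar C. farr F `` {f} \<inter> U \<noteq> {}}"
    using co by (simp_all add: continuous_mvf_def)
  show "(f1, g1) \<in> farr F \<Longrightarrow> (f2, g1) \<in> farr F \<Longrightarrow> src C f1 = src C f2 \<Longrightarrow> f1 = f2"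
    using si 2 unfolding star_injective_def by blast
  show "x \<in> Ob C \<Longrightarrow> g \<in> Ar D \<Longrightarrow> src D g = fobj F x \<Longrightarrow> \<exists>f\<in>Ar C. src C f = x \<and> (f, g) \<in> farr F"
    using ss by (simp add: star_surjective_def)
  show "x \<in> Ob C \<Longrightarrow> openin (arrs D) U \<Longrightarrow> g \<in> U \<Longrightarrow> g \<in> Ar D \<Longrightarrow> tgt D g = fobj F x \<Longrightarrow>
      \<exists>g\<in>U. \<exists>f\<in>Ar C. tgt C f = x \<and> (f, g) \<in> farr F"
    by (rule cp[unfolded co_pseudo_star_surjective_def, THEN bspec, THEN spec, THEN mp, OF _ conjI]) auto
qed

lemma cat_homI:
  assumes "fobj F \<in> Ob C \<rightarrow>\<^sub>E Ob D"
    and "\<And>f g. (f, g) \<in> farr F \<Longrightarrow> f \<in> Ar C \<and> g \<in> Ar D \<and> src D g = fobj F (src C f) \<and> tgt D g = fobj F (tgt C f)"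
    and "\<And>x. x \<in> Ob C \<Longrightarrow> (idn C x, idn D (fobj F x)) \<in> farr F"
    and "\<And>f1 f2 g1 g2. (f1, f2) \<in> composable C \<Longrightarrow> (f1, g1) \<in> farr F \<Longrightarrow> (f2, g2) \<in> farr F \<Longrightarrow> (cmp C f1 f2, cmp D g1 g2) \<in> farr F"
    and "continuous_map (objs C) (objs D) (fobj F)"
    and "\<And>U. openin (arrs D) U \<Longrightarrow> openin (arrs C) {f \<in> Ar C. farr F `` {f} \<inter> U \<noteq> {}}"
    and "\<And>f1 f2 g. (f1, g) \<in> farr F \<Longrightarrow> (f2, g) \<in> farr F \<Longrightarrow> src C f1 = src C f2 \<Longrightarrow> f1 = f2"
    and "\<And>x g. x \<in> Ob C \<Longrightarrow> g \<in> Ar D \<Longrightarrow> src D g = fobj F x \<Longrightarrow> \<exists>f\<in>Ar C. src C f = x \<and> (f, g) \<in> farr F"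
    and "\<And>x U g. x \<in> Ob C \<Longrightarrow> openin (arrs D) U \<Longrightarrow> g \<in> U \<Longrightarrow> g \<in> Ar D \<Longrightarrow> tgt D g = fobj F x \<Longrightarrow>
      \<exists>g\<in>U. \<exists>f\<in>Ar C. tgt C f = x \<and> (f, g) \<in> farr F"
  shows "F \<in> cat_hom C D"
  unfolding cat_hom_def mem_Collect_eq star_coherent_def
proof (intro conjI)
  show "multivalued_functor C D F" unfolding multivalued_functor_def
    by (intro conjI ballI allI impI) (use assms(1-4) in auto)
  show "continuous_mvf C D F" unfolding continuous_mvf_def using assms(5,6) by simp
  show "star_injective C F" unfolding star_injective_def
  proof (intro ballI impI, elim conjE)
    fix f1 f2 assume s: "src C f1 = src C f2" "farr F `` {f1} \<inter> farr F `` {f2} \<noteq> {}"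
    then obtain g where "(f1, g) \<in> farr F" "(f2, g) \<in> farr F" by blast
    then show "f1 = f2" using assms(7) s(1) by blast
  qed
  show "star_surjective C D F" unfolding star_surjective_def by (intro ballI impI assms(8))
  show "co_pseudo_star_surjective C D F" unfolding co_pseudo_star_surjective_def
  proof (intro ballI allI impI, elim conjE)
    fix x U assume x: "x \<in> Ob C" "openin (arrs D) U" "U \<inter> {g \<in> Ar D. tgt D g = fobj F x} \<noteq> {}"
    then obtain g where "g \<in> U" "g \<in> Ar D" "tgt D g = fobj F x" by blast
    then show "\<exists>g\<in>U. \<exists>f\<in>Ar C. tgt C f = x \<and> (f, g) \<in> farr F" using assms(9) x by blast
  qed
qed

lemma cat_id_in_cat_hom: assumes "Stone_etale_epi C" shows "cat_id C \<in> cat_hom C C"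
proof -
  interpret stone_etale C by standard (rule assms)
  have eq: "{f \<in> Ar C. Id_on (Ar C) `` {f} \<inter> U \<noteq> {}} = U" if "openin (arrs C) U" for U
    using openin_subset[OF that] by (auto simp: Id_on_iff)
  show ?thesis
  proof (rule cat_homI)
    show "continuous_map (objs C) (objs C) (fobj (cat_id C))"
      by (rule continuous_map_eq[OF continuous_map_id]) (simp add: cat_id_def)
    show "openin (arrs C) {f \<in> Ar C. farr (cat_id C) `` {f} \<inter> U \<noteq> {}}" if "openin (arrs C) U" for U
      using that eq[OF that] by (simp add: cat_id_def)
    show "\<exists>g\<in>U. \<exists>f\<in>Ar C. tgt C f = x \<and> (f, g) \<in> farr (cat_id C)"
      if "x \<in> Ob C" "g \<in> U" "g \<in> Ar C" "tgt C g = fobj (cat_id C) x" for x U g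
      using that by (auto simp: cat_id_def Id_on_iff)
  qed (auto simp: cat_id_def Id_on_iff composable_def)
qed

lemma cat_comp_id:
  assumes "F \<in> cat_hom C D"
  shows "cat_comp C (cat_id C) F = F" "cat_comp C F (cat_id D) = F"
proof -
  note F = cat_homD(1,2)[OF assms]
  have 1: "compose (Ob C) (fobj F) (\<lambda>x\<in>Ob C. x) = fobj F" "compose (Ob C) (\<lambda>x\<in>Ob D. x) (fobj F) = fobj F"
    using F(1) by (auto simp: compose_def fun_eq_iff PiE_iff extensional_def)
  have 2: "Id_on (Ar C) O farr F = farr F" "farr F O Id_on (Ar D) = farr F"
    using F(2) by (auto simp: Id_on_iff)
  show "cat_comp C (cat_id C) F = F" "cat_comp C F (cat_id D) = F"
    unfolding cat_comp_def cat_id_def by (simp_all add: 1 2)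
qed

lemma cat_comp_in_cat_hom:
  assumes C: "Stone_etale_epi C" and F: "F \<in> cat_hom C D" and G: "G \<in> cat_hom D E"
  shows "cat_comp C F G \<in> cat_hom C E"
proof -
  interpret stone_etale C by standard (rule C)
  note f = cat_homD[OF F] and g = cat_homD[OF G]
  let ?H = "cat_comp C F G"
  have fo: "fobj ?H = compose (Ob C) (fobj G) (fobj F)" by (simp add: cat_comp_def)
  have fa: "(a, c) \<in> farr ?H \<longleftrightarrow> (\<exists>b. (a, b) \<in> farr F \<and> (b, c) \<in> farr G)" for a c
    unfolding cat_comp_def by auto
  have ev: "fobj ?H x = fobj G (fobj F x)" if "x \<in> Ob C" for x
    using that by (simp add: fo compose_def)
  have FO: "fobj F x \<in> Ob D" if "x \<in> Ob C" for x using f(1) that by auto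
  show ?thesis
  proof (rule cat_homI)
    show "fobj ?H \<in> Ob C \<rightarrow>\<^sub>E Ob E" using f(1) g(1) by (auto simp: fo compose_def)
    have "continuous_map (objs C) (objs E) (fobj G \<circ> fobj F)" using f(5) g(5) by (rule continuous_map_compose)
    then show "continuous_map (objs C) (objs E) (fobj ?H)"
      by (rule continuous_map_eq) (simp add: ev)
  next
    fix a c assume "(a, c) \<in> farr ?H"
    then obtain b where "(a, b) \<in> farr F" "(b, c) \<in> farr G" by (auto simp: fa)
    then show "a \<in> Ar C \<and> c \<in> Ar E \<and> src E c = fobj ?H (src C a) \<and> tgt E c = fobj ?H (tgt C a)"
      using f(2)[of a b] g(2)[of b c] by (simp add: ev)
  next
    fix x assume "x \<in> Ob C"
    then show "(idn C x, idn E (fobj ?H x)) \<in> farr ?H"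
      unfolding fa using ev f(3) g(3)[OF FO] by auto
  next
    fix a1 a2 c1 c2 assume a: "(a1, a2) \<in> composable C" "(a1, c1) \<in> farr ?H" "(a2, c2) \<in> farr ?H"
    then obtain b1 b2 where b: "(a1, b1) \<in> farr F" "(b1, c1) \<in> farr G" "(a2, b2) \<in> farr F" "(b2, c2) \<in> farr G"
      by (auto simp: fa)
    have "(b1, b2) \<in> composable D" using f(2)[OF b(1)] f(2)[OF b(3)] a(1) by (simp add: composable_def)
    then show "(cmp C a1 a2, cmp E c1 c2) \<in> farr ?H"
      unfolding fa using f(4)[OF a(1) b(1,3)] g(4)[OF _ b(2,4)] by blast
  next
    fix U assume U: "openin (arrs E) U"
    have "{a \<in> Ar C. farr ?H `` {a} \<inter> U \<noteq> {}} = {a \<in> Ar C. farr F `` {a} \<inter> {b \<in> Ar D. farr G `` {b} \<inter> U \<noteq> {}} \<noteq> {}}"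
      using f(2) by (auto simp: fa set_eq_iff)
    then show "openin (arrs C) {a \<in> Ar C. farr ?H `` {a} \<inter> U \<noteq> {}}" using f(6)[OF g(6)[OF U]] by simp
  next
    fix a1 a2 c assume a: "(a1, c) \<in> farr ?H" "(a2, c) \<in> farr ?H" "src C a1 = src C a2"
    then obtain b1 b2 where b: "(a1, b1) \<in> farr F" "(b1, c) \<in> farr G" "(a2, b2) \<in> farr F" "(b2, c) \<in> farr G"
      by (auto simp: fa)
    have "b1 = b2" using g(7)[OF b(2,4)] f(2)[OF b(1)] f(2)[OF b(3)] a(3) by simp
    then show "a1 = a2" using f(7)[OF b(1)] b(3) a(3) by simp
  next
    fix x c assume x: "x \<in> Ob C" "c \<in> Ar E" "src E c = fobj ?H x"
    then have "src E c = fobj G (fobj F x)" by (simp add: ev)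
    then obtain b where b: "b \<in> Ar D" "src D b = fobj F x" "(b, c) \<in> farr G"
      using g(8)[OF FO[OF x(1)] x(2)] by blast
    then obtain a where "a \<in> Ar C" "src C a = x" "(a, b) \<in> farr F" using f(8)[OF x(1)] by blast
    then show "\<exists>f\<in>Ar C. src C f = x \<and> (f, c) \<in> farr ?H" unfolding fa using b(3) by blast
  next
    fix x U c assume x: "x \<in> Ob C" and U: "openin (arrs E) U" and c: "c \<in> U" "c \<in> Ar E" "tgt E c = fobj ?H x"
    then have "tgt E c = fobj G (fobj F x)" by (simp add: ev)
    then obtain c' b where b: "c' \<in> U" "b \<in> Ar D" "tgt D b = fobj F x" "(b, c') \<in> farr G"
      using g(9)[OF FO[OF x(1)] U c(1,2)] by blast
    \<comment> \<open>Co-pseudo star surjectivity of \<open>G\<close> gives some \<open>b\<close>,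
      but that of \<open>F\<close> cannot be expected to hit \<open>b\<close> itself. It is applied
      to the set of all arrows related to a member of \<open>U\<close>, open by continuity of
      \<open>G\<close>.\<close>
    let ?V = "{b \<in> Ar D. farr G `` {b} \<inter> U \<noteq> {}}"
    have "b \<in> ?V" using b by blast
    then obtain b' a where a: "b' \<in> ?V" "a \<in> Ar C" "tgt C a = x" "(a, b') \<in> farr F"
      using f(9)[OF x g(6)[OF U] _ b(2,3)] by blast
    then obtain c'' where "c'' \<in> U" "(b', c'') \<in> farr G" by blast
    then show "\<exists>g\<in>U. \<exists>f\<in>Ar C. tgt C f = x \<and> (f, g) \<in> farr ?H" unfolding fa using a by blast
  qed
qed

lemma cat_comp_assoc: assumes "F \<in> cat_hom C D"
  shows "cat_comp C (cat_comp C F G) H = cat_comp C F (cat_comp D G H)"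
proof -
  have "fobj F x \<in> Ob D" if "x \<in> Ob C" for x using cat_homD(1)[OF assms] that by auto
  then show ?thesis by (auto simp: cat_comp_def compose_def O_assoc fun_eq_iff)
qed

section \<open>Preimages of sections under a star-coherent functor\<close>

locale stone_etale_hom = C: stone_etale C + D: stone_etale D
  for C :: "('o, 'm) tcat" and D :: "('p, 'n) tcat" +
  fixes F :: "('o, 'm, 'p, 'n) mvf"
  assumes F: "F \<in> cat_hom C D"
begin

abbreviation inv_F where "inv_F U \<equiv> {f \<in> Ar C. farr F `` {f} \<inter> U \<noteq> {}}"

lemma F_Ar: assumes "(f, g) \<in> farr F"
  shows "f \<in> Ar C" "g \<in> Ar D" "src D g = fobj F (src C f)" "tgt D g = fobj F (tgt C f)"
  using cat_homD(2)[OF F assms] by blast+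

lemma F_Ob: "x \<in> Ob C \<Longrightarrow> fobj F x \<in> Ob D"
  using cat_homD(1)[OF F] by auto

text \<open>Star surjectivity lifts an arrow of \<open>U\<close> starting at the image of
  \<open>x\<close> to an arrow starting at \<open>x\<close>. Antidomains are preserved for this
  reason.\<close>

lemma src_inv: assumes U: "U \<in> D.\<S>" shows "src C ` inv_F U = {x \<in> Ob C. fobj F x \<in> src D ` U}"
proof (intro equalityI subsetI)
  fix x assume "x \<in> src C ` inv_F U"
  then obtain f g where "(f, g) \<in> farr F" "g \<in> U" "x = src C f" by blast
  then show "x \<in> {x \<in> Ob C. fobj F x \<in> src D ` U}" using F_Ar[of f g] by (auto intro!: image_eqI[of _ _ g])
next
  fix x assume "x \<in> {x \<in> Ob C. fobj F x \<in> src D ` U}"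
  then obtain g where g: "x \<in> Ob C" "g \<in> U" "src D g = fobj F x" by auto
  then obtain f where "f \<in> Ar C" "src C f = x" "(f, g) \<in> farr F"
    using cat_homD(8)[OF F g(1) D.section_Ar[OF U g(2)]] by blast
  then show "x \<in> src C ` inv_F U" using g(2) by blast
qed

text \<open>Co-pseudo star surjectivity is applied to the open set \<open>U\<close>. The arrow it
  yields may differ from the given one, but membership in \<open>U\<close> is all that the image
  records.\<close>

lemma tgt_inv: assumes U: "U \<in> D.\<S>" shows "tgt C ` inv_F U = {x \<in> Ob C. fobj F x \<in> tgt D ` U}"
proof (intro equalityI subsetI)
  fix x assume "x \<in> tgt C ` inv_F U"
  then obtain f g where "(f, g) \<in> farr F" "g \<in> U" "x = tgt C f" by blast
  then show "x \<in> {x \<in> Ob C. fobj F x \<in> tgt D ` U}" using F_Ar[of f g] by (auto intro!: image_eqI[of _ _ g])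
next
  fix x assume "x \<in> {x \<in> Ob C. fobj F x \<in> tgt D ` U}"
  then obtain g where g: "x \<in> Ob C" "g \<in> U" "tgt D g = fobj F x" by auto
  then obtain g' f where "g' \<in> U" "f \<in> Ar C" "tgt C f = x" "(f, g') \<in> farr F"
    using cat_homD(9)[OF F g(1) D.section_open[OF U] g(2) D.section_Ar[OF U g(2)]] by blast
  then show "x \<in> tgt C ` inv_F U" by blast
qed

text \<open>An arrow related to an identity shares that relative with the identity at its own
  source, so star injectivity makes it an identity.\<close>

lemma inv_idn: assumes K: "K \<subseteq> Ob D" shows "inv_F (idn D ` K) = idn C ` {x \<in> Ob C. fobj F x \<in> K}"
proof (intro equalityI subsetI)
  fix f assume "f \<in> inv_F (idn D ` K)"
  then obtain y where y: "y \<in> K" "(f, idn D y) \<in> farr F" by blast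
  note f = F_Ar[OF y(2)]
  have s: "src C f \<in> Ob C" using f by simp
  have Fs: "fobj F (src C f) = y" using f(3) y(1) K by auto
  then have "(idn C (src C f), idn D y) \<in> farr F" using cat_homD(3)[OF F s] by simp
  then have "f = idn C (src C f)" using cat_homD(7)[OF F y(2)] s by simp
  then show "f \<in> idn C ` {x \<in> Ob C. fobj F x \<in> K}" using s y(1) Fs by blast
next
  fix f assume "f \<in> idn C ` {x \<in> Ob C. fobj F x \<in> K}"
  then obtain x where x: "x \<in> Ob C" "fobj F x \<in> K" "f = idn C x" by blast
  then have "(f, idn D (fobj F x)) \<in> farr F" using cat_homD(3)[OF F x(1)] by simp
  then show "f \<in> inv_F (idn D ` K)" using x F_Ar(1) by blast
qed

text \<open>Two arrows of the preimage with one source have relatives in \<open>U\<close> with one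
  source, hence the same relative, and star injectivity applies. Clopenness of the image is
  \<open>src_inv\<close> with continuity on objects.\<close>

lemma inv_section: assumes U: "U \<in> D.\<S>" shows "inv_F U \<in> C.\<S>"
  unfolding C.sections_iff
proof (intro conjI)
  show "openin (arrs C) (inv_F U)" using cat_homD(6)[OF F D.section_open[OF U]] .
  show "inj_on (src C) (inv_F U)"
  proof (rule inj_onI)
    fix f1 f2 assume "f1 \<in> inv_F U" "f2 \<in> inv_F U" and s: "src C f1 = src C f2"
    then obtain g1 g2 where g: "(f1, g1) \<in> farr F" "g1 \<in> U" "(f2, g2) \<in> farr F" "g2 \<in> U" by blast
    then have "g1 = g2" using D.section_inj[OF U] F_Ar(3) s by metis
    then show "f1 = f2" using cat_homD(7)[OF F g(1)] g(3) s by simp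
  qed
  have "openin (objs D) (src D ` U)" "closedin (objs D) (src D ` U)"
    using D.section_src[OF U] by (simp_all add: D.clopen_def)
  then show "C.clopen (src C ` inv_F U)" unfolding src_inv[OF U] C.clopen_def
    using cat_homD(5)[OF F] openin_continuous_map_preimage closedin_continuous_map_preimage by blast
qed

text \<open>For an arrow \<open>f\<close> related to a composite, star surjectivity lifts the first
  factor at the source of \<open>f\<close> and the second where that lift ends. The composite of the
  lifts is related to the same arrow as \<open>f\<close>, so star injectivity identifies the
  two.\<close>

lemma inv_seq: assumes U: "U \<in> D.\<S>" and V: "V \<in> D.\<S>"
  shows "inv_F (D.prd U V) = C.prd (inv_F U) (inv_F V)"
proof (intro equalityI subsetI)
  fix f assume "f \<in> inv_F (D.prd U V)"
  then obtain u v where uv: "(f, cmp D u v) \<in> farr F" "u \<in> U" "v \<in> V" "tgt D u = src D v" by blast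
  have A: "u \<in> Ar D" "v \<in> Ar D" using uv D.section_Ar[OF U] D.section_Ar[OF V] by blast+
  note f = F_Ar[OF uv(1)]
  have "src D u = fobj F (src C f)" using f(3) A uv(4) by simp
  then obtain f1 where f1: "f1 \<in> Ar C" "src C f1 = src C f" "(f1, u) \<in> farr F"
    using cat_homD(8)[OF F _ A(1)] f(1) C.st_Ob(1) by blast
  have "src D v = fobj F (tgt C f1)" using F_Ar(4)[OF f1(3)] uv(4) by simp
  then obtain f2 where f2: "f2 \<in> Ar C" "src C f2 = tgt C f1" "(f2, v) \<in> farr F"
    using cat_homD(8)[OF F _ A(2)] f1(1) C.st_Ob(2) by blast
  have "(f1, f2) \<in> composable C" using f1 f2 by (simp add: composable_def)
  then have "(cmp C f1 f2, cmp D u v) \<in> farr F" using cat_homD(4)[OF F _ f1(3) f2(3)] by blast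
  then have "f = cmp C f1 f2" using cat_homD(7)[OF F uv(1)] f1 f2 by simp
  moreover have "f1 \<in> inv_F U" "f2 \<in> inv_F V" using f1 f2 uv by blast+
  ultimately show "f \<in> C.prd (inv_F U) (inv_F V)" using f2(2) by force
next
  fix f assume "f \<in> C.prd (inv_F U) (inv_F V)"
  then obtain f1 f2 u v where f: "f = cmp C f1 f2" "tgt C f1 = src C f2" "(f1, u) \<in> farr F" "u \<in> U"
    "(f2, v) \<in> farr F" "v \<in> V" by blast
  have "(f1, f2) \<in> composable C" using F_Ar(1) f by (simp add: composable_def)
  then have "(f, cmp D u v) \<in> farr F" using cat_homD(4)[OF F _ f(3,5)] f(1) by simp
  moreover have "tgt D u = src D v" using F_Ar(3)[OF f(5)] F_Ar(4)[OF f(3)] f(2) by simp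
  then have "cmp D u v \<in> D.prd U V" using f(4,6) by blast
  ultimately show "f \<in> inv_F (D.prd U V)" using F_Ar(1) by blast
qed

lemma inv_pref: assumes U: "U \<in> D.\<S>"
  shows "inv_F (U \<union> {g \<in> V. src D g \<notin> src D ` U}) = inv_F U \<union> {g \<in> inv_F V. src C g \<notin> src C ` inv_F U}"
proof -
  have s: "src C f \<in> src C ` inv_F U \<longleftrightarrow> src D g \<in> src D ` U" if "(f, g) \<in> farr F" for f g
    unfolding src_inv[OF U] using F_Ar[OF that] by auto
  have "f \<in> inv_F {g \<in> V. src D g \<notin> src D ` U} \<longleftrightarrow> f \<in> inv_F V \<and> src C f \<notin> src C ` inv_F U" for f
  proof
    assume "f \<in> inv_F {g \<in> V. src D g \<notin> src D ` U}"
    then obtain g where "(f, g) \<in> farr F" "g \<in> V" "src D g \<notin> src D ` U" by blast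
    then show "f \<in> inv_F V \<and> src C f \<notin> src C ` inv_F U" using s F_Ar(1) by blast
  next
    assume "f \<in> inv_F V \<and> src C f \<notin> src C ` inv_F U"
    then obtain g where "(f, g) \<in> farr F" "g \<in> V" "src C f \<notin> src C ` inv_F U" by blast
    then show "f \<in> inv_F {g \<in> V. src D g \<notin> src D ` U}" using s F_Ar(1) by blast
  qed
  then have "inv_F {g \<in> V. src D g \<notin> src D ` U} = {g \<in> inv_F V. src C g \<notin> src C ` inv_F U}" by blast
  moreover have "inv_F (U \<union> W) = inv_F U \<union> inv_F W" for W by blast
  ultimately show ?thesis by simp
qed

lemma sections_hom_eq: "U \<in> D.\<S> \<Longrightarrow> sections_hom C D F U = inv_F U"
  by (simp add: sections_hom_def)

lemma sections_hom_in_alg_hom: "sections_hom C D F \<in> alg_hom (sections_alg D) (sections_alg C)"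
  unfolding alg_hom_def
proof (intro CollectI conjI ballI)
  show "sections_hom C D F \<in> D.\<S> \<rightarrow>\<^sub>E C.\<S>" using inv_section by (auto simp: sections_hom_def)
next
  fix U assume U: "U \<in> D.\<S>"
  have "adom (sections_alg D) U \<in> D.\<S>" "rng (sections_alg D) U \<in> D.\<S>"
    using D.algebra_sig_sections U unfolding algebra_sig_def by blast+
  moreover have "{x \<in> Ob C. fobj F x \<in> Ob D - src D ` U} = Ob C - src C ` inv_F U"
    unfolding src_inv[OF U] using F_Ob by blast
  moreover have "tgt D ` U \<subseteq> Ob D" using D.clopen_Ob[OF D.section_tgt[OF U]] .
  ultimately show "sections_hom C D F (adom (sections_alg D) U) = adom (sections_alg C) (sections_hom C D F U)"
    "sections_hom C D F (rng (sections_alg D) U) = rng (sections_alg C) (sections_hom C D F U)"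
    using U by (simp_all add: sections_hom_eq inv_idn tgt_inv)
next
  fix U V assume U: "U \<in> D.\<S>" and V: "V \<in> D.\<S>"
  show "sections_hom C D F (seq (sections_alg D) U V) = seq (sections_alg C) (sections_hom C D F U) (sections_hom C D F V)"
    unfolding C.ops D.ops sections_hom_eq[OF U] sections_hom_eq[OF V] sections_hom_eq[OF D.section_seq[OF U V]]
    by (rule inv_seq[OF U V])
  show "sections_hom C D F (pref (sections_alg D) U V) = pref (sections_alg C) (sections_hom C D F U) (sections_hom C D F V)"
    unfolding C.ops D.ops sections_hom_eq[OF U] sections_hom_eq[OF V] sections_hom_eq[OF D.section_pref[OF U V]]
    by (rule inv_pref[OF U])
qed

end

lemma (in stone_etale) sections_hom_cat_id: "sections_hom C C (cat_id C) = alg_id (sections_alg C)"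
  unfolding sections_hom_def alg_id_def
proof (rule restrict_ext)
  fix U assume "U \<in> \<S>"
  then show "{f \<in> Ar C. farr (cat_id C) `` {f} \<inter> U \<noteq> {}} = U"
    using section_Ar by (auto simp: cat_id_def Id_on_iff)
qed

lemma sections_hom_cat_comp:
  assumes "Stone_etale_epi C" "Stone_etale_epi D" "Stone_etale_epi E" and F: "F \<in> cat_hom C D" and G: "G \<in> cat_hom D E"
  shows "sections_hom C E (cat_comp C F G) = alg_comp (sections_alg E) (sections_hom D E G) (sections_hom C D F)"
proof -
  interpret F: stone_etale_hom C D F
    using assms by (simp add: stone_etale_hom_def stone_etale_def stone_etale_hom_axioms_def)
  interpret G: stone_etale_hom D E G
    using assms by (simp add: stone_etale_hom_def stone_etale_def stone_etale_hom_axioms_def)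
  show ?thesis unfolding alg_comp_def compose_def sections_hom_def[of C E]
  proof (rule restrict_ext)
    fix U assume U: "U \<in> G.D.\<S>"
    show "{f \<in> Ar C. farr (cat_comp C F G) `` {f} \<inter> U \<noteq> {}} = sections_hom C D F (sections_hom D E G U)"
      unfolding G.sections_hom_eq[OF U] F.sections_hom_eq[OF G.inv_section[OF U]]
    proof (intro equalityI subsetI)
      fix f assume "f \<in> {f \<in> Ar C. farr (cat_comp C F G) `` {f} \<inter> U \<noteq> {}}"
      then obtain c b where "(f, b) \<in> farr F" "(b, c) \<in> farr G" "c \<in> U" by (auto simp: cat_comp_def)
      then show "f \<in> F.inv_F (G.inv_F U)" using F.F_Ar(1) G.F_Ar(1) by blast
    next
      fix f assume "f \<in> F.inv_F (G.inv_F U)"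
      then obtain b c where "f \<in> Ar C" "(f, b) \<in> farr F" "(b, c) \<in> farr G" "c \<in> U" by blast
      then show "f \<in> {f \<in> Ar C. farr (cat_comp C F G) `` {f} \<inter> U \<noteq> {}}" by (auto simp: cat_comp_def)
    qed
  qed
qed

section \<open>The unit on algebras\<close>

lemma alg_isoI:
  assumes A: "algebra_sig A" and h: "h \<in> alg_hom A B" and bij: "bij_betw h (carr A) (carr B)"
  shows "alg_iso A B h"
proof -
  define k where "k = restrict (inv_into (carr A) h) (carr B)"
  have hk: "k b \<in> carr A" "h (k b) = b" if "b \<in> carr B" for b
    using that bij unfolding k_def bij_betw_def by (auto simp: inv_into_into f_inv_into_f)
  have kh: "k (h a) = a" if "a \<in> carr A" for a
    using that bij unfolding k_def bij_betw_def by auto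
  have cl: "adom A a \<in> carr A" "rng A a \<in> carr A" "seq A a b \<in> carr A" "pref A a b \<in> carr A"
    if "a \<in> carr A" "b \<in> carr A" for a b using A that by (auto simp: algebra_sig_def)
  have hom: "h (adom A a) = adom B (h a)" "h (rng A a) = rng B (h a)"
    "h (seq A a b) = seq B (h a) (h b)" "h (pref A a b) = pref B (h a) (h b)"
    if "a \<in> carr A" "b \<in> carr A" for a b using h that by (auto simp: alg_hom_def)
  have "k \<in> alg_hom B A" unfolding alg_hom_def
  proof (intro CollectI conjI ballI)
    show "k \<in> carr B \<rightarrow>\<^sub>E carr A" using hk by (auto simp: k_def)
    fix b assume b: "b \<in> carr B"
    show "k (adom B b) = adom A (k b)" "k (rng B b) = rng A (k b)"
      using kh[OF cl(1)[OF hk(1)[OF b] hk(1)[OF b]]] kh[OF cl(2)[OF hk(1)[OF b] hk(1)[OF b]]]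
        hom(1,2)[OF hk(1)[OF b] hk(1)[OF b]] hk(2)[OF b] by simp_all
    fix c assume c: "c \<in> carr B"
    show "k (seq B b c) = seq A (k b) (k c)" "k (pref B b c) = pref A (k b) (k c)"
      using kh[OF cl(3)[OF hk(1)[OF b] hk(1)[OF c]]] kh[OF cl(4)[OF hk(1)[OF b] hk(1)[OF c]]]
        hom(3,4)[OF hk(1)[OF b] hk(1)[OF c]] hk(2)[OF b] hk(2)[OF c] by simp_all
  qed
  moreover have "alg_comp A h k = alg_id A" unfolding alg_comp_def alg_id_def compose_def
    by (rule restrict_ext) (rule kh)
  moreover have "alg_comp B k h = alg_id B" unfolding alg_comp_def alg_id_def compose_def
    by (rule restrict_ext) (rule hk(2))
  ultimately show ?thesis using h unfolding alg_iso_def by blast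
qed

text \<open>Makes the calculus of sections available for the dual of \<open>A\<close>, under the
  qualifier \<open>dual\<close>.\<close>

sublocale pf_rep \<subseteq> dual: stone_etale "dual_cat A"
  by standard (rule Stone_etale_epi_dual)

context pf_rep
begin

lemma germ_cong:
  assumes "\<gamma> \<in> germs A" "e \<in> germ_src A \<gamma>" "a \<in> carr A" "b \<in> carr A" "e \<cdot> a = e \<cdot> b"
  shows "a \<in> \<gamma> \<longleftrightarrow> b \<in> \<gamma>"
  using germ_memI[OF assms(1) _ assms(4,2,5)] germ_memI[OF assms(1) _ assms(3,2) assms(5)[symmetric]] by blast

lemma ar_section: assumes "a \<in> carr A" shows "ar a \<in> dual.\<S>"
  unfolding dual.sections_iff
  using assms by (simp add: openin_ar inj_src_ar src_ar dual.clopen_def openin_ob clopen_ob)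

lemma ar_E: assumes e: "e \<in> E" shows "ar e = idn \<C> ` ob e"
proof (intro equalityI subsetI)
  fix \<gamma> assume "\<gamma> \<in> ar e"
  then have \<gamma>: "\<gamma> \<in> germs A" "e \<in> \<gamma>" by auto
  have s: "uf (germ_src A \<gamma>)" "e \<in> germ_src A \<gamma>" using uf_germ_src germ_mem_src e \<gamma> by blast+
  have "\<gamma> = idn \<C> (germ_src A \<gamma>)"
    using germ_eqI[OF \<gamma>(1) germ_idn(1)[OF s(1)] _ \<gamma>(2) germ_idn(4)[OF s]] germ_idn(2)[OF s(1)] by simp
  then show "\<gamma> \<in> idn \<C> ` ob e" using s by blast
qed (use germ_idn in auto)

text \<open>A germ of a \<cdot> b factors as the germ of \<open>a\<close> at the same source
  followed by the germ of \<open>b\<close> at the target so reached; the two domain conditions are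
  both contained in that of a \<cdot> b.\<close>

lemma ar_seq: assumes a: "a \<in> carr A" and b: "b \<in> carr A" shows "ar (a \<cdot> b) = dual.prd (ar a) (ar b)"
proof (intro equalityI subsetI)
  fix \<gamma> assume "\<gamma> \<in> ar (a \<cdot> b)"
  then have \<gamma>: "\<gamma> \<in> germs A" "a \<cdot> b \<in> \<gamma>" by auto
  let ?p = "germ_src A \<gamma>"
  have p: "uf ?p" using uf_germ_src \<gamma> by blast
  have ab: "\<delta> (a \<cdot> b) \<in> ?p" using germ_rep(2)[OF \<gamma>] .
  have "\<delta> (a \<cdot> b) \<cdot> \<delta> a = \<delta> (a \<cdot> b)"
    using a b delta_res[of "\<delta> a" "a \<cdot> b"] E_comm[of "\<delta> a" "\<delta> (a \<cdot> b)"] by (simp flip: assoc)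
  then have pa: "\<delta> a \<in> ?p" using uf_le[OF p ab] a by simp
  note \<alpha> = germ_in_germs[OF p a pa] germ_self[OF p a] germ_src_germ[OF p a pa]
  let ?\<alpha> = "germ A ?p a"
  have "\<delta> b \<in> germ_tgt A ?\<alpha>"
    using germ_tgt_iff[OF \<alpha>(1,2)] germ_cores_iff[OF \<alpha>(1,2)] \<alpha>(3) ab delta_seq_delta[OF a b] b by simp
  note q = uf_germ_tgt[OF \<alpha>(1)] and qb = this
  note \<beta> = germ_in_germs[OF q b qb] germ_self[OF q b] germ_src_germ[OF q b qb]
  note c = germ_comp[OF \<alpha>(1) \<beta>(1) \<beta>(3)[symmetric]]
  have "\<gamma> = cmp \<C> ?\<alpha> (germ A (germ_tgt A ?\<alpha>) b)"
    using germ_eqI[OF \<gamma>(1) c(1) _ \<gamma>(2) c(4)[OF \<alpha>(2) \<beta>(2)]] c(2) \<alpha>(3) by simp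
  moreover have "?\<alpha> \<in> ar a" "germ A (germ_tgt A ?\<alpha>) b \<in> ar b" using \<alpha>(1,2) \<beta>(1,2) by simp_all
  moreover have "tgt \<C> ?\<alpha> = src \<C> (germ A (germ_tgt A ?\<alpha>) b)" using \<beta>(3) by simp
  ultimately show "\<gamma> \<in> dual.prd (ar a) (ar b)" unfolding mem_Collect_eq[of \<gamma>] by (intro exI conjI)
next
  fix \<gamma> assume "\<gamma> \<in> dual.prd (ar a) (ar b)"
  then obtain \<alpha> \<beta> where "\<alpha> \<in> ar a" "\<beta> \<in> ar b" "germ_tgt A \<alpha> = germ_src A \<beta>" "\<gamma> = cmp \<C> \<alpha> \<beta>" by auto
  then show "\<gamma> \<in> ar (a \<cdot> b)" using germ_comp[of \<alpha> \<beta>] by simp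
qed

lemma ob_compl: "e \<in> E \<Longrightarrow> Ob \<C> - ob e = ob (adom A e)"
  using uf_adom unfolding Ob_dual by blast

text \<open>The source of a germ decides \<delta> a. On one side the preferential union agrees with
  \<open>a\<close>, on the other with \<open>b\<close>, and \<open>germ_cong\<close> transfers
  membership.\<close>

lemma ar_pref: assumes a: "a \<in> carr A" and b: "b \<in> carr A"
  shows "ar (pref A a b) = ar a \<union> {\<beta> \<in> ar b. germ_src A \<beta> \<notin> germ_src A ` ar a}"
proof -
  have "pref A a b \<in> \<gamma> \<longleftrightarrow> a \<in> \<gamma> \<or> b \<in> \<gamma> \<and> \<delta> a \<notin> germ_src A \<gamma>" if \<gamma>: "\<gamma> \<in> germs A" for \<gamma>
  proof (cases "\<delta> a \<in> germ_src A \<gamma>")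
    case True
    have "pref A a b \<in> \<gamma> \<longleftrightarrow> a \<in> \<gamma>"
      by (rule germ_cong[OF \<gamma> True]) (use a b pref_res in simp_all)
    then show ?thesis using True by blast
  next
    case False
    then have "adom A (\<delta> a) \<in> germ_src A \<gamma>" using uf_adom[OF uf_germ_src[OF \<gamma>], of "\<delta> a"] a by simp
    then have "adom A a \<in> germ_src A \<gamma>" using a by simp
    then have "pref A a b \<in> \<gamma> \<longleftrightarrow> b \<in> \<gamma>"
      by (rule germ_cong[OF \<gamma>]) (use a b pref_cores in simp_all)
    then show ?thesis using False germ_rep(2)[OF \<gamma>] by blast
  qed
  then show ?thesis unfolding src_ar[OF a] using uf_germ_src by blast
qed

lemma alg_unit_in_alg_hom: "alg_unit A \<in> alg_hom A (sections_alg \<C>)"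
  unfolding alg_hom_def
proof (intro CollectI conjI ballI)
  show "alg_unit A \<in> carr A \<rightarrow>\<^sub>E dual.\<S>" using ar_section by (auto simp: alg_unit_def)
  fix a assume a: "a \<in> carr A"
  have "adom A (\<delta> a) = adom A a" using a by simp
  then have "Ob \<C> - ob (\<delta> a) = ob (adom A a)" using ob_compl[of "\<delta> a"] a by simp
  then show "alg_unit A (adom A a) = adom (sections_alg \<C>) (alg_unit A a)"
    "alg_unit A (rng A a) = rng (sections_alg \<C>) (alg_unit A a)"
    using a by (simp_all add: alg_unit_def src_ar tgt_ar ar_E)
  fix b assume b: "b \<in> carr A"
  show "alg_unit A (a \<cdot> b) = seq (sections_alg \<C>) (alg_unit A a) (alg_unit A b)"
    unfolding dual.ops using ar_seq[OF a b] a b by (simp add: alg_unit_def)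
  show "alg_unit A (pref A a b) = pref (sections_alg \<C>) (alg_unit A a) (alg_unit A b)"
    unfolding dual.ops using ar_pref[OF a b] a b by (simp add: alg_unit_def)
qed

text \<open>Preferential union acts as a union here because all pieces lie in one set with injective
  source: a germ of the second piece over the domain of the first already belongs to the
  first.\<close>

lemma ar_finite_Union:
  assumes U: "inj_on (germ_src A) U" and G: "finite G" "G \<subseteq> carr A" "\<Union>(ar ` G) \<subseteq> U"
  shows "\<exists>c\<in>carr A. ar c = \<Union>(ar ` G)"
  using G
proof (induction G)
  case empty
  obtain a where a: "a \<in> carr A" using sig by (auto simp: algebra_sig_def)
  \<comment> \<open>The empty union is represented by a domain element composed with its complement,
    which no ultrafilter contains.\<close>
  let ?e = "adom A a"
  have "ob (?e \<cdot> adom A ?e) = {}" using uf_seq[of _ ?e "adom A ?e"] uf_adom[of _ ?e] a by simp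
  then have "ar (?e \<cdot> adom A ?e) = {}" using ar_E[of "?e \<cdot> adom A ?e"] a by simp
  then show ?case using a by (intro bexI[of _ "?e \<cdot> adom A ?e"]) auto
next
  case (insert a G)
  then obtain c where c: "c \<in> carr A" "ar c = \<Union>(ar ` G)" by auto
  have a: "a \<in> carr A" using insert by simp
  have sub: "ar a \<union> ar c \<subseteq> U" using insert.prems c(2) by simp
  have "\<beta> \<in> ar a" if \<beta>: "\<beta> \<in> ar c" "germ_src A \<beta> \<in> germ_src A ` ar a" for \<beta>
  proof -
    obtain \<alpha> where \<alpha>: "\<alpha> \<in> ar a" "germ_src A \<beta> = germ_src A \<alpha>" using \<beta>(2) by blast
    then have "\<beta> = \<alpha>" using inj_onD[OF U] sub \<beta>(1) by blast
    then show ?thesis using \<alpha>(1) by simp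
  qed
  then have "ar (pref A a c) = ar a \<union> ar c" unfolding ar_pref[OF a c(1)] by blast
  then show ?case using c a by (intro bexI[of _ "pref A a c"]) auto
qed

text \<open>A section is open, hence a union of basic sets, and by compactness a finite one.\<close>

lemma alg_unit_onto: assumes U: "U \<in> dual.\<S>" shows "\<exists>c\<in>carr A. ar c = U"
proof -
  let ?\<U> = "{ar a |a. a \<in> carr A \<and> ar a \<subseteq> U}"
  have "compactin (arrs \<C>) U" using U by (simp add: sections_alg_def)
  moreover have "\<forall>V\<in>?\<U>. openin (arrs \<C>) V" using openin_ar by blast
  moreover have "U \<subseteq> \<Union>?\<U>"
  proof
    fix \<alpha> assume "\<alpha> \<in> U"
    then obtain a where "a \<in> carr A" "\<alpha> \<in> ar a" "ar a \<subseteq> U"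
      using dual.section_open[OF U] unfolding openin_arrs by blast
    then show "\<alpha> \<in> \<Union>?\<U>" by (intro UnionI[of "ar a"]) auto
  qed
  ultimately obtain \<F> where F: "finite \<F>" "\<F> \<subseteq> ?\<U>" "U \<subseteq> \<Union>\<F>" unfolding compactin_def by meson
  have "\<F> \<subseteq> ar ` {a \<in> carr A. ar a \<subseteq> U}" using F(2) by blast
  then obtain G where G: "finite G" "G \<subseteq> {a \<in> carr A. ar a \<subseteq> U}" "\<F> = ar ` G"
    using F(1) by (meson finite_subset_image)
  have sub: "\<Union>(ar ` G) \<subseteq> U" using G(2) by blast
  have "inj_on (germ_src A) U" using U by (simp add: dual.sections_iff)
  then obtain c where "c \<in> carr A" "ar c = \<Union>(ar ` G)" using ar_finite_Union[OF _ G(1) _ sub] G(2) by blast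
  then show ?thesis using sub F(3) G(3) by (intro bexI[of _ c]) auto
qed

lemma alg_unit_inj: assumes "a \<in> carr A" "b \<in> carr A" "ar a = ar b" shows "a = b"
proof (rule ccontr)
  assume "a \<noteq> b"
  then obtain p where p: "uf p" "\<delta> a \<in> p \<or> \<delta> b \<in> p" "\<And>e. e \<in> p \<Longrightarrow> e \<cdot> a \<noteq> e \<cdot> b"
    using separation[OF assms(1,2)] by blast
  \<comment> \<open>A germ at \<open>p\<close> containing both \<open>a\<close> and \<open>b\<close>
    would make them agree on a member of \<open>p\<close>. Such a germ exists whichever of the two
    domains is in \<open>p\<close>, since \<open>ar a\<close> = \<open>ar b\<close>.\<close>
  have key: False if c: "c \<in> carr A" "\<delta> c \<in> p" "a \<in> germ A p c" "b \<in> germ A p c" for c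
  proof -
    note \<gamma> = germ_in_germs[OF p(1) c(1,2)]
    obtain e where "e \<in> germ_src A (germ A p c)" "e \<cdot> a = e \<cdot> b" using germ_memE[OF \<gamma> c(3,4)] .
    then show False using p(3) germ_src_germ[OF p(1) c(1,2)] by blast
  qed
  from p(2) show False
  proof
    assume d: "\<delta> a \<in> p"
    have "germ A p a \<in> ar a" using germ_in_germs[OF p(1) assms(1) d] germ_self[OF p(1) assms(1)] by simp
    then show False using key[OF assms(1) d] assms(3) by blast
  next
    assume d: "\<delta> b \<in> p"
    have "germ A p b \<in> ar b" using germ_in_germs[OF p(1) assms(2) d] germ_self[OF p(1) assms(2)] by simp
    then show False using key[OF assms(2) d] assms(3) by blast
  qed
qed

lemma alg_iso_alg_unit: "alg_iso A (sections_alg \<C>) (alg_unit A)"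
proof (rule alg_isoI[OF sig alg_unit_in_alg_hom])
  have eq: "alg_unit A a = ar a" if "a \<in> carr A" for a using that by (simp add: alg_unit_def)
  show "bij_betw (alg_unit A) (carr A) dual.\<S>"
  proof (rule bij_betw_imageI)
    show "inj_on (alg_unit A) (carr A)"
      by (rule inj_onI) (simp add: eq alg_unit_inj)
    show "alg_unit A ` carr A = dual.\<S>"
    proof (intro equalityI subsetI)
      fix U assume "U \<in> dual.\<S>"
      from bexE[OF alg_unit_onto[OF this]] obtain c where "c \<in> carr A" "ar c = U" .
      then show "U \<in> alg_unit A ` carr A" using eq by (intro image_eqI[of _ _ c]) simp_all
    qed (use eq ar_section in \<open>auto simp del: dual.ops\<close>)
  qed
qed

end

lemma (in pf_rep_hom) alg_unit_natural:
  "alg_comp A (alg_unit A) (sections_hom B.\<C> A.\<C> F) = alg_comp A h (alg_unit B)"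
  unfolding alg_comp_def compose_def
proof (rule restrict_ext)
  fix a assume a: "a \<in> carr A"
  then have "sections_hom B.\<C> A.\<C> F (alg_unit A a) = {\<beta> \<in> germs B. farr F `` {\<beta>} \<inter> A.ar a \<noteq> {}}"
    using A.ar_section[OF a] by (simp add: sections_hom_def alg_unit_def B.Ar_dual)
  also have "\<dots> = alg_unit B (h a)" using dual_hom_preimage[OF a] a by (simp add: alg_unit_def)
  finally show "sections_hom B.\<C> A.\<C> F (alg_unit A a) = alg_unit B (h a)" .
qed

section \<open>The unit on categories\<close>

text \<open>Arrows lift uniquely along the bijection \<open>fa\<close>, and injectivity of
  \<open>fo\<close> forces the lift to start or end at the prescribed object; this gives the star
  conditions, the third one even with the given arrow itself.\<close>

lemma graph_in_cat_hom:
  assumes C: "small_category C"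
    and o: "homeomorphic_map (objs C) (objs D) fo" and a: "homeomorphic_map (arrs C) (arrs D) fa"
    and st: "\<And>f. f \<in> Ar C \<Longrightarrow> src D (fa f) = fo (src C f) \<and> tgt D (fa f) = fo (tgt C f)"
    and id: "\<And>x. x \<in> Ob C \<Longrightarrow> fa (idn C x) = idn D (fo x)"
    and cmp: "\<And>f g. (f, g) \<in> composable C \<Longrightarrow> fa (cmp C f g) = cmp D (fa f) (fa g)"
  shows "\<lparr>fobj = (\<lambda>x\<in>Ob C. fo x), farr = {(f, fa f) |f. f \<in> Ar C}\<rparr> \<in> cat_hom C D" (is "?F \<in> _")
proof (rule cat_homI)
  have O: "fo ` Ob C = Ob D" "inj_on fo (Ob C)" "continuous_map (objs C) (objs D) fo"
    using o by (simp_all add: homeomorphic_eq_everything_map)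
  have A: "fa ` Ar C = Ar D" "inj_on fa (Ar C)" "continuous_map (arrs C) (arrs D) fa"
    using a by (simp_all add: homeomorphic_eq_everything_map)
  have cat: "f \<in> Ar C \<Longrightarrow> src C f \<in> Ob C \<and> tgt C f \<in> Ob C" "x \<in> Ob C \<Longrightarrow> idn C x \<in> Ar C"
    "(f, g) \<in> composable C \<Longrightarrow> cmp C f g \<in> Ar C" for f g x
    using C unfolding small_category_def by blast+
  show "fobj ?F \<in> Ob C \<rightarrow>\<^sub>E Ob D" using O(1) by auto
  show "f \<in> Ar C \<and> g \<in> Ar D \<and> src D g = fobj ?F (src C f) \<and> tgt D g = fobj ?F (tgt C f)"
    if "(f, g) \<in> farr ?F" for f g using that st cat(1) A(1) by auto
  show "(idn C x, idn D (fobj ?F x)) \<in> farr ?F" if "x \<in> Ob C" for x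
    using that id cat(2) by simp
  show "(cmp C f1 f2, cmp D g1 g2) \<in> farr ?F"
    if "(f1, f2) \<in> composable C" "(f1, g1) \<in> farr ?F" "(f2, g2) \<in> farr ?F" for f1 f2 g1 g2
    using that cmp cat(3) by simp
  show "continuous_map (objs C) (objs D) (fobj ?F)"
    by (rule continuous_map_eq[OF O(3)]) simp
  show "openin (arrs C) {f \<in> Ar C. farr ?F `` {f} \<inter> U \<noteq> {}}" if "openin (arrs D) U" for U
  proof -
    have "{f \<in> Ar C. farr ?F `` {f} \<inter> U \<noteq> {}} = {f \<in> Ar C. fa f \<in> U}" by auto
    then show ?thesis using openin_continuous_map_preimage[OF A(3) that] by simp
  qed
  show "f1 = f2" if "(f1, g) \<in> farr ?F" "(f2, g) \<in> farr ?F" for f1 f2 g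
    using that inj_onD[OF A(2)] by auto
  have ex: "\<exists>f\<in>Ar C. g = fa f" if "g \<in> Ar D" for g using that A(1) by blast
  show "\<exists>f\<in>Ar C. src C f = x \<and> (f, g) \<in> farr ?F"
    if x: "x \<in> Ob C" "g \<in> Ar D" "src D g = fobj ?F x" for x g
  proof -
    obtain f where f: "f \<in> Ar C" "g = fa f" using ex[OF x(2)] by blast
    then have "src C f = x" using inj_onD[OF O(2), of "src C f" x] st[OF f(1)] cat(1)[OF f(1)] x by simp
    then show ?thesis using f by auto
  qed
  show "\<exists>g\<in>U. \<exists>f\<in>Ar C. tgt C f = x \<and> (f, g) \<in> farr ?F"
    if x: "x \<in> Ob C" "g \<in> U" "g \<in> Ar D" "tgt D g = fobj ?F x" for x U g
  proof -
    obtain f where f: "f \<in> Ar C" "g = fa f" using ex[OF x(3)] by blast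
    then have "tgt C f = x" using inj_onD[OF O(2), of "tgt C f" x] st[OF f(1)] cat(1)[OF f(1)] x by simp
    then show ?thesis using f x(2) by auto
  qed
qed

text \<open>The inverse is the graph of the inverse homeomorphisms, which satisfies the same
  hypotheses.\<close>

lemma graph_cat_iso:
  assumes C: "small_category C" and D: "small_category D"
    and o: "homeomorphic_map (objs C) (objs D) fo" and a: "homeomorphic_map (arrs C) (arrs D) fa"
    and st: "\<And>f. f \<in> Ar C \<Longrightarrow> src D (fa f) = fo (src C f) \<and> tgt D (fa f) = fo (tgt C f)"
    and id: "\<And>x. x \<in> Ob C \<Longrightarrow> fa (idn C x) = idn D (fo x)"
    and cmp: "\<And>f g. (f, g) \<in> composable C \<Longrightarrow> fa (cmp C f g) = cmp D (fa f) (fa g)"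
  shows "cat_iso C D \<lparr>fobj = (\<lambda>x\<in>Ob C. fo x), farr = {(f, fa f) |f. f \<in> Ar C}\<rparr>" (is "cat_iso C D ?F")
proof -
  obtain go where go: "homeomorphic_maps (objs C) (objs D) fo go" using o homeomorphic_map_maps by blast
  obtain ga where ga: "homeomorphic_maps (arrs C) (arrs D) fa ga" using a homeomorphic_map_maps by blast
  have o'1: "homeomorphic_map (objs D) (objs C) go" using go by (simp add: homeomorphic_maps_map)
  have o': "\<And>x. x \<in> Ob C \<Longrightarrow> fo x \<in> Ob D \<and> go (fo x) = x"
    "\<And>y. y \<in> Ob D \<Longrightarrow> go y \<in> Ob C \<and> fo (go y) = y"
    using go by (auto simp: homeomorphic_maps_def continuous_map_def)
  have a'1: "homeomorphic_map (arrs D) (arrs C) ga" using ga by (simp add: homeomorphic_maps_map)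
  have a': "\<And>x. x \<in> Ar C \<Longrightarrow> fa x \<in> Ar D \<and> ga (fa x) = x"
    "\<And>y. y \<in> Ar D \<Longrightarrow> ga y \<in> Ar C \<and> fa (ga y) = y"
    using ga by (auto simp: homeomorphic_maps_def continuous_map_def)
  have cC: "f \<in> Ar C \<Longrightarrow> src C f \<in> Ob C \<and> tgt C f \<in> Ob C" "x \<in> Ob C \<Longrightarrow> idn C x \<in> Ar C"
    "(f, g) \<in> composable C \<Longrightarrow> cmp C f g \<in> Ar C" for f g x
    using C unfolding small_category_def by blast+
  let ?G = "\<lparr>fobj = (\<lambda>x\<in>Ob D. go x), farr = {(f, ga f) |f. f \<in> Ar D}\<rparr>"
  have F: "?F \<in> cat_hom C D" by (rule graph_in_cat_hom[OF C o a st id cmp])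
  have st': "src C (ga g) = go (src D g) \<and> tgt C (ga g) = go (tgt D g)" if "g \<in> Ar D" for g
    using st[of "ga g"] a'(2)[OF that] cC(1)[of "ga g"] o'(1) by metis
  have G: "?G \<in> cat_hom D C"
  proof (rule graph_in_cat_hom[OF D o'1 a'1 st'])
    fix y assume y: "y \<in> Ob D"
    show "ga (idn D y) = idn C (go y)" using id[of "go y"] o'(2)[OF y] a'(1)[OF cC(2)] by metis
  next
    fix f g assume fg: "(f, g) \<in> composable D"
    then have A: "f \<in> Ar D" "g \<in> Ar D" "tgt D f = src D g" by (simp_all add: composable_def)
    then have c: "(ga f, ga g) \<in> composable C" using st' a'(2) by (simp add: composable_def)
    show "ga (cmp D f g) = cmp C (ga f) (ga g)"
      using cmp[OF c] a'(1)[OF cC(3)[OF c]] a'(2)[OF A(1)] a'(2)[OF A(2)] by simp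
  qed
  have "cat_comp C ?F ?G = cat_id C"
    unfolding cat_comp_def cat_id_def compose_def using o'(1) a'(1)
    by (auto intro!: restrict_ext simp: Id_on_iff relcomp_unfold)
  moreover have "cat_comp D ?G ?F = cat_id D"
    unfolding cat_comp_def cat_id_def compose_def using o'(2) a'(2)
    by (auto intro!: restrict_ext simp: Id_on_iff relcomp_unfold)
  ultimately show ?thesis using F G unfolding cat_iso_def by blast
qed

section \<open>Objects as ultrafilters and arrows as germs\<close>

context stone_etale
begin

lemma idn_mem: assumes K: "clopen K" and x: "x \<in> Ob C" shows "idn C x \<in> idn C ` K \<longleftrightarrow> x \<in> K"
proof
  assume "idn C x \<in> idn C ` K"
  then obtain y where y: "y \<in> K" "idn C x = idn C y" by blast
  have "x = src C (idn C y)" unfolding y(2)[symmetric] using x by simp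
  also have "\<dots> = y" using y(1) clopen_Ob[OF K] by auto
  finally show "x \<in> K" using y(1) by simp
qed (rule imageI)

lemma dom_elem_sectionE:
  assumes "e \<in> dom_elems \<A>" obtains K where "clopen K" "e = idn C ` K"
  using assms unfolding dom_elems_sections by blast

lemma adom_idn: assumes "clopen K" shows "adom \<A> (idn C ` K) = idn C ` (Ob C - K)"
proof -
  have "src C ` idn C ` K = K" using clopen_Ob[OF assms] by force
  then show ?thesis by simp
qed

lemma idn_prd: assumes K: "clopen K" and U: "U \<in> \<S>" shows "prd (idn C ` K) U = {f \<in> U. src C f \<in> K}"
proof (intro equalityI subsetI)
  fix h assume "h \<in> prd (idn C ` K) U"
  then obtain x g where x: "x \<in> K" "g \<in> U" "tgt C (idn C x) = src C g" "h = cmp C (idn C x) g" by blast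
  have "x = src C g" using x clopen_Ob[OF K] by auto
  then have "h = g" using x(4) cmp_idn(1)[OF section_Ar[OF U x(2)]] by simp
  then show "h \<in> {f \<in> U. src C f \<in> K}" using x(1,2) \<open>x = src C g\<close> by simp
next
  fix h assume h: "h \<in> {f \<in> U. src C f \<in> K}"
  then have "h \<in> Ar C" using section_Ar[OF U] by blast
  then have "h = cmp C (idn C (src C h)) h" "tgt C (idn C (src C h)) = src C h" by simp_all
  then show "h \<in> prd (idn C ` K) U" using h by blast
qed

lemma prd_idn: assumes K: "clopen K" and U: "U \<in> \<S>" shows "prd U (idn C ` K) = {f \<in> U. tgt C f \<in> K}"
proof (intro equalityI subsetI)
  fix h assume "h \<in> prd U (idn C ` K)"
  then obtain x g where x: "x \<in> K" "g \<in> U" "tgt C g = src C (idn C x)" "h = cmp C g (idn C x)" by blast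
  have "x = tgt C g" using x clopen_Ob[OF K] by auto
  then have "h = g" using x(4) cmp_idn(2)[OF section_Ar[OF U x(2)]] by simp
  then show "h \<in> {f \<in> U. tgt C f \<in> K}" using x(1,2) \<open>x = tgt C g\<close> by simp
next
  fix h assume h: "h \<in> {f \<in> U. tgt C f \<in> K}"
  then have "h \<in> Ar C" using section_Ar[OF U] by blast
  then have "h = cmp C h (idn C (tgt C h))" "tgt C h = src C (idn C (tgt C h))" by simp_all
  then show "h \<in> prd U (idn C ` K)" using h by blast
qed

lemma idn_prd_idn: assumes K: "clopen K" and L: "clopen L" shows "prd (idn C ` K) (idn C ` L) = idn C ` (K \<inter> L)"
  unfolding idn_prd[OF K idn_section[OF L]] using clopen_Ob[OF L] by force

text \<open>\<open>pt\<close> and \<open>gm\<close> are the components of \<open>cat_unit\<close> on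
  objects and on arrows.\<close>

abbreviation pt where "pt x \<equiv> {U \<in> dom_elems \<A>. idn C x \<in> U}"
abbreviation gm where "gm f \<equiv> {U \<in> \<S>. f \<in> U}"

lemma pt_mem: "clopen K \<Longrightarrow> x \<in> Ob C \<Longrightarrow> idn C ` K \<in> pt x \<longleftrightarrow> x \<in> K"
  using idn_mem dom_elems_sections by blast

lemma alg_ultrafilter_pt: assumes x: "x \<in> Ob C" shows "alg_ultrafilter \<A> (pt x)"
  unfolding alg_ultrafilter_def
proof (intro conjI ballI)
  fix d e assume "d \<in> dom_elems \<A>" "e \<in> dom_elems \<A>"
  then obtain K L where KL: "clopen K" "clopen L" "d = idn C ` K" "e = idn C ` L"
    unfolding dom_elems_sections by blast
  have "seq \<A> d e = idn C ` (K \<inter> L)" unfolding ops KL(3,4) by (rule idn_prd_idn[OF KL(1,2)])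
  then show "seq \<A> d e \<in> pt x \<longleftrightarrow> d \<in> pt x \<and> e \<in> pt x"
    unfolding KL(3,4) using pt_mem[OF _ x] KL(1,2) clopen_Int by simp
next
  fix e assume "e \<in> dom_elems \<A>"
  then obtain K where K: "clopen K" "e = idn C ` K" by (rule dom_elem_sectionE)
  show "adom \<A> e \<in> pt x \<longleftrightarrow> e \<notin> pt x"
    unfolding K(2) adom_idn[OF K(1)] pt_mem[OF K(1) x] pt_mem[OF clopen_compl[OF K(1)] x] using x by simp
qed blast

lemma pt_inj: assumes "x \<in> Ob C" "y \<in> Ob C" "pt x = pt y" shows "x = y"
proof (rule ccontr)
  assume "x \<noteq> y"
  then obtain K where "clopen K" "x \<in> K" "y \<notin> K"
    using objs_ts assms unfolding totally_separated_space_def clopen_def by blast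
  then show False using pt_mem[of K x] pt_mem[of K y] assms by blast
qed

lemma gm_inj: assumes f: "f \<in> Ar C" and g: "g \<in> Ar C" and eq: "gm f = gm g" "src C f = src C g" shows "f = g"
proof -
  obtain U where U: "U \<in> \<S>" "f \<in> U" using f by (rule section_ex[OF openin_topspace])
  then have "g \<in> U" using eq(1) by blast
  then show ?thesis using section_inj U eq(2) by blast
qed

end

text \<open>A representation of the algebra of sections is added as a parameter so that the theory
  of ultrafilters and germs applies to it, under the qualifier \<open>R\<close>.\<close>

locale stone_etale_rep = stone_etale C + R: pf_rep "sections_alg C" X \<phi>
  for C :: "('o, 'm) tcat" and X :: "'x set" and \<phi>
begin

text \<open>Otherwise every object is missed by a clopen set belonging to \<open>p\<close>. By
  compactness finitely many of them have empty intersection, and that intersection belongs to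
  \<open>p\<close> as well.\<close>

lemma pt_onto: assumes p: "R.uf p" shows "\<exists>x\<in>Ob C. p = pt x"
proof (rule ccontr)
  assume no: "\<not> (\<exists>x\<in>Ob C. p = pt x)"
  let ?\<U> = "{Ob C - K |K. clopen K \<and> idn C ` K \<in> p}"
  have "compactin (objs C) (Ob C)" using objs_compact by (simp add: compact_space_def)
  moreover have "\<forall>V\<in>?\<U>. openin (objs C) V" by (auto simp: clopen_def)
  moreover have "Ob C \<subseteq> \<Union>?\<U>"
  proof
    fix x assume x: "x \<in> Ob C"
    then have "\<not> p \<subseteq> pt x" using no R.uf_eqI[OF p alg_ultrafilter_pt[OF x]] by blast
    then obtain e where e: "e \<in> p" "e \<notin> pt x" by blast
    obtain K where K: "clopen K" "e = idn C ` K" using R.uf_E[OF p e(1)] by (rule dom_elem_sectionE)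
    have "x \<notin> K" using e(2) unfolding K(2) pt_mem[OF K(1) x] .
    then show "x \<in> \<Union>?\<U>" using K e(1) x by blast
  qed
  ultimately obtain \<F> where F: "finite \<F>" "\<F> \<subseteq> ?\<U>" "Ob C \<subseteq> \<Union>\<F>" unfolding compactin_def by meson
  have E: "idn C ` K \<in> R.E" if "clopen K" for K using that unfolding dom_elems_sections by blast
  have full: "idn C ` Ob C \<in> p"
  proof -
    obtain e where e: "e \<in> p" using R.uf_ex[OF p] .
    obtain K where K: "clopen K" "e = idn C ` K" using R.uf_E[OF p e] by (rule dom_elem_sectionE)
    have "seq \<A> e (idn C ` Ob C) = e"
      unfolding ops K(2) idn_prd_idn[OF K(1) clopen_full] using clopen_Ob[OF K(1)] by (simp add: Int_absorb2)
    then show ?thesis using R.uf_le[OF p e E[OF clopen_full]] by blast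
  qed
  \<comment> \<open>Induction along the finite subcover: \<open>p\<close> contains the identities on
    what is left uncovered. It starts with all objects, and at the end nothing is left.\<close>
  have "clopen (Ob C - \<Union>\<F>) \<and> idn C ` (Ob C - \<Union>\<F>) \<in> p" using F(1,2)
  proof (induction \<F>)
    case (insert V \<F>)
    then obtain K where K: "V = Ob C - K" "clopen K" "idn C ` K \<in> p" by blast
    let ?L = "Ob C - \<Union>\<F>"
    have L: "clopen ?L" "idn C ` ?L \<in> p" using insert by auto
    have eq: "Ob C - \<Union>(insert V \<F>) = K \<inter> ?L" using K(1) clopen_Ob[OF K(2)] by blast
    have "seq \<A> (idn C ` K) (idn C ` ?L) \<in> p"
      using R.uf_seq[OF p E[OF K(2)] E[OF L(1)]] K(3) L(2) by blast
    then have "idn C ` (K \<inter> ?L) \<in> p" unfolding ops idn_prd_idn[OF K(2) L(1)] .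
    then show ?case unfolding eq using clopen_Int K(2) L(1) by blast
  qed (simp add: full clopen_full)
  moreover have "Ob C - \<Union>\<F> = {}" using F(3) by blast
  ultimately have e: "clopen {}" "idn C ` {} \<in> p" by simp_all
  have "adom \<A> (idn C ` {}) \<in> p" unfolding adom_idn[OF e(1)] using full by simp
  then show False using R.uf_adom[OF p E[OF e(1)]] e(2) by blast
qed

lemma section_delta: assumes U: "U \<in> \<S>" shows "R.\<delta> U = idn C ` src C ` U"
proof -
  have "src C ` idn C ` (Ob C - src C ` U) = Ob C - src C ` U" by force
  then show ?thesis using clopen_Ob[OF section_src[OF U]] by (simp add: double_diff)
qed

lemma section_delta_pt: assumes U: "U \<in> \<S>" and x: "x \<in> Ob C" shows "R.\<delta> U \<in> pt x \<longleftrightarrow> x \<in> src C ` U"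
  unfolding section_delta[OF U] by (rule pt_mem[OF section_src[OF U] x])

text \<open>Two sections through \<open>f\<close> coincide near \<open>f\<close>: over a clopen set
  of sources of arrows in their open intersection, each has only the arrows of the intersection.
  Conversely, agreement over a neighbourhood of the source of \<open>f\<close> puts \<open>f\<close>
  in the other section.\<close>

lemma gm_eq_germ: assumes U: "U \<in> \<S>" and f: "f \<in> U" shows "gm f = germ \<A> (pt (src C f)) U"
proof (intro equalityI subsetI)
  have fA: "f \<in> Ar C" using section_Ar[OF U f] .
  fix V assume "V \<in> gm f"
  then have V: "V \<in> \<S>" "f \<in> V" by auto
  have "openin (objs C) (src C ` (U \<inter> V))" using open_src section_open U V by (simp add: open_map_def openin_Int)
  then obtain K where K: "clopen K" "src C f \<in> K" "K \<subseteq> src C ` (U \<inter> V)" using clopen_ex f V(2) by blast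
  have both: "g \<in> U \<and> g \<in> V" if W: "W \<in> \<S>" "U \<inter> V \<subseteq> W" "g \<in> W" "src C g \<in> K" for g W
  proof -
    obtain h where h: "h \<in> U \<inter> V" "src C g = src C h" using K(3) W(4) by blast
    then have "g = h" using section_inj[OF W(1,3)] W(2) by blast
    then show ?thesis using h(1) by blast
  qed
  have "{f \<in> U. src C f \<in> K} = {f \<in> V. src C f \<in> K}"
    using both[OF U Int_lower1] both[OF V(1) Int_lower2] by blast
  then have "seq \<A> (idn C ` K) U = seq \<A> (idn C ` K) V"
    unfolding ops idn_prd[OF K(1) U] idn_prd[OF K(1) V(1)] .
  moreover have "idn C ` K \<in> pt (src C f)" unfolding pt_mem[OF K(1) st_Ob(1)[OF fA]] by (rule K(2))
  ultimately show "V \<in> germ \<A> (pt (src C f)) U" unfolding germ_def using V(1) by blast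
next
  have fA: "f \<in> Ar C" using section_Ar[OF U f] .
  fix V assume "V \<in> germ \<A> (pt (src C f)) U"
  then obtain e where V: "V \<in> \<S>" "e \<in> pt (src C f)" "seq \<A> e U = seq \<A> e V"
    unfolding germ_def by blast
  then have "e \<in> R.E" by blast
  then obtain K where K: "clopen K" "e = idn C ` K" by (rule dom_elem_sectionE)
  have "src C f \<in> K" using V(2) unfolding K(2) pt_mem[OF K(1) st_Ob(1)[OF fA]] .
  moreover have "{f \<in> U. src C f \<in> K} = {f \<in> V. src C f \<in> K}"
    using V(3) unfolding ops K(2) idn_prd[OF K(1) U] idn_prd[OF K(1) V(1)] .
  ultimately show "V \<in> gm f" using f V(1) by blast
qed

lemma gm_germ: assumes f: "f \<in> Ar C"
  shows "gm f \<in> germs \<A>" "germ_src \<A> (gm f) = pt (src C f)"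
    "germ_tgt \<A> (gm f) = pt (tgt C f)"
proof -
  obtain U where U: "U \<in> \<S>" "f \<in> U" using f by (rule section_ex[OF openin_topspace])
  have p: "R.uf (pt (src C f))" using alg_ultrafilter_pt f by simp
  have d: "R.\<delta> U \<in> pt (src C f)" unfolding section_delta_pt[OF U(1) st_Ob(1)[OF f]] using U(2) by (rule imageI)
  show g: "gm f \<in> germs \<A>" "germ_src \<A> (gm f) = pt (src C f)"
    unfolding gm_eq_germ[OF U] using R.germ_in_germs[OF p U(1) d] R.germ_src_germ[OF p U(1) d] by blast+
  have "e \<in> pt (tgt C f)" if e: "e \<in> germ_tgt \<A> (gm f)" for e
  proof -
    have "U \<in> gm f" using U by blast
    then have eU: "e \<in> R.E" "seq \<A> U e \<in> gm f" using R.germ_tgt_iff[OF g(1)] e by blast+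
    obtain K where K: "clopen K" "e = idn C ` K" using eU(1) by (rule dom_elem_sectionE)
    have "f \<in> {f \<in> U. tgt C f \<in> K}" using eU(2) unfolding ops K(2) prd_idn[OF K(1) U(1)] by blast
    then show ?thesis unfolding K(2) pt_mem[OF K(1) st_Ob(2)[OF f]] by blast
  qed
  then show "germ_tgt \<A> (gm f) = pt (tgt C f)"
    by (intro R.uf_eqI R.uf_germ_tgt[OF g(1)] alg_ultrafilter_pt st_Ob(2)[OF f] subsetI)
qed

text \<open>The source of \<alpha> is a point \<open>x\<close>, and the domain condition for a
  representative \<open>U\<close> provides an arrow of \<open>U\<close> starting at
  \<open>x\<close>; this arrow has \<alpha> as its germ.\<close>

lemma gm_onto: assumes \<alpha>: "\<alpha> \<in> germs \<A>" shows "\<exists>f\<in>Ar C. \<alpha> = gm f"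
proof -
  obtain x where x: "x \<in> Ob C" "germ_src \<A> \<alpha> = pt x" using pt_onto[OF R.uf_germ_src[OF \<alpha>]] by blast
  obtain U where U: "U \<in> \<alpha>" using R.germ_nonempty[OF \<alpha>] .
  have US: "U \<in> \<S>" "R.\<delta> U \<in> pt x" using R.germ_rep(1,2)[OF \<alpha> U] x(2) by blast+
  then obtain f where f: "f \<in> U" "x = src C f" using section_delta_pt[OF US(1) x(1)] by blast
  have fA: "f \<in> Ar C" using section_Ar US f by blast
  have "U \<in> gm f" using US(1) f(1) by blast
  then have "\<alpha> = gm f" using R.germ_eqI[OF \<alpha> gm_germ(1)[OF fA] _ U] x(2) f(2) gm_germ(2)[OF fA] by simp
  then show ?thesis using fA by blast
qed

lemma gm_idn: assumes x: "x \<in> Ob C" shows "gm (idn C x) = idn R.\<C> (pt x)"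
proof -
  have A: "idn C x \<in> Ar C" using x by simp
  note i = R.germ_idn[OF alg_ultrafilter_pt[OF x]]
  have 1: "idn C ` Ob C \<in> pt x" unfolding pt_mem[OF clopen_full x] by (rule x)
  have 2: "idn C ` Ob C \<in> gm (idn C x)" using idn_section[OF clopen_full] x by blast
  have "germ_src \<A> (gm (idn C x)) = germ_src \<A> (idn R.\<C> (pt x))"
    unfolding gm_germ(2)[OF A] i(2) idn_simps(2)[OF x] by (rule refl)
  then show ?thesis by (rule R.germ_eqI[OF gm_germ(1)[OF A] i(1) _ 2 i(4)[OF 1]])
qed

lemma gm_cmp: assumes "(f, g) \<in> composable C" shows "gm (cmp C f g) = cmp R.\<C> (gm f) (gm g)"
proof -
  have fg: "f \<in> Ar C" "g \<in> Ar C" "tgt C f = src C g" using assms by (auto simp: composable_def)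
  have A: "cmp C f g \<in> Ar C" using fg by simp
  obtain U where U: "U \<in> \<S>" "f \<in> U" using fg(1) by (rule section_ex[OF openin_topspace])
  obtain V where V: "V \<in> \<S>" "g \<in> V" using fg(2) by (rule section_ex[OF openin_topspace])
  have st: "germ_tgt \<A> (gm f) = germ_src \<A> (gm g)"
    using gm_germ(3)[OF fg(1)] gm_germ(2)[OF fg(2)] fg(3) by simp
  note c = R.germ_comp[OF gm_germ(1)[OF fg(1)] gm_germ(1)[OF fg(2)] st]
  have "U \<in> gm f" "V \<in> gm g" using U V by blast+
  then have 1: "seq \<A> U V \<in> cmp R.\<C> (gm f) (gm g)" by (rule c(4))
  have "cmp C f g \<in> prd U V" using U V fg by blast
  then have 2: "seq \<A> U V \<in> gm (cmp C f g)" unfolding ops using section_seq[OF U(1) V(1)] by blast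
  have "germ_src \<A> (gm (cmp C f g)) = germ_src \<A> (cmp R.\<C> (gm f) (gm g))"
    unfolding c(2) gm_germ(2)[OF A] gm_germ(2)[OF fg(1)] using fg by simp
  then show ?thesis using R.germ_eqI[OF gm_germ(1)[OF A] c(1) _ 2 1] by blast
qed

text \<open>Clopen sets are a base of the objects, and \<open>pt\<close> matches a clopen
  \<open>K\<close> with the basic set of ultrafilters given by the identities on
  \<open>K\<close>.\<close>

lemma homeomorphic_pt: "homeomorphic_map (objs C) (objs R.\<C>) pt"
proof (rule bijective_open_imp_homeomorphic_map)
  have E: "idn C ` K \<in> R.E" if "clopen K" for K using that unfolding dom_elems_sections by blast
  show im: "pt ` Ob C = Ob R.\<C>"
    unfolding R.Ob_dual using alg_ultrafilter_pt pt_onto by blast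
  show "inj_on pt (Ob C)" by (rule inj_onI) (rule pt_inj)
  show "continuous_map (objs C) (objs R.\<C>) pt" unfolding continuous_map_def
  proof (intro conjI allI impI)
    show "pt \<in> Ob C \<rightarrow> Ob R.\<C>" using im by blast
    fix W assume W: "openin (objs R.\<C>) W"
    show "openin (objs C) {x \<in> Ob C. pt x \<in> W}"
    proof (subst openin_subopen, intro ballI)
      fix x assume "x \<in> {x \<in> Ob C. pt x \<in> W}"
      then have x: "x \<in> Ob C" "pt x \<in> W" by auto
      from bspec[OF W[unfolded R.openin_objs] x(2)]
      obtain e where e: "e \<in> R.E" "e \<in> pt x" and eW: "R.ob e \<subseteq> W" by (elim bexE conjE)
      obtain K where K: "clopen K" "e = idn C ` K" using e(1) by (rule dom_elem_sectionE)
      have "y \<in> {x \<in> Ob C. pt x \<in> W}" if y: "y \<in> K" for y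
      proof -
        have yO: "y \<in> Ob C" using y clopen_Ob K by blast
        have "idn C ` K \<in> pt y" unfolding pt_mem[OF K(1) yO] by (rule y)
        then have "pt y \<in> R.ob e" unfolding K(2) using alg_ultrafilter_pt[OF yO] by blast
        then show ?thesis using subsetD[OF eW] yO by simp
      qed
      moreover have "x \<in> K" using e(2) unfolding K(2) pt_mem[OF K(1) x(1)] .
      ultimately show "\<exists>T. openin (objs C) T \<and> x \<in> T \<and> T \<subseteq> {x \<in> Ob C. pt x \<in> W}"
        using K(1) unfolding clopen_def by (intro exI[of _ K] conjI subsetI) simp_all
    qed
  qed
  show "open_map (objs C) (objs R.\<C>) pt" unfolding open_map_def
  proof (intro allI impI)
    fix U assume U: "openin (objs C) U"
    show "openin (objs R.\<C>) (pt ` U)" unfolding R.openin_objs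
    proof
      fix p assume "p \<in> pt ` U"
      then obtain x where x: "x \<in> U" "p = pt x" by blast
      have xO: "x \<in> Ob C" using openin_subset[OF U] x(1) by blast
      obtain K where K: "clopen K" "x \<in> K" "K \<subseteq> U" using U x(1) by (rule clopen_ex)
      have "R.ob (idn C ` K) \<subseteq> pt ` U"
      proof
        fix q assume q: "q \<in> R.ob (idn C ` K)"
        then obtain y where y: "y \<in> Ob C" "q = pt y" using pt_onto by blast
        then have "y \<in> K" using q pt_mem[OF K(1) y(1)] by blast
        then show "q \<in> pt ` U" using y(2) K(3) by blast
      qed
      moreover have "idn C ` K \<in> p" unfolding x(2) pt_mem[OF K(1) xO] by (rule K(2))
      ultimately show "\<exists>e\<in>R.E. R.uf p \<and> e \<in> p \<and> R.ob e \<subseteq> pt ` U"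
        using E[OF K(1)] alg_ultrafilter_pt[OF xO] x(2) by (intro bexI[of _ "idn C ` K"] conjI) simp_all
    qed
  qed
qed

text \<open>Sections are a base of the arrows, and \<open>gm\<close> matches a section
  \<open>U\<close> with the basic set \<open>R.ar U\<close>.\<close>

lemma homeomorphic_gm: "homeomorphic_map (arrs C) (arrs R.\<C>) gm"
proof (rule bijective_open_imp_homeomorphic_map)
  show im: "gm ` Ar C = Ar R.\<C>"
  proof
    show "gm ` Ar C \<subseteq> Ar R.\<C>" unfolding R.Ar_dual using gm_germ(1) by blast
    show "Ar R.\<C> \<subseteq> gm ` Ar C" unfolding R.Ar_dual
    proof
      fix \<alpha> assume "\<alpha> \<in> germs \<A>"
      from gm_onto[OF this] show "\<alpha> \<in> gm ` Ar C" by (elim bexE) (rule image_eqI)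
    qed
  qed
  show "inj_on gm (Ar C)"
  proof (rule inj_onI)
    fix f g assume f: "f \<in> Ar C" "g \<in> Ar C" and eq: "gm f = gm g"
    have "pt (src C f) = pt (src C g)" using gm_germ(2)[OF f(1)] gm_germ(2)[OF f(2)] eq by simp
    then show "f = g" using gm_inj[OF f eq] pt_inj st_Ob(1) f by blast
  qed
  show "continuous_map (arrs C) (arrs R.\<C>) gm" unfolding continuous_map_def
  proof (intro conjI allI impI)
    show "gm \<in> Ar C \<rightarrow> Ar R.\<C>" using im by blast
    fix W assume W: "openin (arrs R.\<C>) W"
    show "openin (arrs C) {f \<in> Ar C. gm f \<in> W}"
    proof (subst openin_subopen, intro ballI)
      fix f assume "f \<in> {f \<in> Ar C. gm f \<in> W}"
      then have f: "f \<in> Ar C" "gm f \<in> W" by auto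
      from bspec[OF W[unfolded R.openin_arrs] f(2)]
      obtain U where U: "U \<in> \<S>" "U \<in> gm f" and UW: "R.ar U \<subseteq> W" by (elim bexE conjE)
      have "g \<in> {f \<in> Ar C. gm f \<in> W}" if g: "g \<in> U" for g
      proof -
        have gA: "g \<in> Ar C" using section_Ar[OF U(1) g] .
        then have "gm g \<in> R.ar U" using gm_germ(1)[OF gA] g U(1) by simp
        then show ?thesis using subsetD[OF UW] gA by simp
      qed
      then show "\<exists>T. openin (arrs C) T \<and> f \<in> T \<and> T \<subseteq> {f \<in> Ar C. gm f \<in> W}"
        using U section_open by (intro exI[of _ U] conjI subsetI) simp_all
    qed
  qed
  show "open_map (arrs C) (arrs R.\<C>) gm" unfolding open_map_def
  proof (intro allI impI)
    fix W assume W: "openin (arrs C) W"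
    show "openin (arrs R.\<C>) (gm ` W)" unfolding R.openin_arrs
    proof
      fix \<alpha> assume "\<alpha> \<in> gm ` W"
      then obtain f where f: "f \<in> W" "\<alpha> = gm f" by blast
      have fA: "f \<in> Ar C" using openin_subset[OF W] f(1) by blast
      obtain U where U: "U \<in> \<S>" "f \<in> U" "U \<subseteq> W" using W f(1) by (rule section_ex)
      have "R.ar U \<subseteq> gm ` W"
      proof
        fix \<beta> assume \<beta>: "\<beta> \<in> R.ar U"
        then have "\<beta> \<in> germs \<A>" by simp
        from bexE[OF gm_onto[OF this]] obtain g where g: "g \<in> Ar C" "\<beta> = gm g" .
        then have "g \<in> W" using \<beta> U(3) by blast
        then show "\<beta> \<in> gm ` W" using g(2) by blast
      qed
      moreover have "U \<in> \<alpha>" using f(2) U by blast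
      ultimately show "\<exists>a\<in>\<S>. \<alpha> \<in> germs \<A> \<and> a \<in> \<alpha> \<and> R.ar a \<subseteq> gm ` W"
        using gm_germ(1)[OF fA] f(2) U(1) by (intro bexI[of _ U] conjI) simp_all
    qed
  qed
qed

lemma cat_iso_cat_unit: "cat_iso C R.\<C> (cat_unit C)"
  unfolding cat_unit_def
proof (rule graph_cat_iso[OF cat R.small_category_dual homeomorphic_pt homeomorphic_gm])
  show "src R.\<C> (gm f) = pt (src C f) \<and> tgt R.\<C> (gm f) = pt (tgt C f)" if "f \<in> Ar C" for f
    using gm_germ(2,3)[OF that] by simp
qed (rule gm_idn gm_cmp, assumption)+

end

text \<open>On objects this is an inclusion of ultrafilters, given by preservation of identities. On
  arrows, a germ related to that of \<open>f\<close> comes from an arrow \<open>g\<close>, and a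
  section through \<open>g\<close> yields a relative of \<open>f\<close>; agreement of sources shows
  that this relative is \<open>g\<close>.\<close>

lemma cat_unit_natural:
  fixes C :: "('o, 'm) tcat" and D :: "('p, 'n) tcat"
  assumes C: "Stone_etale_epi C" and D: "Stone_etale_epi D" and F: "F \<in> cat_hom C D"
  shows "cat_comp C (cat_unit C) (dual_hom (sections_alg D) (sections_alg C) (sections_hom C D F)) =
    cat_comp C F (cat_unit D)"
proof -
  obtain X :: "('m set \<times> bool) list set" and \<phi> where X: "pf_rep (sections_alg C) X \<phi>" using representable_pf_rep[OF stone_etale.representable_sections[OF stone_etale.intro[OF C]]] .
  obtain Y :: "('n set \<times> bool) list set" and \<psi> where Y: "pf_rep (sections_alg D) Y \<psi>" using representable_pf_rep[OF stone_etale.representable_sections[OF stone_etale.intro[OF D]]] .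
  interpret C: stone_etale_rep C X \<phi> using X C by (simp add: stone_etale_rep_def stone_etale_def)
  interpret D: stone_etale_rep D Y \<psi> using Y D by (simp add: stone_etale_rep_def stone_etale_def)
  interpret H: stone_etale_hom C D F
    using assms by (simp add: stone_etale_hom_def stone_etale_def stone_etale_hom_axioms_def)
  let ?h = "sections_hom C D F"
  interpret K: pf_rep_hom "sections_alg D" Y \<psi> "sections_alg C" X \<phi> ?h
    using X Y H.sections_hom_in_alg_hom by (simp add: pf_rep_hom_def pf_rep_hom_axioms_def)
  have ptF: "K.pull (C.pt x) = D.pt (fobj F x)" if x: "x \<in> Ob C" for x
  proof (rule D.R.uf_eqI[symmetric, OF D.alg_ultrafilter_pt[OF H.F_Ob[OF x]] K.uf_pull[OF C.alg_ultrafilter_pt[OF x]]], rule subsetI)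
    fix e assume e: "e \<in> D.pt (fobj F x)"
    then have E: "e \<in> D.R.E" "idn D (fobj F x) \<in> e" by blast+
    have "?h e \<in> C.R.E" using K.hom_E[OF E(1)] .
    moreover have "idn C x \<in> ?h e"
      unfolding H.sections_hom_eq[OF D.R.E_carr[OF E(1)]] using cat_homD(3)[OF F x] E(2) H.F_Ar(1) by blast
    ultimately show "e \<in> K.pull (C.pt x)" using E(1) by blast
  qed
  have "(\<lambda>x\<in>Ob C. fobj K.F (fobj (cat_unit C) x)) = (\<lambda>x\<in>Ob C. fobj (cat_unit D) (fobj F x))"
  proof (rule restrict_ext)
    fix x assume x: "x \<in> Ob C"
    have "fobj (cat_unit C) x = C.pt x" "fobj (cat_unit D) (fobj F x) = D.pt (fobj F x)"
      using x H.F_Ob[OF x] by (simp_all add: cat_unit_def)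
    then show "fobj K.F (fobj (cat_unit C) x) = fobj (cat_unit D) (fobj F x)"
      using K.fobj_dual_hom[OF C.alg_ultrafilter_pt[OF x]] ptF[OF x] by (simp only:)
  qed
  moreover have "farr (cat_unit C) O farr K.F = farr F O farr (cat_unit D)"
  proof -
    have L: "(f, \<alpha>) \<in> farr (cat_unit C) O farr K.F \<longleftrightarrow> f \<in> Ar C \<and> (C.gm f, \<alpha>) \<in> farr K.F" for f \<alpha>
      unfolding cat_unit_def mvf.simps by blast
    have R: "(f, \<alpha>) \<in> farr F O farr (cat_unit D) \<longleftrightarrow> (\<exists>g\<in>Ar D. (f, g) \<in> farr F \<and> \<alpha> = D.gm g)" for f \<alpha>
      unfolding cat_unit_def mvf.simps by blast
    have "(f, \<alpha>) \<in> farr (cat_unit C) O farr K.F \<longleftrightarrow> (f, \<alpha>) \<in> farr F O farr (cat_unit D)" for f \<alpha>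
      unfolding L R K.farr_dual_hom
    proof
      assume a: "f \<in> Ar C \<and> C.gm f \<in> germs (sections_alg C) \<and> \<alpha> \<in> germs (sections_alg D) \<and> ?h ` \<alpha> \<subseteq> C.gm f"
      note f = conjunct1[OF a] and \<alpha> = conjunct1[OF conjunct2[OF conjunct2[OF a]]]
        and sub = conjunct2[OF conjunct2[OF conjunct2[OF a]]]
      from bexE[OF D.gm_onto[OF \<alpha>]] obtain g where g: "g \<in> Ar D" "\<alpha> = D.gm g" .
      have "D.pt (src D g) = K.pull (C.pt (src C f))"
        using K.hom_germ_src_tgt(1)[OF \<alpha> C.gm_germ(1)[OF f] sub] unfolding C.gm_germ(2)[OF f] g(2) D.gm_germ(2)[OF g(1)] .
      then have "D.pt (src D g) = D.pt (fobj F (src C f))" unfolding ptF[OF C.st_Ob(1)[OF f]] .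
      then have s: "src D g = fobj F (src C f)"
        by (rule D.pt_inj[OF D.st_Ob(1)[OF g(1)] H.F_Ob[OF C.st_Ob(1)[OF f]]])
      obtain U where U: "U \<in> D.\<S>" "g \<in> U" using g(1) by (rule D.section_ex[OF openin_topspace])
      have "?h U \<in> C.gm f" using sub g(2) U by blast
      then have "f \<in> H.inv_F U" unfolding H.sections_hom_eq[OF U(1)] by blast
      then obtain g' where g': "(f, g') \<in> farr F" "g' \<in> U" by blast
      then have "g' = g" using D.section_inj[OF U(1) g'(2) U(2)] H.F_Ar(3)[OF g'(1)] s by simp
      then show "\<exists>g\<in>Ar D. (f, g) \<in> farr F \<and> \<alpha> = D.gm g" using g g'(1) by blast
    next
      assume "\<exists>g\<in>Ar D. (f, g) \<in> farr F \<and> \<alpha> = D.gm g"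
      then obtain g where g: "g \<in> Ar D" "(f, g) \<in> farr F" "\<alpha> = D.gm g" by (elim bexE conjE)
      have f: "f \<in> Ar C" using H.F_Ar(1)[OF g(2)] .
      have "?h U \<in> C.gm f" if "U \<in> D.gm g" for U
      proof -
        have U: "U \<in> D.\<S>" "g \<in> U" using that by blast+
        show ?thesis unfolding H.sections_hom_eq[OF U(1)] using H.inv_section[OF U(1)] f g(2) U(2) by blast
      qed
      then have "?h ` \<alpha> \<subseteq> C.gm f" unfolding g(3) by (rule image_subsetI)
      then show "f \<in> Ar C \<and> C.gm f \<in> germs (sections_alg C) \<and> \<alpha> \<in> germs (sections_alg D) \<and> ?h ` \<alpha> \<subseteq> C.gm f"
        using f C.gm_germ(1)[OF f] D.gm_germ(1)[OF g(1)] unfolding g(3) by (intro conjI)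
    qed
    then show ?thesis by (intro set_eqI) (simp only: split_paired_all)
  qed
  ultimately show ?thesis unfolding cat_comp_def compose_def by (simp only:)
qed

section \<open>The duality\<close>

lemma alg_id_in_alg_hom: "algebra_sig A \<Longrightarrow> alg_id A \<in> alg_hom A A"
  by (auto simp: alg_hom_def alg_id_def algebra_sig_def)

lemma alg_comp_id:
  assumes "h \<in> alg_hom A B"
  shows "alg_comp A (alg_id A) h = h" "alg_comp A h (alg_id B) = h"
proof -
  have "h \<in> carr A \<rightarrow>\<^sub>E carr B" using assms by (simp add: alg_hom_def)
  then show "alg_comp A (alg_id A) h = h" "alg_comp A h (alg_id B) = h"
    by (auto simp: alg_comp_def alg_id_def compose_def fun_eq_iff extensional_def PiE_iff)
qed

lemma alg_comp_in_alg_hom: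
  assumes A: "algebra_sig A" and h: "h \<in> alg_hom A B" and k: "k \<in> alg_hom B C"
  shows "alg_comp A h k \<in> alg_hom A C"
proof -
  have "adom A a \<in> carr A" "rng A a \<in> carr A" "seq A a b \<in> carr A" "pref A a b \<in> carr A"
    if "a \<in> carr A" "b \<in> carr A" for a b using A that by (auto simp: algebra_sig_def)
  moreover have "h a \<in> carr B" if "a \<in> carr A" for a using h that by (auto simp: alg_hom_def)
  ultimately show ?thesis using h k
    by (auto simp: alg_hom_def alg_comp_def compose_def)
qed

lemma alg_comp_assoc:
  assumes "h \<in> alg_hom A B"
  shows "alg_comp A (alg_comp A h k) l = alg_comp A h (alg_comp B k l)"
proof -
  have "h a \<in> carr B" if "a \<in> carr A" for a using assms that by (auto simp: alg_hom_def)
  then show ?thesis by (auto simp: alg_comp_def compose_def fun_eq_iff)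
qed

lemma representable_sig: "representable A \<Longrightarrow> algebra_sig A"
  by (simp add: representable_def representable_over_def)

text \<open>A representation is chosen inside the proof, which frees the results of the locale from
  it; the next lemmas do the same for homomorphisms.\<close>

lemma representable_dual:
  fixes A :: "'a alg"
  assumes "representable A"
  shows "Stone_etale_epi (dual_cat A)" "dual_hom A A (alg_id A) = cat_id (dual_cat A)"
    "alg_iso A (sections_alg (dual_cat A)) (alg_unit A)"
proof -
  obtain X :: "('a \<times> bool) list set" and \<phi> where "pf_rep A X \<phi>" using representable_pf_rep[OF assms] .
  then interpret pf_rep A X \<phi> .
  show "Stone_etale_epi (dual_cat A)" "dual_hom A A (alg_id A) = cat_id (dual_cat A)"
    "alg_iso A (sections_alg (dual_cat A)) (alg_unit A)"
    by (rule Stone_etale_epi_dual dual_hom_alg_id alg_iso_alg_unit)+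
qed

lemma representable_dual_hom:
  fixes A :: "'a alg" and B :: "'b alg"
  assumes "representable A" "representable B" "h \<in> alg_hom A B"
  shows "dual_hom A B h \<in> cat_hom (dual_cat B) (dual_cat A)"
    "alg_comp A (alg_unit A) (sections_hom (dual_cat B) (dual_cat A) (dual_hom A B h)) = alg_comp A h (alg_unit B)"
proof -
  obtain X :: "('a \<times> bool) list set" and \<phi> where X: "pf_rep A X \<phi>" using representable_pf_rep[OF assms(1)] .
  obtain Y :: "('b \<times> bool) list set" and \<psi> where Y: "pf_rep B Y \<psi>" using representable_pf_rep[OF assms(2)] .
  interpret pf_rep_hom A X \<phi> B Y \<psi> h using X Y assms(3) by (simp add: pf_rep_hom_def pf_rep_hom_axioms_def)
  show "dual_hom A B h \<in> cat_hom (dual_cat B) (dual_cat A)"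
    "alg_comp A (alg_unit A) (sections_hom (dual_cat B) (dual_cat A) (dual_hom A B h)) = alg_comp A h (alg_unit B)"
    by (rule dual_hom_in_cat_hom alg_unit_natural)+
qed

lemma representable_dual_hom_comp:
  fixes A :: "'a alg" and B :: "'b alg" and C :: "'c alg"
  assumes "representable A" "representable B" "representable C" "h \<in> alg_hom A B" "k \<in> alg_hom B C"
  shows "dual_hom A C (alg_comp A h k) = cat_comp (dual_cat C) (dual_hom B C k) (dual_hom A B h)"
proof -
  obtain X :: "('a \<times> bool) list set" and \<phi> where X: "pf_rep A X \<phi>" using representable_pf_rep[OF assms(1)] .
  obtain Y :: "('b \<times> bool) list set" and \<psi> where Y: "pf_rep B Y \<psi>" using representable_pf_rep[OF assms(2)] .
  obtain Z :: "('c \<times> bool) list set" and \<rho> where Z: "pf_rep C Z \<rho>" using representable_pf_rep[OF assms(3)] .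
  show ?thesis by (rule dual_hom_alg_comp[OF X Y Z assms(4,5)])
qed

lemma Stone_etale_epi_sections:
  fixes C :: "('o, 'm) tcat"
  assumes "Stone_etale_epi C"
  shows "representable (sections_alg C)" "sections_hom C C (cat_id C) = alg_id (sections_alg C)"
    "cat_iso C (dual_cat (sections_alg C)) (cat_unit C)"
proof -
  interpret stone_etale C by standard (rule assms)
  show r: "representable (sections_alg C)" "sections_hom C C (cat_id C) = alg_id (sections_alg C)"
    by (rule representable_sections sections_hom_cat_id)+
  obtain X :: "('m set \<times> bool) list set" and \<phi> where "pf_rep (sections_alg C) X \<phi>" using representable_pf_rep[OF r(1)] .
  then interpret stone_etale_rep C X \<phi> by (simp add: stone_etale_rep_def stone_etale_axioms)
  show "cat_iso C (dual_cat (sections_alg C)) (cat_unit C)" by (rule cat_iso_cat_unit)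
qed

lemma Stone_etale_epi_sections_hom:
  assumes "Stone_etale_epi C" "Stone_etale_epi D" "F \<in> cat_hom C D"
  shows "sections_hom C D F \<in> alg_hom (sections_alg D) (sections_alg C)"
proof -
  interpret stone_etale_hom C D F
    using assms by (simp add: stone_etale_hom_def stone_etale_def stone_etale_hom_axioms_def)
  show ?thesis by (rule sections_hom_in_alg_hom)
qed

text \<open>Dualising changes the types: an algebra on one type yields a category on sets over it.
  The laws are therefore stated for independent type variables, so that they also cover morphisms
  between an object and its double dual.\<close>

theorem theorem3p7:
  shows
    "\<comment> \<open>representable algebras and homomorphisms form a category\<close>
     ((\<forall>A :: 'a alg. representable A \<longrightarrow> alg_id A \<in> alg_hom A A) \<and>
      (\<forall>(A :: 'a alg) (B :: 'b alg) h. representable A \<and> representable B \<and> h \<in> alg_hom A B \<longrightarrow>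
         alg_comp A (alg_id A) h = h \<and> alg_comp A h (alg_id B) = h) \<and>
      (\<forall>(A :: 'a alg) (B :: 'b alg) (C :: 'c alg) h k.
         representable A \<and> representable B \<and> representable C \<and>
         h \<in> alg_hom A B \<and> k \<in> alg_hom B C \<longrightarrow> alg_comp A h k \<in> alg_hom A C) \<and>
      (\<forall>(A :: 'a alg) (B :: 'b alg) (C :: 'c alg) (D :: 'd alg) h k l.
         representable A \<and> representable B \<and> representable C \<and> representable D \<and>
         h \<in> alg_hom A B \<and> k \<in> alg_hom B C \<and> l \<in> alg_hom C D \<longrightarrow>
         alg_comp A (alg_comp A h k) l = alg_comp A h (alg_comp B k l)))
    \<and>
    \<comment> \<open>Stone etale categories with all arrows epi and star-coherent functors form a category\<close>
     ((\<forall>A :: ('o1, 'm1) tcat. Stone_etale_epi A \<longrightarrow> cat_id A \<in> cat_hom A A) \<and>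
      (\<forall>(A :: ('o1, 'm1) tcat) (B :: ('o2, 'm2) tcat) F.
         Stone_etale_epi A \<and> Stone_etale_epi B \<and> F \<in> cat_hom A B \<longrightarrow>
         cat_comp A (cat_id A) F = F \<and> cat_comp A F (cat_id B) = F) \<and>
      (\<forall>(A :: ('o1, 'm1) tcat) (B :: ('o2, 'm2) tcat) (C :: ('o3, 'm3) tcat) F G.
         Stone_etale_epi A \<and> Stone_etale_epi B \<and> Stone_etale_epi C \<and>
         F \<in> cat_hom A B \<and> G \<in> cat_hom B C \<longrightarrow> cat_comp A F G \<in> cat_hom A C) \<and>
      (\<forall>(A :: ('o1, 'm1) tcat) (B :: ('o2, 'm2) tcat) (C :: ('o3, 'm3) tcat)
         (D :: ('o4, 'm4) tcat) F G H.
         Stone_etale_epi A \<and> Stone_etale_epi B \<and> Stone_etale_epi C \<and> Stone_etale_epi D \<and>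
         F \<in> cat_hom A B \<and> G \<in> cat_hom B C \<and> H \<in> cat_hom C D \<longrightarrow>
         cat_comp A (cat_comp A F G) H = cat_comp A F (cat_comp B G H)))
    \<and>
    \<comment> \<open>contravariant functor from algebras to categories\<close>
     ((\<forall>A :: 'a alg. representable A \<longrightarrow>
         Stone_etale_epi (dual_cat A) \<and> dual_hom A A (alg_id A) = cat_id (dual_cat A)) \<and>
      (\<forall>(A :: 'a alg) (B :: 'b alg) h. representable A \<and> representable B \<and> h \<in> alg_hom A B \<longrightarrow>
         dual_hom A B h \<in> cat_hom (dual_cat B) (dual_cat A)) \<and>
      (\<forall>(A :: 'a alg) (B :: 'b alg) (C :: 'c alg) h k.
         representable A \<and> representable B \<and> representable C \<and>
         h \<in> alg_hom A B \<and> k \<in> alg_hom B C \<longrightarrow>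
         dual_hom A C (alg_comp A h k) =
           cat_comp (dual_cat C) (dual_hom B C k) (dual_hom A B h)))
    \<and>
    \<comment> \<open>contravariant functor from categories to algebras\<close>
     ((\<forall>A :: ('o1, 'm1) tcat. Stone_etale_epi A \<longrightarrow>
         representable (sections_alg A) \<and> sections_hom A A (cat_id A) = alg_id (sections_alg A)) \<and>
      (\<forall>(A :: ('o1, 'm1) tcat) (B :: ('o2, 'm2) tcat) F.
         Stone_etale_epi A \<and> Stone_etale_epi B \<and> F \<in> cat_hom A B \<longrightarrow>
         sections_hom A B F \<in> alg_hom (sections_alg B) (sections_alg A)) \<and>
      (\<forall>(A :: ('o1, 'm1) tcat) (B :: ('o2, 'm2) tcat) (C :: ('o3, 'm3) tcat) F G.
         Stone_etale_epi A \<and> Stone_etale_epi B \<and> Stone_etale_epi C \<and>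
         F \<in> cat_hom A B \<and> G \<in> cat_hom B C \<longrightarrow>
         sections_hom A C (cat_comp A F G) =
           alg_comp (sections_alg C) (sections_hom B C G) (sections_hom A B F)))
    \<and>
    \<comment> \<open>natural isomorphism from the identity to the double dual on algebras\<close>
     ((\<forall>A :: 'a alg. representable A \<longrightarrow> alg_iso A (sections_alg (dual_cat A)) (alg_unit A)) \<and>
      (\<forall>(A :: 'a alg) (B :: 'b alg) h. representable A \<and> representable B \<and> h \<in> alg_hom A B \<longrightarrow>
         alg_comp A (alg_unit A) (sections_hom (dual_cat B) (dual_cat A) (dual_hom A B h)) =
           alg_comp A h (alg_unit B)))
    \<and>
    \<comment> \<open>natural isomorphism from the identity to the double dual on categories\<close>
     ((\<forall>A :: ('o1, 'm1) tcat. Stone_etale_epi A \<longrightarrow>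
         cat_iso A (dual_cat (sections_alg A)) (cat_unit A)) \<and>
      (\<forall>(A :: ('o1, 'm1) tcat) (B :: ('o2, 'm2) tcat) F.
         Stone_etale_epi A \<and> Stone_etale_epi B \<and> F \<in> cat_hom A B \<longrightarrow>
         cat_comp A (cat_unit A)
             (dual_hom (sections_alg B) (sections_alg A) (sections_hom A B F)) =
           cat_comp A F (cat_unit B)))"
  by (intro conjI allI impI; (elim conjE)?)
    (rule alg_id_in_alg_hom alg_comp_id alg_comp_in_alg_hom alg_comp_assoc
      cat_id_in_cat_hom cat_comp_id cat_comp_in_cat_hom cat_comp_assoc
      representable_dual representable_dual_hom representable_dual_hom_comp
      Stone_etale_epi_sections Stone_etale_epi_sections_hom sections_hom_cat_comp cat_unit_natural,
      (assumption | erule representable_sig)+)+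

end
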